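(* Let $G$ be a graph with maximum degree at most $3$ and girth at least $5$. Then $$\nu_{ur}(G) \geq \frac{n(G)-\kappa_G(\mathcal{G})-\kappa_G(\mathcal{G}_3)-\kappa_G(\{H_1,H_2\})}{3}.$$
   Context: A matching $M$ in a graph $G$ is uniquely restricted if no other matching in $G$ covers the same set of vertices; $\nu_{ur}(G)$ is the maximum size of such a matching; $\nu(G)$ is the matching number; $n(G)$ the number of vertices. Girth at least $5$ means no cycles of length $3$ or $4$. For a set $\mathcal{H}$ of connected graphs, $\kappa_G(\mathcal{H})$ is the number of connected components of $G$ isomorphic to a graph in $\mathcal{H}$. $\mathcal{G}_3$ is the set of cubic graphs of girth at least $5$. Gallai–Edmonds sets: for a graph $G$, $D_G$ is the set of vertices not covered by at least one maximum matching, $A_G=N_G(D_G)\setminus D_G$, $C_G=V(G)\setminus(A_G\cup D_G)$. $\mathcal{T}$ is the set of all trees $T$ such that every vertex of $A_T$ has degree at most $3$ in $T$ and $\nu(T)=\frac{n(T)-1}{3}$. The graphs $G_1,\dots,G_9$: $G_1$ has vertices $a_1,\dots,a_4$ and $s_{ij}$ ($1\le i<j\le4$), edges $a_is_{ij},a_js_{ij}$ (subdivided $K_4$). $G_2$: add to $G_1$ vertices $t_1,t_2,t_3$ with $t_1\sim s_{14},s_{23}$; $t_2\sim s_{24},s_{13}$; $t_3\sim s_{12},s_{34}$. $G_5$: add to $G_2$ vertices $p,q,r$ and edges $pt_1,pt_2,pq,qr,rt_3$. $G_6$: add to $G_2$ a $6$-cycle $d_0d_1\dots d_5d_0$ and edges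 $d_0t_1,d_2t_2,d_4t_3$. $G_3$ has vertices $z,w_0,w_2,w_4,b_0,\dots,b_5,c_0,\dots,c_5$ and edges $b_ib_{i+1}$, $c_ic_{i+1}$ ($i=0,\dots,5$, indices mod $6$), and $zw_j,w_jb_j,w_jc_j$ for $j\in\{0,2,4\}$. $G_4$: add to $G_3$ vertices $w_1,w_3,w_5$ with $w_j\sim b_j,c_j$ for $j\in\{1,3,5\}$. $G_7$: add to $G_3$ vertices $y_0,y_1,y_2$ and edges $y_0y_1,y_0y_2,y_1b_3,y_1c_5,y_2c_3,y_2b_5$. $G_8$: add to $G_4$ vertices $p,q,r$ and edges $pw_1,pw_3,pq,qr,rw_5$. $G_9$: add to $G_4$ a $6$-cycle $d_0d_1\dots d_5d_0$ and edges $d_0w_1,d_2w_3,d_4w_5$. Let $\mathcal{B}=\{G_1,\dots,G_9\}$; each has maximum degree $3$ and minimum degree $2$. Replacement: let $H\in\mathcal{B}$ with degree-$2$ vertices $u_1,\dots,u_k$, let $T\in\mathcal{T}$ and $u\in D_T$ with neighbors $v_1,\dots,v_\ell$ in $T$ where $\ell\le k$. A graph arises from $T$ by replacing $u$ by $H$ if it arises from the disjoint union of $T-u$ and $H$ by adding edges $u_{i_1}v_1,\dots,u_{i_\ell}v_\ell$ for some distinct indices $i_1,\dots,i_\ell\in[k]$. $\mathcal{G}$ is the set of graphs that arise from a tree $T\in\mathcal{T}$ (the host tree) by replacing some (possibly no) vertices of $D_T$ by graphs in $\mathcal{B}$ (each replaced independently). $H_1$ arises from $G_2$ by adding a new vertex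 adjacent to $t_1,t_2,t_3$; $H_2$ arises from $G_4$ by adding a new vertex adjacent to $w_1,w_3,w_5$. *)

theory Defs
  imports Complex_Main
begin

definition graph :: "'a set \<Rightarrow> 'a set set \<Rightarrow> bool" where
  "graph V E \<longleftrightarrow> finite V \<and> (\<forall>e\<in>E. \<exists>u v. e = {u, v} \<and> u \<noteq> v \<and> u \<in> V \<and> v \<in> V)"

definition degree :: "'a set set \<Rightarrow> 'a \<Rightarrow> nat" where
  "degree E v = card {u. {u, v} \<in> E}"

definition max_degree_le :: "'a set \<Rightarrow> 'a set set \<Rightarrow> nat \<Rightarrow> bool" where
  "max_degree_le V E k \<longleftrightarrow> (\<forall>v\<in>V. degree E v \<le> k)"

definition is_cycle :: "'a set set \<Rightarrow> 'a list \<Rightarrow> bool" where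
  "is_cycle E xs \<longleftrightarrow> length xs \<ge> 3 \<and> distinct xs \<and>
     (\<forall>i < length xs. {xs ! i, xs ! ((i + 1) mod length xs)} \<in> E)"

definition girth_ge :: "'a set set \<Rightarrow> nat \<Rightarrow> bool" where
  "girth_ge E k \<longleftrightarrow> (\<forall>xs. is_cycle E xs \<longrightarrow> length xs \<ge> k)"

definition reach :: "'a set set \<Rightarrow> 'a \<Rightarrow> 'a \<Rightarrow> bool" where
  "reach E = (\<lambda>x y. {x, y} \<in> E)\<^sup>*\<^sup>*"

definition connected_graph :: "'a set \<Rightarrow> 'a set set \<Rightarrow> bool" where
  "connected_graph V E \<longleftrightarrow> (\<forall>u\<in>V. \<forall>v\<in>V. reach E u v)"

definition tree :: "'a set \<Rightarrow> 'a set set \<Rightarrow> bool" where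
  "tree V E \<longleftrightarrow> graph V E \<and> V \<noteq> {} \<and> connected_graph V E \<and> (\<forall>xs. \<not> is_cycle E xs)"

definition components :: "'a set \<Rightarrow> 'a set set \<Rightarrow> 'a set set" where
  "components V E = {{w \<in> V. reach E v w} | v. v \<in> V}"

definition induced_edges :: "'a set set \<Rightarrow> 'a set \<Rightarrow> 'a set set" where
  "induced_edges E C = {e \<in> E. e \<subseteq> C}"

definition iso :: "'a set \<Rightarrow> 'a set set \<Rightarrow> 'b set \<Rightarrow> 'b set set \<Rightarrow> bool" where
  "iso V1 E1 V2 E2 \<longleftrightarrow> (\<exists>f. bij_betw f V1 V2 \<and>
      (\<forall>u\<in>V1. \<forall>v\<in>V1. {u, v} \<in> E1 \<longleftrightarrow> {f u, f v} \<in> E2))"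

definition kappa :: "'a set \<Rightarrow> 'a set set \<Rightarrow> ('a set \<Rightarrow> 'a set set \<Rightarrow> bool) \<Rightarrow> nat" where
  "kappa V E P = card {C \<in> components V E. P C (induced_edges E C)}"

definition matching :: "'a set set \<Rightarrow> 'a set set \<Rightarrow> bool" where
  "matching E M \<longleftrightarrow> M \<subseteq> E \<and> (\<forall>e1\<in>M. \<forall>e2\<in>M. e1 \<noteq> e2 \<longrightarrow> e1 \<inter> e2 = {})"

definition matching_number :: "'a set set \<Rightarrow> nat" where
  "matching_number E = Max (card ` {M. matching E M})"

definition uniquely_restricted :: "'a set set \<Rightarrow> 'a set set \<Rightarrow> bool" where
  "uniquely_restricted E M \<longleftrightarrow> matching E M \<and>
     (\<forall>M'. matching E M' \<and> \<Union>M' = \<Union>M \<longrightarrow> M' = M)"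

definition ur_matching_number :: "'a set set \<Rightarrow> nat" where
  "ur_matching_number E = Max (card ` {M. uniquely_restricted E M})"

definition GE_D :: "'a set \<Rightarrow> 'a set set \<Rightarrow> 'a set" where
  "GE_D V E = {v \<in> V. \<exists>M. matching E M \<and> card M = matching_number E \<and> v \<notin> \<Union>M}"

definition GE_A :: "'a set \<Rightarrow> 'a set set \<Rightarrow> 'a set" where
  "GE_A V E = {v \<in> V - GE_D V E. \<exists>u \<in> GE_D V E. {u, v} \<in> E}"

definition calT :: "'a set \<Rightarrow> 'a set set \<Rightarrow> bool" where
  "calT V E \<longleftrightarrow> tree V E \<and> (\<forall>v \<in> GE_A V E. degree E v \<le> 3) \<and>
     3 * matching_number E + 1 = card V"

definition mk_graph :: "(nat \<times> nat) list \<Rightarrow> nat set \<times> nat set set" where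
  "mk_graph es = (fst ` set es \<union> snd ` set es, (\<lambda>(a, b). {a, b}) ` set es)"

text \<open>Labelling for G1,G2,G5,G6,H1: a_i = i (i=1..4), s_ij = 10*i+j,
  t_1,t_2,t_3 = 101,102,103, p,q,r = 111,112,113, d_k = 120+k, extra vertex 130.\<close>

definition s_idx :: "nat \<Rightarrow> nat \<Rightarrow> nat" where "s_idx i j = 10 * i + j"

definition G1_edges :: "(nat \<times> nat) list" where
  "G1_edges = concat (map (\<lambda>(i, j). [(i, s_idx i j), (j, s_idx i j)])
      [(1,2),(1,3),(1,4),(2,3),(2,4),(3,4)])"

definition G2_edges :: "(nat \<times> nat) list" where
  "G2_edges = G1_edges @
     [(101, s_idx 1 4), (101, s_idx 2 3), (102, s_idx 2 4), (102, s_idx 1 3),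
      (103, s_idx 1 2), (103, s_idx 3 4)]"

definition G5_edges :: "(nat \<times> nat) list" where
  "G5_edges = G2_edges @ [(111, 101), (111, 102), (111, 112), (112, 113), (113, 103)]"

definition G6_edges :: "(nat \<times> nat) list" where
  "G6_edges = G2_edges @ map (\<lambda>k. (120 + k, 120 + (k + 1) mod 6)) [0..<6] @
     [(120, 101), (122, 102), (124, 103)]"

definition H1_edges :: "(nat \<times> nat) list" where
  "H1_edges = G2_edges @ [(130, 101), (130, 102), (130, 103)]"

text \<open>Labelling for G3,G4,G7,G8,G9,H2: z = 1, w_j = 2+j, b_i = 10+i, c_i = 20+i,
  y_0,y_1,y_2 = 30,31,32, p,q,r = 40,41,42, d_k = 50+k, extra vertex 60.\<close>

definition wv :: "nat \<Rightarrow> nat" where "wv j = 2 + j"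
definition bv :: "nat \<Rightarrow> nat" where "bv i = 10 + i mod 6"
definition cv :: "nat \<Rightarrow> nat" where "cv i = 20 + i mod 6"

definition G3_edges :: "(nat \<times> nat) list" where
  "G3_edges = map (\<lambda>i. (bv i, bv (i + 1))) [0..<6] @ map (\<lambda>i. (cv i, cv (i + 1))) [0..<6] @
     concat (map (\<lambda>j. [(1, wv j), (wv j, bv j), (wv j, cv j)]) [0, 2, 4])"

definition G4_edges :: "(nat \<times> nat) list" where
  "G4_edges = G3_edges @ concat (map (\<lambda>j. [(wv j, bv j), (wv j, cv j)]) [1, 3, 5])"

definition G7_edges :: "(nat \<times> nat) list" where
  "G7_edges = G3_edges @
     [(30, 31), (30, 32), (31, bv 3), (31, cv 5), (32, cv 3), (32, bv 5)]"

definition G8_edges :: "(nat \<times> nat) list" where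
  "G8_edges = G4_edges @ [(40, wv 1), (40, wv 3), (40, 41), (41, 42), (42, wv 5)]"

definition G9_edges :: "(nat \<times> nat) list" where
  "G9_edges = G4_edges @ map (\<lambda>k. (50 + k, 50 + (k + 1) mod 6)) [0..<6] @
     [(50, wv 1), (52, wv 3), (54, wv 5)]"

definition H2_edges :: "(nat \<times> nat) list" where
  "H2_edges = G4_edges @ [(60, wv 1), (60, wv 3), (60, wv 5)]"

definition calB :: "(nat set \<times> nat set set) set" where
  "calB = mk_graph ` set [G1_edges, G2_edges, G3_edges, G4_edges, G5_edges,
                          G6_edges, G7_edges, G8_edges, G9_edges]"

definition graph_H1 :: "nat set \<times> nat set set" where "graph_H1 = mk_graph H1_edges"
definition graph_H2 :: "nat set \<times> nat set set" where "graph_H2 = mk_graph H2_edges"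

definition replace :: "nat set \<Rightarrow> nat set set \<Rightarrow> nat \<Rightarrow> nat set \<Rightarrow> nat set set
     \<Rightarrow> nat set \<Rightarrow> nat set set \<Rightarrow> bool" where
  "replace V E u VH EH V' E' \<longleftrightarrow>
     (let N = {v \<in> V. {u, v} \<in> E} in
      \<exists>f g. inj_on f VH \<and> f ` VH \<inter> (V - {u}) = {} \<and>
        inj_on g N \<and> g ` N \<subseteq> {x \<in> VH. degree EH x = 2} \<and>
        V' = (V - {u}) \<union> f ` VH \<and>
        E' = {e \<in> E. u \<notin> e} \<union> (\<lambda>e. f ` e) ` EH \<union> {{f (g v), v} | v. v \<in> N})"

text \<open>gen R V E: (V,E) arises from a host tree T in calT by replacing some vertices of D_T;
  R is the set of vertices of D_T not yet replaced. Replacing sequentially is the same as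
  replacing independently.\<close>
inductive gen :: "nat set \<Rightarrow> nat set \<Rightarrow> nat set set \<Rightarrow> bool" where
  base: "calT V E \<Longrightarrow> gen (GE_D V E) V E"
| step: "gen R V E \<Longrightarrow> u \<in> R \<Longrightarrow> (VH, EH) \<in> calB \<Longrightarrow> replace V E u VH EH V' E'
          \<Longrightarrow> gen (R - {u}) V' E'"

definition calG :: "nat set \<Rightarrow> nat set set \<Rightarrow> bool" where
  "calG V E \<longleftrightarrow> (\<exists>R. gen R V E)"

definition iso_to_calG :: "'a set \<Rightarrow> 'a set set \<Rightarrow> bool" where
  "iso_to_calG C EC \<longleftrightarrow> (\<exists>W F. calG W F \<and> iso C EC W F)"

definition in_calG3 :: "'a set \<Rightarrow> 'a set set \<Rightarrow> bool" where
  "in_calG3 C EC \<longleftrightarrow> graph C EC \<and> (\<forall>v\<in>C. degree EC v = 3) \<and> girth_ge EC 5"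

definition iso_to_H12 :: "'a set \<Rightarrow> 'a set set \<Rightarrow> bool" where
  "iso_to_H12 C EC \<longleftrightarrow> iso C EC (fst graph_H1) (snd graph_H1) \<or> iso C EC (fst graph_H2) (snd graph_H2)"

end

theory Submission
  imports Defs
begin

text \<open>
  Write \<open>d(X) = |X| - 3 \<nu>\<^sub>u\<^sub>r(X)\<close> for a vertex set \<open>X\<close>, so that \<open>d(X) \<equiv> |X|\<close> modulo 3.
  If all edges between disjoint \<open>X\<close> and \<open>Y\<close> share a vertex, then \<open>d(X \<union> Y) \<le> d(X) + d(Y)\<close>; in
  particular removing the closed neighbourhood of a vertex of degree 2 does not decrease \<open>d\<close>.
  By induction every connected \<open>X\<close> that is not cubic has \<open>d(X) \<le> 1\<close>, with equality only if \<open>X\<close>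
  is a tree of blobs (single vertices or graphs from \<open>\<B>\<close>) joined through vertices of degree 3.
  Leaves and bridges are handled by the congruence modulo 3 and by replacing one side of a bridge
  by a single vertex. If there is no bridge, let \<open>Y\<close> be \<open>X\<close> without the closed neighbourhood of a
  vertex of degree 2. At most four edges leave \<open>Y\<close>, so if \<open>Y\<close> is a tree of blobs, it has very few
  of them, and \<open>X\<close> is either \<open>G\<^sub>1\<close> or a graph from \<open>\<B>\<close> with a path or a hexagon glued to it; these
  finitely many cases are checked by explicit witnesses. A cubic graph loses one more when a
  vertex is removed.\<close>

section \<open>Uniquely restricted matchings and cuts\<close>

text \<open>Few leaving edges restrict a tree of blobs for this reason. In a 2-edge-connected
  \<open>X\<close> every part of a join sends one edge to the join vertex and another one out of the
  tree. A blob with only two leaving edges already forces \<open>defic X \<le> 0\<close>, because it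
  keeps a matching of a third of its order (rounded down) when two of its ports, the vertices of
  degree 2, are deleted. So a part with two leaving edges is a single vertex. If \<open>Y\<close> is
  a join, two of its parts are of this kind; with the join vertex and the three deleted vertices
  they form a hexagon, and the third part is a blob or leads to G1. The nine graphs are the closure
  of G1 under these gluings: a path attached at four ports gives G2 from G1, and G4 and G7 from G3;
  a path attached at three ports gives G5 from G2 and G8 from G4; a hexagon gives G3, G6, G9 from
  G1, G2, G4. All other gluings have a larger matching or a 4-cycle. It remains to match trees of
  blobs, which grow by joins, with \<open>gen\<close>, which fixes the host tree before any
  replacement. To commute joins with replacements, the free ports are recorded.\<close>

lemma card_Union_matching:
  assumes "matching E M" "finite E" "\<And>e. e \<in> E \<Longrightarrow> card e = 2"
  shows "card (\<Union>M) = 2 * card M"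
proof -
  have fin: "finite M"
    using assms finite_subset unfolding matching_def by blast
  have c2: "\<And>e. e \<in> M \<Longrightarrow> card e = 2"
    using assms unfolding matching_def by blast
  have "card (\<Union>M) = sum card M"
    using assms(1) c2 unfolding matching_def
    by (intro card_Union_disjoint) (force simp: pairwise_def disjnt_def intro: card_ge_0_finite)+
  also have "\<dots> = 2 * card M"
    using c2 by simp
  finally show ?thesis .
qed

lemma uniquely_restrictedI:
  "matching E M \<Longrightarrow> (\<And>M'. matching E M' \<Longrightarrow> \<Union>M' = \<Union>M \<Longrightarrow> M' = M)
    \<Longrightarrow> uniquely_restricted E M"
  unfolding uniquely_restricted_def by blast

lemma matching_subset: "matching E M \<Longrightarrow> N \<subseteq> M \<Longrightarrow> matching E N"
  unfolding matching_def by blast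

text \<open>A perfect matching of the union of two evenly sized sets uses an even number of
  edges between them; if all those edges share a vertex, it uses none.\<close>

lemma uniquely_restricted_Un:
  assumes finE: "finite E" and c2: "\<And>e. e \<in> E \<Longrightarrow> card e = 2"
    and u1: "uniquely_restricted E M1" and u2: "uniquely_restricted E M2"
    and disj: "\<Union>M1 \<inter> \<Union>M2 = {}"
    and cut: "\<And>s t. s \<in> \<Union>M1 \<Longrightarrow> t \<in> \<Union>M2 \<Longrightarrow> {s, t} \<in> E \<Longrightarrow> s = x \<or> t = x"
  shows "uniquely_restricted E (M1 \<union> M2)"
proof -
  have m1: "matching E M1" and m2: "matching E M2"
    using u1 u2 by (auto simp: uniquely_restricted_def)
  have "e \<inter> f = {}" if "e \<in> M1" "f \<in> M2" for e f
    using that disj by blast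
  then have mU: "matching E (M1 \<union> M2)"
    using m1 m2 unfolding matching_def by (metis Un_iff Un_least inf_commute)
  have "M' = M1 \<union> M2" if m': "matching E M'" and cov: "\<Union>M' = \<Union>(M1 \<union> M2)" for M'
  proof -
    define S T where "S = \<Union>M1" and "T = \<Union>M2"
    have ST: "S \<inter> T = {}" and covST: "\<Union>M' = S \<union> T"
      using disj cov by (auto simp: S_def T_def)
    have two: "\<exists>a b. e = {a, b} \<and> a \<noteq> b" if "e \<in> M'" for e
      using that m' c2 unfolding matching_def by (metis card_2_iff subsetD)
    have sub: "M' \<subseteq> E" and dj: "\<And>e f. e \<in> M' \<Longrightarrow> f \<in> M' \<Longrightarrow> e \<noteq> f \<Longrightarrow> e \<inter> f = {}"
      using m' by (auto simp: matching_def)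
    define N1 N2 where "N1 = {e \<in> M'. e \<subseteq> S}" and "N2 = {e \<in> M'. e \<subseteq> T}"
    have mN1: "matching E N1" and mN2: "matching E N2"
      using m' by (auto intro: matching_subset simp: N1_def N2_def)
    have cross: "\<exists>s t. e = {s, t} \<and> s \<in> S \<and> t \<in> T \<and> x \<in> e" if e: "e \<in> M'" "e \<notin> N1" "e \<notin> N2" for e
    proof -
      obtain a b where ab: "e = {a, b}" "a \<noteq> b" using two e by blast
      have "{a, b} \<subseteq> S \<union> T" using ab e covST by blast
      then consider "a \<in> S" "b \<in> T" | "b \<in> S" "a \<in> T"
        using e ab unfolding N1_def N2_def by blast
      then show ?thesis
        using cut[of a b] cut[of b a] ab e sub unfolding S_def T_def
        by (metis insertI1 insert_commute subsetD)
    qed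
    have none: "e \<in> N1 \<or> e \<in> N2" if e: "e \<in> M'" for e
    proof (rule ccontr)
      assume "\<not> (e \<in> N1 \<or> e \<in> N2)"
      then obtain s t where st: "e = {s, t}" "s \<in> S" "t \<in> T" "x \<in> e" using cross e by blast
      \<comment> \<open>All crossing edges contain \<open>x\<close>, and edges of a matching are
        disjoint, so \<open>e\<close> is the only crossing edge. The rest of \<open>S\<close> is
        matched inside \<open>S\<close>, which makes \<open>card S\<close> odd, whereas
        \<open>M1\<close> shows that it is even.\<close>
      have "\<Union>N1 = S - {s}"
      proof (intro equalityI subsetI)
        fix v assume "v \<in> \<Union>N1"
        then obtain f where f: "f \<in> M'" "f \<subseteq> S" "v \<in> f" by (auto simp: N1_def)
        then have "f \<noteq> e" using st ST by auto
        then show "v \<in> S - {s}" using f dj[of f e] e st by auto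
      next
        fix v assume v: "v \<in> S - {s}"
        then obtain f where f: "f \<in> M'" "v \<in> f" using covST by blast
        have "f \<noteq> e" using f st v ST by auto
        then have "x \<notin> f" using dj[of f e] f e st by blast
        moreover have "f \<notin> N2" using f v ST by (auto simp: N2_def)
        ultimately have "f \<in> N1" using cross f by blast
        then show "v \<in> \<Union>N1" using f by blast
      qed
      moreover have "finite S"
        using m1 finE c2 unfolding S_def matching_def
        by (metis card.infinite finite_Union finite_subset subsetD zero_neq_numeral)
      ultimately have "card S = Suc (2 * card N1)"
        using card_Union_matching[OF mN1 finE c2] card_Suc_Diff1[of S s] st(2) by simp
      moreover have "card S = 2 * card M1"
        using card_Union_matching[OF m1 finE c2] by (simp add: S_def)
      ultimately show False by presburger
    qed
    have "\<Union>N1 = S"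
    proof (intro equalityI subsetI)
      fix v assume v: "v \<in> S"
      then obtain f where "f \<in> M'" "v \<in> f" using covST by blast
      then show "v \<in> \<Union>N1" using none[of f] v ST by (auto simp: N2_def)
    qed (auto simp: N1_def)
    moreover have "\<Union>N2 = T"
    proof (intro equalityI subsetI)
      fix v assume v: "v \<in> T"
      then obtain f where "f \<in> M'" "v \<in> f" using covST by blast
      then show "v \<in> \<Union>N2" using none[of f] v ST by (auto simp: N1_def)
    qed (auto simp: N2_def)
    ultimately have "N1 = M1" "N2 = M2"
      using u1 u2 mN1 mN2 by (auto simp: uniquely_restricted_def S_def T_def)
    moreover have "M' = N1 \<union> N2" using none by (auto simp: N1_def N2_def)
    ultimately show ?thesis by simp
  qed
  then show ?thesis by (rule uniquely_restrictedI[OF mU])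
qed

lemma uniquely_restricted_empty: 
  assumes "\<And>e. e \<in> E \<Longrightarrow> card e = 2"
  shows "uniquely_restricted E {}"
proof -
  have *: "M' = {}" if "matching E M'" "\<Union>M' = {}" for M'
  proof -
    have "card e = 2 \<and> e = {}" if "e \<in> M'" for e
      using that \<open>matching E M'\<close> \<open>\<Union>M' = {}\<close> assms by (auto simp: matching_def)
    then show ?thesis by fastforce
  qed
  show ?thesis
  proof (rule uniquely_restrictedI)
    show "M' = {}" if "matching E M'" "\<Union>M' = \<Union>{}" for M'
      using that *[of M'] by simp
  qed (simp add: matching_def)
qed

lemma uniquely_restricted_edge:
  assumes c2: "\<And>e. e \<in> E \<Longrightarrow> card e = 2" and "e \<in> E"
  shows "uniquely_restricted E {e}"
proof -
  have *: "M' = {e}" if m: "matching E M'" and U: "\<Union>M' = e" for M'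
  proof -
    have sub: "f = e" if "f \<in> M'" for f
    proof (rule card_subset_eq)
      show "finite e" using c2[OF \<open>e \<in> E\<close>] by (intro card_ge_0_finite) simp
      show "f \<subseteq> e" using that U by blast
      show "card f = card e" using that m c2 \<open>e \<in> E\<close> by (metis matching_def subsetD)
    qed
    moreover have "e \<noteq> {}" using c2[OF \<open>e \<in> E\<close>] by auto
    ultimately show ?thesis using U by blast
  qed
  show ?thesis
  proof (rule uniquely_restrictedI)
    show "M' = {e}" if "matching E M'" "\<Union>M' = \<Union>{e}" for M'
      using that *[of M'] by simp
  qed (simp add: matching_def assms(2))
qed

section \<open>Deficiency, edge counts and edge-connectivity in a fixed graph\<close>

locale subcubic =
  fixes V :: "'a set" and E :: "'a set set"
  assumes graph: "graph V E" and max_degree: "max_degree_le V E 3" and girth: "girth_ge E 5"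
begin

abbreviation adj :: "'a \<Rightarrow> 'a \<Rightarrow> bool" where "adj x y \<equiv> {x, y} \<in> E"

lemma finite_V: "finite V" using graph by (simp add: graph_def)

lemma finite_sub: "X \<subseteq> V \<Longrightarrow> finite X" using finite_V finite_subset by blast

lemma adj_sym: "adj x y \<Longrightarrow> adj y x" by (simp add: insert_commute)

lemma adj_irrefl [simp]: "{x} \<notin> E"
  using graph unfolding graph_def by (metis insert_absorb2 doubleton_eq_iff)

lemma adj_V: "adj x y \<Longrightarrow> x \<in> V \<and> y \<in> V"
  using graph unfolding graph_def by (metis doubleton_eq_iff)

lemma edge_card: "e \<in> E \<Longrightarrow> card e = 2"
  using graph unfolding graph_def by (metis card_2_iff)

lemma finite_E: "finite E"
proof (rule finite_subset)
  show "E \<subseteq> Pow V" using graph unfolding graph_def by fastforce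
qed (simp add: finite_V)

lemma finite_adj: "finite {w. adj v w}"
  by (rule finite_subset[OF _ finite_V]) (use adj_V in auto)

lemma card_adj: "card {w. adj v w} \<le> 3"
proof (cases "v \<in> V")
  case True
  then show ?thesis
    using max_degree unfolding max_degree_le_def degree_def by (simp add: insert_commute[of v])
next
  case False
  then have "{w. adj v w} = {}" using adj_V by blast
  then show ?thesis by simp
qed

lemma no_triangle: "adj x y \<Longrightarrow> adj y z \<Longrightarrow> adj z x \<Longrightarrow> False"
proof -
  assume a: "adj x y" "adj y z" "adj z x"
  then have "distinct [x, y, z]" by auto
  then have "is_cycle E [x, y, z]"
    using a by (simp add: is_cycle_def All_less_Suc)
  then show False using girth by (auto simp: girth_ge_def)
qed

lemma no_square: 
  assumes "adj w x" "adj x y" "adj y z" "adj z w" "w \<noteq> y" "x \<noteq> z"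
  shows False
proof -
  have "distinct [w, x, y, z]" using assms by auto
  then have "is_cycle E [w, x, y, z]"
    using assms by (simp add: is_cycle_def All_less_Suc)
  then show False using girth by (auto simp: girth_ge_def)
qed

text \<open>Being uniquely restricted refers to the whole of \<open>E\<close>. This agrees with the
  parameter of the subgraph induced by \<open>X\<close>, since a matching with the same vertex set
  uses only edges inside that set. The induction can thus vary \<open>X\<close> and keep the
  graph.\<close>

definition nu :: "'a set \<Rightarrow> nat" where
  "nu X = Max (card ` {M. uniquely_restricted E M \<and> \<Union>M \<subseteq> X})"

lemma finite_ur: "finite {M. uniquely_restricted E M \<and> P M}"
  by (rule finite_subset[of _ "Pow E"]) 
    (auto simp: uniquely_restricted_def matching_def finite_E)

lemma nu_ge: "uniquely_restricted E M \<Longrightarrow> \<Union>M \<subseteq> X \<Longrightarrow> card M \<le> nu X"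
  unfolding nu_def using finite_ur by (intro Max_ge) auto

lemma nu_witness: "\<exists>M. uniquely_restricted E M \<and> \<Union>M \<subseteq> X \<and> card M = nu X"
proof -
  have "nu X \<in> card ` {M. uniquely_restricted E M \<and> \<Union>M \<subseteq> X}"
    unfolding nu_def using finite_ur uniquely_restricted_empty[of E] edge_card
    by (intro Max_in) auto
  then show ?thesis by auto
qed

definition defic :: "'a set \<Rightarrow> int" where
  "defic X = int (card X) - 3 * int (nu X)"

lemma nu_Un:
  assumes "X \<inter> Y = {}" "\<And>s t. s \<in> X \<Longrightarrow> t \<in> Y \<Longrightarrow> adj s t \<Longrightarrow> s = x \<or> t = x"
  shows "nu X + nu Y \<le> nu (X \<union> Y)"
proof -
  obtain M N where M: "uniquely_restricted E M" "\<Union>M \<subseteq> X" "card M = nu X"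
    and N: "uniquely_restricted E N" "\<Union>N \<subseteq> Y" "card N = nu Y"
    using nu_witness by meson
  have "uniquely_restricted E (M \<union> N)"
  proof (rule uniquely_restricted_Un[OF finite_E edge_card M(1) N(1), where x = x])
    show "\<Union>M \<inter> \<Union>N = {}" using M(2) N(2) assms(1) by blast
    show "s = x \<or> t = x" if "s \<in> \<Union>M" "t \<in> \<Union>N" "adj s t" for s t
      using that M(2) N(2) assms(2) by (meson subsetD)
  qed
  then have "card (M \<union> N) \<le> nu (X \<union> Y)"
    using M N by (intro nu_ge) auto
  moreover have "M \<inter> N = {}"
  proof -
    have "e = {}" if "e \<in> M" "e \<in> N" for e
      using that M(2) N(2) assms(1) by blast
    moreover have "{} \<notin> M"
      using M(1) edge_card[of "{}"] by (auto simp: uniquely_restricted_def matching_def)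
    ultimately show ?thesis by blast
  qed
  moreover have "finite M" "finite N"
    using M(1) N(1) finite_subset[OF _ finite_E]
    by (simp_all add: uniquely_restricted_def matching_def)
  ultimately show ?thesis using M N by (simp add: card_Un_disjoint)
qed

lemma defic_Un:
  assumes "X \<subseteq> V" "Y \<subseteq> V" "X \<inter> Y = {}"
    and "\<And>s t. s \<in> X \<Longrightarrow> t \<in> Y \<Longrightarrow> adj s t \<Longrightarrow> s = x \<or> t = x"
  shows "defic (X \<union> Y) \<le> defic X + defic Y"
  using nu_Un[OF assms(3,4)] card_Un_disjoint[of X Y] assms(1-3) finite_sub
  unfolding defic_def by simp

lemma nu_mono: "X \<subseteq> Y \<Longrightarrow> nu X \<le> nu Y"
  by (metis nu_witness nu_ge order_trans)

lemma defic_insert: 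
  assumes "X \<subseteq> V" shows "defic (insert x X) \<le> defic X + 1"
  using nu_mono[of X "insert x X"] finite_sub[OF assms] unfolding defic_def
  by (simp add: card_insert_if subset_insertI)

lemma defic_edge: 
  assumes "adj u v" shows "defic {u, v} \<le> -1"
proof -
  have "card {{u, v}} \<le> nu {u, v}"
    using uniquely_restricted_edge[OF edge_card assms] by (intro nu_ge) auto
  moreover have "card {u, v} = 2" using edge_card assms by blast
  ultimately show ?thesis by (simp add: defic_def)
qed

text \<open>Sharpens bounds: on a set whose order is divisible by 3, a deficiency of at most 2 is at
  most 0.\<close>

lemma defic_mod: "defic X mod 3 = int (card X) mod 3"
  unfolding defic_def by (simp add: mod_diff_eq[symmetric])

lemma defic_empty [simp]: "defic {} \<le> 0" by (simp add: defic_def)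

text \<open>Counting ordered pairs makes this additive in both arguments. For disjoint sets it is
  the number of edges between them; for \<open>v \<in> X\<close>, \<open>ecount {v} X\<close> is the
  degree of \<open>v\<close> in the subgraph induced by \<open>X\<close>.\<close>

definition ecount :: "'a set \<Rightarrow> 'a set \<Rightarrow> nat" where
  "ecount A B = card {(a, b). a \<in> A \<and> b \<in> B \<and> adj a b}"

lemma finite_ecount: "finite {(a, b). a \<in> A \<and> b \<in> B \<and> adj a b}"
  by (rule finite_subset[of _ "V \<times> V"]) (use adj_V finite_V in auto)

lemma ecount_sym: "ecount A B = ecount B A"
  unfolding ecount_def
  by (rule bij_betw_same_card[of "\<lambda>(a, b). (b, a)"])
    (rule bij_betw_byWitness[where f' = "\<lambda>(a, b). (b, a)"], auto simp: insert_commute)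

lemma ecount_Un_left: "A \<inter> A' = {} \<Longrightarrow> ecount (A \<union> A') B = ecount A B + ecount A' B"
  unfolding ecount_def
  by (subst card_Un_disjoint[OF finite_ecount finite_ecount, symmetric])
    (auto intro: arg_cong[where f = card])

lemma ecount_Un_right: "B \<inter> B' = {} \<Longrightarrow> ecount A (B \<union> B') = ecount A B + ecount A B'"
  using ecount_Un_left[of B B' A] by (simp add: ecount_sym)

lemma ecount_mono: "A \<subseteq> A' \<Longrightarrow> B \<subseteq> B' \<Longrightarrow> ecount A B \<le> ecount A' B'"
  unfolding ecount_def by (rule card_mono[OF finite_ecount]) auto

lemma ecount_eq_0: "ecount A B = 0 \<longleftrightarrow> (\<forall>a\<in>A. \<forall>b\<in>B. \<not> adj a b)"
  unfolding ecount_def using finite_ecount by auto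

lemma ecount_empty [simp]: "ecount {} B = 0" "ecount A {} = 0"
  by (auto simp: ecount_eq_0)

lemma ecount_single: "ecount {v} B = card {w \<in> B. adj v w}"
  unfolding ecount_def
  by (rule bij_betw_same_card[of snd]) (rule bij_betw_byWitness[where f' = "Pair v"], auto)

lemma ecount_single_le: "ecount {v} B \<le> 3"
  unfolding ecount_single by (rule order_trans[OF card_mono[OF finite_adj] card_adj]) auto

lemma ecount_insert_left: "v \<notin> A \<Longrightarrow> ecount (insert v A) B = ecount {v} B + ecount A B"
  using ecount_Un_left[of "{v}" A B] by simp

lemma ecount_insert_right: "v \<notin> B \<Longrightarrow> ecount A (insert v B) = ecount {v} A + ecount A B"
  using ecount_insert_left[of v B A] by (simp add: ecount_sym)

lemma ecount_single_single: "ecount {v} {w} = (if adj v w then 1 else 0)"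
proof -
  have "{u \<in> {w}. adj v u} = (if adj v w then {w} else {})" by auto
  then show ?thesis by (simp add: ecount_single)
qed

text \<open>Edge-connectivity of the induced subgraph, expressed by cuts. A single vertex satisfies
  it for every \<open>k\<close>.\<close>

definition econn :: "nat \<Rightarrow> 'a set \<Rightarrow> bool" where
  "econn k X \<longleftrightarrow> X \<noteq> {} \<and> (\<forall>Z. Z \<subset> X \<and> Z \<noteq> {} \<longrightarrow> k \<le> ecount Z (X - Z))"

abbreviation "conn \<equiv> econn (Suc 0)"

lemma econnD: "econn k X \<Longrightarrow> Z \<subset> X \<Longrightarrow> Z \<noteq> {} \<Longrightarrow> k \<le> ecount Z (X - Z)"
  by (simp add: econn_def)

lemma econn_nonempty: "econn k X \<Longrightarrow> X \<noteq> {}" by (simp add: econn_def)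

text \<open>\<open>Z\<close> and \<open>Y - Z\<close> have no edges between them, so the
  \<open>k\<close> or more edges that leave each of them in \<open>X\<close> all end outside
  \<open>Y\<close>.\<close>

lemma not_conn_split:
  assumes "econn k X" "Y \<subset> X" "Y \<noteq> {}" "\<not> conn Y"
  obtains Z where "Z \<noteq> {}" "Z \<subset> Y" "ecount Z (Y - Z) = 0" "k \<le> ecount Z (X - Y)"
    "k \<le> ecount (Y - Z) (X - Y)" "ecount Y (X - Y) = ecount Z (X - Y) + ecount (Y - Z) (X - Y)"
proof -
  obtain Z where Z: "Z \<subset> Y" "Z \<noteq> {}" "ecount Z (Y - Z) = 0"
    using assms unfolding econn_def by (metis less_Suc0 linorder_not_le)
  have eq: "X - Z = (X - Y) \<union> (Y - Z)" "X - (Y - Z) = (X - Y) \<union> Z" using Z assms by auto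
  have "k \<le> ecount Z (X - Z)" "k \<le> ecount (Y - Z) (X - (Y - Z))"
    using Z assms by (auto intro!: econnD)
  moreover have "ecount Z (X - Z) = ecount Z (X - Y) + ecount Z (Y - Z)"
    unfolding eq by (rule ecount_Un_right) auto
  moreover have "ecount (Y - Z) (X - (Y - Z)) = ecount (Y - Z) (X - Y) + ecount (Y - Z) Z"
    unfolding eq by (rule ecount_Un_right) (use Z in auto)
  moreover have "ecount (Y - Z) Z = 0" using Z ecount_sym by metis
  moreover have "ecount Y (X - Y) = ecount Z (X - Y) + ecount (Y - Z) (X - Y)"
    using ecount_Un_left[of Z "Y - Z" "X - Y"] Z by (simp add: Un_absorb1 psubset_imp_subset)
  ultimately show thesis using that Z by simp
qed

lemma conn_if_few_edges:
  assumes "econn k X" "Y \<subset> X" "Y \<noteq> {}" "ecount Y (X - Y) < 2 * k"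
  shows "conn Y"
  using not_conn_split[OF assms(1-3)] assms(4) by fastforce

text \<open>Either half of a split takes at least \<open>k\<close> of the fewer than
  \<open>3 * k\<close> leaving edges. Fewer than \<open>2 * k\<close> remain for the other half,
  which is therefore connected.\<close>

lemma two_parts_if_few_edges:
  assumes "econn k X" "Y \<subset> X" "Y \<noteq> {}" "ecount Y (X - Y) < 3 * k" "\<not> conn Y"
  obtains P Q where "Y = P \<union> Q" "P \<inter> Q = {}" "conn P" "conn Q" "ecount P Q = 0"
    "k \<le> ecount P (X - Y)" "k \<le> ecount Q (X - Y)"
    "ecount Y (X - Y) = ecount P (X - Y) + ecount Q (X - Y)"
proof -
  obtain Z where Z: "Z \<noteq> {}" "Z \<subset> Y" "ecount Z (Y - Z) = 0" "k \<le> ecount Z (X - Y)"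
    "k \<le> ecount (Y - Z) (X - Y)" "ecount Y (X - Y) = ecount Z (X - Y) + ecount (Y - Z) (X - Y)"
    using not_conn_split[OF assms(1-3,5)] by metis
  have eq: "X - Z = (X - Y) \<union> (Y - Z)" "X - (Y - Z) = (X - Y) \<union> Z" using Z assms by auto
  have z': "ecount (Y - Z) Z = 0" using Z ecount_sym by metis
  have "ecount Z (X - Z) = ecount Z (X - Y)"
    unfolding eq using Z by (subst ecount_Un_right) auto
  moreover have "ecount (Y - Z) (X - (Y - Z)) = ecount (Y - Z) (X - Y)"
    unfolding eq using Z z' by (subst ecount_Un_right) auto
  ultimately have "ecount Z (X - Z) < 2 * k" "ecount (Y - Z) (X - (Y - Z)) < 2 * k"
    using Z assms(4) by linarith+
  then have "conn Z" "conn (Y - Z)"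
    using Z(1,2) assms(2) conn_if_few_edges[OF assms(1), of Z]
      conn_if_few_edges[OF assms(1), of "Y - Z"] by blast+
  then show thesis using that[of Z "Y - Z"] Z by auto
qed

lemma conn_edge_out:
  assumes "conn X" "Y \<subset> X" "Y \<noteq> {}"
  obtains v w where "v \<in> Y" "w \<in> X - Y" "adj v w"
  using econnD[OF assms] ecount_eq_0[of Y "X - Y"] by (metis not_less_eq_eq le0)

lemma ecount_single_less:
  assumes "w \<notin> Y" "adj v w" shows "ecount {v} Y \<le> 2"
  using ecount_insert_right[of w Y "{v}"] ecount_single_le[of v "insert w Y"] assms
  by (simp add: ecount_single_single adj_sym)

text \<open>This lets the induction descend: a proper part of a connected set loses an edge at some
  vertex and so is never cubic.\<close>

lemma conn_sub_deg:
  assumes "conn X" "Y \<subset> X" "Y \<noteq> {}"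
  shows "\<exists>v\<in>Y. ecount {v} Y \<le> 2"
  by (rule conn_edge_out[OF assms]) (use ecount_single_less in blast)

end

section \<open>Witnesses for the finite part\<close>

definition verts :: "(nat \<times> nat) list \<Rightarrow> nat set" where
  "verts es = fst ` set es \<union> snd ` set es"

text \<open>Neighbourhoods are lists so that all finite checks below can be run by
  evaluation.\<close>

fun lnbrs :: "(nat \<times> nat) list \<Rightarrow> nat \<Rightarrow> nat list" where
  "lnbrs [] x = []"
| "lnbrs ((a, b) # es) x =
    (if a = x then b # lnbrs es x else if b = x then a # lnbrs es x else lnbrs es x)"

definition ladj :: "(nat \<times> nat) list \<Rightarrow> nat \<Rightarrow> nat \<Rightarrow> bool" where
  "ladj es x y \<longleftrightarrow> y \<in> set (lnbrs es x)"

lemma ladj_iff: "ladj es x y \<longleftrightarrow> (x, y) \<in> set es \<or> (y, x) \<in> set es"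
  unfolding ladj_def by (induction es x rule: lnbrs.induct) auto

lemma ladj_verts: "ladj es x y \<Longrightarrow> x \<in> verts es \<and> y \<in> verts es"
  by (force simp: ladj_iff verts_def)

lemma fst_mk_graph: "fst (mk_graph es) = verts es"
  by (simp add: mk_graph_def verts_def)

lemma snd_mk_graph: "{x, y} \<in> snd (mk_graph es) \<longleftrightarrow> ladj es x y"
  by (force simp: mk_graph_def ladj_iff doubleton_eq_iff)

text \<open>In such a list of edges, \<open>u\<close> is a leaf of the subgraph induced by the vertices of the current
  and the later pairs. Hence its edge is forced, and the matching is uniquely restricted.\<close>

fun leaf_order :: "(nat \<times> nat) list \<Rightarrow> (nat \<times> nat) list \<Rightarrow> bool" where
  "leaf_order es [] = True"
| "leaf_order es ((u, v) # ps) =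
    (let vs = map fst ps @ map snd ps; ns = lnbrs es u
     in u \<noteq> v \<and> v \<in> set ns \<and> u \<notin> set vs \<and> v \<notin> set vs \<and> list_all (\<lambda>w. w \<notin> set vs) ns
       \<and> leaf_order es ps)"

text \<open>The list \<open>ps\<close> is the graph of a bijection. It suffices that both directions
  carry edges to edges and undo each other at the ends of edges, because every vertex of an edge
  list lies on an edge.\<close>

definition iso_check ::
  "(nat \<times> nat) list \<Rightarrow> (nat \<times> nat) list \<Rightarrow> (nat \<times> nat) list \<Rightarrow> bool" where
  "iso_check es es' ps =
    (let qs = map prod.swap ps; h = (\<lambda>x. the (map_of ps x)); g = (\<lambda>x. the (map_of qs x))
     in list_all (\<lambda>(a, b). h b \<in> set (lnbrs es' (h a)) \<and> g (h a) = a \<and> g (h b) = b) es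
      \<and> list_all (\<lambda>(a, b). g b \<in> set (lnbrs es (g a)) \<and> h (g a) = a \<and> h (g b) = b) es')"

text \<open>Lets a witness name its target by a number. Indices other than 1 to 8 all denote G9, so
  every index names a blob.\<close>

definition blob_edges :: "nat \<Rightarrow> (nat \<times> nat) list" where
  "blob_edges i = (if i = 1 then G1_edges else if i = 2 then G2_edges else if i = 3 then G3_edges
     else if i = 4 then G4_edges else if i = 5 then G5_edges else if i = 6 then G6_edges
     else if i = 7 then G7_edges else if i = 8 then G8_edges else G9_edges)"

text \<open>A small graph is settled by a large uniquely restricted matching, by a cycle of length 4, or
  by an isomorphism with a member of \<open>\<B>\<close>.\<close>

datatype witness =
    Leaf "(nat \<times> nat) list"
  | Square nat nat nat nat
  | Iso nat "(nat \<times> nat) list"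

fun check :: "nat \<Rightarrow> (nat \<times> nat) list \<Rightarrow> witness \<Rightarrow> bool" where
  "check k es (Leaf ps) = (k \<le> length ps \<and> leaf_order es ps)"
| "check k es (Square w x y z) =
    (w \<noteq> y \<and> x \<noteq> z \<and> x \<in> set (lnbrs es w) \<and> y \<in> set (lnbrs es x) \<and> z \<in> set (lnbrs es y)
      \<and> w \<in> set (lnbrs es z))"
| "check k es (Iso i ps) = iso_check es (blob_edges i) ps"

text \<open>The vertices in \<open>ds\<close> are the ports. The last condition provides, for any
  two ports, a matching of \<open>m\<close> edges that avoids both; one entry of \<open>cs\<close>
  may serve many pairs. The bound 200 keeps the labels of added vertices fresh.\<close>

definition blob_data ::
  "(nat \<times> nat) list \<Rightarrow> nat \<Rightarrow> nat list \<Rightarrow> (nat \<times> nat) list list \<Rightarrow> bool" where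
  "blob_data es m ds cs =
    (let vs = remdups (map fst es @ map snd es)
     in length vs = 3 * m + 1
      \<and> list_all (\<lambda>x. x < 200 \<and>
          length (remdups (lnbrs es x)) = (if x \<in> set ds then 2 else 3)) vs
      \<and> list_all (\<lambda>x. x \<in> set vs) ds
      \<and> list_all (\<lambda>ps. length ps = m \<and> leaf_order es ps) cs
      \<and> list_all (\<lambda>h. list_all (\<lambda>h'. h = h' \<or> list_ex (\<lambda>ps.
          h \<notin> set (map fst ps @ map snd ps) \<and> h' \<notin> set (map fst ps @ map snd ps)) cs) ds) ds)"

text \<open>The labels from 200 on are not used by the graphs in \<open>\<B>\<close>.\<close>

definition add_path :: "(nat \<times> nat) list \<Rightarrow> nat \<times> nat \<times> nat \<Rightarrow> (nat \<times> nat) list" where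
  "add_path es = (\<lambda>(h1, h2, h3). es @ map (Pair 200) [h1, h2] @ map (Pair 201) [200]
     @ map (Pair 202) [201, h3])"

text \<open>Each block \<open>map (Pair l) ns\<close> attaches one new vertex \<open>l\<close> to
  earlier ones, in the shape required by \<open>realizes_insert\<close>. Here 201 is the vertex of
  degree 2, and 200 and 202 are its neighbours, each with two edges to the blob.\<close>

definition add_biforked_path ::
  "(nat \<times> nat) list \<Rightarrow> nat \<times> nat \<times> nat \<times> nat \<Rightarrow> (nat \<times> nat) list" where
  "add_biforked_path es = (\<lambda>(h1, h2, h3, h4). es @ map (Pair 200) [h1, h2] @ map (Pair 201) [200]
     @ map (Pair 202) [201, h3, h4])"

text \<open>The hexagon is attached to the blob at every other vertex, namely at 200, 202 and
  204.\<close>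

definition add_hexagon :: "(nat \<times> nat) list \<Rightarrow> nat \<times> nat \<times> nat \<Rightarrow> (nat \<times> nat) list" where
  "add_hexagon es = (\<lambda>(h0, h1, h2). es @ map (Pair 200) [h0] @ map (Pair 201) [200]
     @ map (Pair 202) [201, h1] @ map (Pair 203) [202] @ map (Pair 204) [203, h2]
     @ map (Pair 205) [204, 200])"

text \<open>The ports \<open>h1\<close> and \<open>h2\<close> are attached to the same end of the
  path, so one order of them suffices.\<close>

definition triples :: "nat list \<Rightarrow> (nat \<times> nat \<times> nat) list" where
  "triples ds = [(h1, h2, h3). h1 \<leftarrow> ds, h2 \<leftarrow> ds, h3 \<leftarrow> ds, h1 < h2, h3 \<noteq> h1, h3 \<noteq> h2]"

text \<open>One representative up to swapping the two ports at either end and swapping the two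
  ends.\<close>

definition pairs_of_pairs :: "nat list \<Rightarrow> (nat \<times> nat \<times> nat \<times> nat) list" where
  "pairs_of_pairs ds = [(h1, h2, h3, h4). h1 \<leftarrow> ds, h2 \<leftarrow> ds, h3 \<leftarrow> ds, h4 \<leftarrow> ds,
     h1 < h2, h3 < h4, h1 < h3, h2 \<noteq> h3, h2 \<noteq> h4]"

text \<open>Rotations and reflections of the hexagon produce all six orders of the three ports, so
  the increasing one suffices.\<close>

definition sorted_triples :: "nat list \<Rightarrow> (nat \<times> nat \<times> nat) list" where
  "sorted_triples ds = [(h1, h2, h3). h1 \<leftarrow> ds, h2 \<leftarrow> ds, h3 \<leftarrow> ds, h1 < h2, h2 < h3]"

section \<open>Evaluated data of the nine blobs and of all gluings to them\<close>

lemma blob_data_G1: "blob_data G1_edges 3 [12,13,14,23,24,34]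
    [[(1,14),(2,24),(3,34)],
     [(1,13),(2,23),(3,34)],
     [(1,12),(3,23),(2,24)],
     [(2,12),(3,13),(1,14)],
     [(1,14),(2,23),(3,34)],
     [(1,14),(3,23),(2,24)],
     [(1,13),(2,24),(3,34)]]"
  by code_simp

lemma blob_data_G2: "blob_data G2_edges 4 [101,102,103]
    [[(13,1),(14,4),(23,2),(12,103)],
     [(12,1),(14,4),(23,3),(13,102)],
     [(12,1),(13,3),(23,101),(14,4)]]"
  by code_simp

lemma blob_data_G3: "blob_data G3_edges 5 [11,13,15,21,23,25]
    [[(10,2),(12,4),(1,6),(20,25),(22,23)],
     [(12,4),(22,21),(20,2),(1,6),(10,15)],
     [(20,2),(10,11),(22,4),(1,6),(12,13)]]"
  by code_simp

lemma blob_data_G4: "blob_data G4_edges 6 [3,5,7]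
    [[(7,25),(10,2),(20,21),(1,4),(12,13),(22,23)],
     [(5,13),(11,10),(15,14),(2,1),(4,22),(6,24)],
     [(3,11),(10,2),(20,25),(1,4),(12,13),(22,23)]]"
  by code_simp

lemma blob_data_G5: "blob_data G5_edges 5 [112,113]
    [[(103,34),(1,13),(3,23),(2,24),(101,111)]]"
  by code_simp

lemma blob_data_G6: "blob_data G6_edges 6 [121,123,125]
    [[(120,101),(122,102),(124,103),(12,1),(13,3),(14,4)]]"
  by code_simp

lemma blob_data_G7: "blob_data G7_edges 6 [11,21,30]
    [[(10,2),(20,25),(31,13),(12,4),(1,6),(22,23)]]"
  by code_simp

lemma blob_data_G8: "blob_data G8_edges 7 [41,42]
    [[(7,25),(10,2),(20,21),(3,40),(1,4),(12,13),(5,23)]]"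
  by code_simp

lemma blob_data_G9: "blob_data G9_edges 8 [51,53,55]
    [[(50,3),(52,5),(54,7),(11,10),(13,14),(2,1),(4,22),(6,24)]]"
  by code_simp

text \<open>A blob of order \<open>3 * m + 1\<close> becomes a graph of order
  \<open>3 * m + 4\<close>, so \<open>m + 2\<close> matching edges are needed to bring the
  deficiency from 1 to -2; here \<open>m\<close> is 3. No blob arises from G1 in this way.\<close>

lemma path_table_G1: "list_all2 (check (3 + 2)) (map (add_path G1_edges) (triples [12,13,14,23,24,34]))
    [Square 1 12 200 13,
     Leaf [(14,1),(24,2),(12,200),(13,3),(23,202)],
     Leaf [(14,1),(34,3),(13,200),(12,2),(24,202)],
     Leaf [(14,1),(24,2),(12,200),(13,3),(34,202)],
     Square 1 12 200 14,
     Leaf [(13,1),(34,4),(14,200),(12,2),(23,202)],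
     Leaf [(13,1),(23,2),(12,200),(14,4),(24,202)],
     Leaf [(13,1),(23,2),(12,200),(14,4),(34,202)],
     Leaf [(14,1),(24,2),(12,200),(23,3),(13,202)],
     Leaf [(13,1),(34,4),(14,202),(24,2),(12,200)],
     Square 12 200 23 2,
     Leaf [(13,1),(14,4),(24,2),(12,200),(34,202)],
     Leaf [(14,1),(34,3),(13,202),(23,2),(12,200)],
     Leaf [(13,1),(23,2),(12,200),(24,4),(14,202)],
     Square 12 200 24 2,
     Leaf [(13,1),(14,4),(23,2),(12,200),(34,202)],
     Leaf [(14,1),(24,2),(12,200),(23,3),(13,202)],
     Leaf [(13,1),(23,2),(12,200),(24,4),(14,202)],
     Leaf [(13,1),(14,4),(24,2),(12,200),(23,202)],
     Leaf [(13,1),(14,4),(23,2),(12,200),(24,202)],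
     Square 1 13 200 14,
     Leaf [(12,1),(24,4),(14,200),(13,3),(23,202)],
     Leaf [(12,1),(23,3),(13,200),(14,4),(24,202)],
     Leaf [(12,1),(23,3),(13,200),(14,4),(34,202)],
     Leaf [(14,1),(24,2),(12,202),(34,3),(13,200)],
     Leaf [(12,1),(24,4),(14,202),(34,3),(13,200)],
     Leaf [(12,1),(14,4),(24,202),(34,3),(13,200)],
     Square 13 200 23 3,
     Leaf [(14,1),(34,3),(13,200),(23,2),(12,202)],
     Leaf [(12,1),(23,3),(13,200),(24,4),(14,202)],
     Leaf [(12,1),(14,4),(24,200),(13,3),(23,202)],
     Leaf [(12,1),(14,4),(23,3),(13,200),(34,202)],
     Leaf [(14,1),(24,2),(12,202),(23,3),(13,200)],
     Leaf [(12,1),(23,3),(13,200),(24,4),(14,202)],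
     Square 13 200 34 3,
     Leaf [(12,1),(14,4),(23,3),(13,200),(24,202)],
     Leaf [(13,1),(34,4),(14,200),(23,2),(12,202)],
     Leaf [(12,1),(24,4),(14,200),(23,3),(13,202)],
     Leaf [(12,1),(13,3),(23,200),(14,4),(24,202)],
     Leaf [(12,1),(13,3),(23,200),(14,4),(34,202)],
     Leaf [(13,1),(23,2),(12,202),(34,4),(14,200)],
     Leaf [(12,1),(23,3),(13,202),(34,4),(14,200)],
     Leaf [(12,1),(13,3),(23,202),(34,4),(14,200)],
     Square 14 200 24 4,
     Leaf [(13,1),(23,2),(12,202),(24,4),(14,200)],
     Leaf [(12,1),(23,3),(13,202),(24,4),(14,200)],
     Leaf [(12,1),(13,3),(23,202),(24,4),(14,200)],
     Square 14 200 34 4,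
     Square 2 24 200 23,
     Leaf [(12,1),(14,4),(24,200),(23,3),(13,202)],
     Leaf [(12,1),(13,3),(23,200),(24,4),(14,202)],
     Leaf [(12,1),(13,3),(14,4),(23,200),(34,202)],
     Leaf [(13,1),(14,4),(24,2),(12,202),(23,200)],
     Square 3 34 200 23,
     Leaf [(12,1),(13,3),(23,200),(24,4),(14,202)],
     Leaf [(12,1),(13,3),(14,4),(23,200),(24,202)],
     Leaf [(13,1),(14,4),(23,2),(12,202),(24,200)],
     Leaf [(12,1),(14,4),(23,3),(13,202),(24,200)],
     Square 4 24 200 34,
     Leaf [(12,1),(13,3),(14,4),(23,202),(24,200)]]"
  by code_simp

text \<open>G2 arises in the three cases where each end of the path is attached to the subdivision
  vertices of two opposite edges of K4.\<close>

lemma biforked_table_G1: "list_all2 (check (3 + 2)) (map (add_biforked_path G1_edges) (pairs_of_pairs [12,13,14,23,24,34]))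
    [Leaf [(24,2),(34,3),(23,202),(14,1),(12,200)],
     Leaf [(23,2),(34,4),(24,202),(14,1),(12,200)],
     Leaf [(23,2),(24,4),(34,202),(14,1),(12,200)],
     Leaf [(14,1),(34,3),(13,200),(12,2),(23,202)],
     Leaf [(14,1),(24,2),(12,200),(13,3),(23,202)],
     Square 1 12 200 13,
     Leaf [(24,2),(34,3),(23,202),(13,1),(12,200)],
     Leaf [(23,2),(34,4),(24,202),(13,1),(12,200)],
     Leaf [(23,2),(24,4),(34,202),(13,1),(12,200)],
     Leaf [(13,1),(34,4),(14,200),(12,2),(23,202)],
     Square 1 12 200 14,
     Leaf [(13,1),(23,2),(12,200),(14,4),(24,202)],
     Leaf [(24,2),(34,3),(23,200),(12,1),(13,202)],
     Leaf [(14,1),(34,3),(13,202),(24,2),(12,200)],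
     Leaf [(14,1),(24,2),(12,200),(23,3),(13,202)],
     Leaf [(13,1),(34,4),(14,202),(24,2),(12,200)],
     Square 12 200 23 2,
     Leaf [(13,1),(14,4),(34,202),(24,2),(12,200)],
     Leaf [(23,2),(34,4),(24,200),(12,1),(13,202)],
     Leaf [(14,1),(34,3),(13,202),(23,2),(12,200)],
     Square 12 200 24 2,
     Leaf [(13,1),(34,4),(14,202),(23,2),(12,200)],
     Leaf [(13,1),(23,2),(12,200),(24,4),(14,202)],
     Leaf [(13,1),(14,4),(34,202),(23,2),(12,200)],
     Leaf [(23,2),(24,4),(34,200),(12,1),(13,202)],
     Leaf [(14,1),(24,2),(12,200),(34,3),(13,202)],
     Iso 2 [(1,14),(2,12),(3,34),(4,23),(12,1),(13,4),(14,101),(23,103),(24,2),(34,3),(200,13),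
        (201,102),(202,24)],
     Iso 2 [(1,14),(2,12),(3,23),(4,34),(12,1),(13,101),(14,4),(23,2),(24,103),(34,3),(200,13),
        (201,102),(202,24)],
     Leaf [(13,1),(23,2),(12,200),(34,4),(14,202)],
     Leaf [(13,1),(14,4),(34,200),(12,2),(23,202)],
     Square 1 13 200 14,
     Leaf [(12,1),(24,4),(14,200),(13,3),(23,202)],
     Leaf [(12,1),(23,3),(13,200),(14,4),(24,202)],
     Square 13 200 23 3,
     Leaf [(12,1),(24,4),(14,202),(34,3),(13,200)],
     Leaf [(12,1),(14,4),(24,202),(34,3),(13,200)],
     Iso 2 [(1,14),(2,23),(3,12),(4,34),(12,101),(13,1),(14,4),(23,2),(24,3),(34,103),(200,13),
        (201,102),(202,24)],
     Leaf [(12,1),(23,3),(13,200),(24,4),(14,202)],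
     Leaf [(12,1),(14,4),(24,200),(13,3),(23,202)],
     Leaf [(12,1),(24,4),(14,202),(23,3),(13,200)],
     Leaf [(12,1),(23,3),(13,200),(34,4),(14,202)],
     Leaf [(12,1),(14,4),(24,202),(23,3),(13,200)],
     Leaf [(12,1),(13,3),(23,200),(14,4),(24,202)],
     Leaf [(12,1),(13,3),(23,202),(34,4),(14,200)],
     Leaf [(12,1),(13,3),(23,202),(24,4),(14,200)]]"
  by code_simp

text \<open>The order grows by 6, so three further matching edges are needed. G3 arises when the
  three ports surround one branch vertex, which then plays the role of \<open>z\<close>.\<close>

lemma hexagon_table_G1: "list_all2 (check (3 + 3)) (map (add_hexagon G1_edges) (sorted_triples [12,13,14,23,24,34]))
    [Iso 3 [(1,1),(2,10),(3,12),(4,14),(12,2),(13,4),(14,6),(23,11),(24,15),(34,13),(200,20),(201,21),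
        (202,22),(203,23),(204,24),(205,25)],
     Leaf [(14,1),(24,2),(12,200),(34,3),(13,202),(23,204)],
     Leaf [(14,1),(34,3),(13,202),(23,2),(12,200),(24,204)],
     Leaf [(14,1),(24,2),(12,200),(23,3),(13,202),(34,204)],
     Leaf [(13,1),(34,4),(14,202),(24,2),(12,200),(23,204)],
     Leaf [(13,1),(23,2),(12,200),(34,4),(14,202),(24,204)],
     Leaf [(13,1),(23,2),(12,200),(24,4),(14,202),(34,204)],
     Iso 3 [(1,10),(2,1),(3,12),(4,14),(12,2),(13,11),(14,15),(23,4),(24,6),(34,13),(200,20),(201,21),
        (202,22),(203,23),(204,24),(205,25)],
     Leaf [(13,1),(14,4),(24,2),(12,200),(23,202),(34,204)],
     Leaf [(13,1),(14,4),(23,2),(12,200),(24,202),(34,204)],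
     Leaf [(12,1),(24,4),(14,202),(34,3),(13,200),(23,204)],
     Leaf [(12,1),(23,3),(13,200),(34,4),(14,202),(24,204)],
     Leaf [(12,1),(23,3),(13,200),(24,4),(14,202),(34,204)],
     Leaf [(12,1),(14,4),(24,204),(34,3),(13,200),(23,202)],
     Iso 3 [(1,10),(2,12),(3,1),(4,14),(12,11),(13,2),(14,15),(23,4),(24,13),(34,6),(200,20),(201,21),
        (202,22),(203,23),(204,24),(205,25)],
     Leaf [(12,1),(14,4),(23,3),(13,200),(24,202),(34,204)],
     Leaf [(12,1),(13,3),(23,202),(34,4),(14,200),(24,204)],
     Leaf [(12,1),(13,3),(23,202),(24,4),(14,200),(34,204)],
     Iso 3 [(1,10),(2,12),(3,14),(4,1),(12,11),(13,15),(14,2),(23,13),(24,4),(34,6),(200,20),(201,21),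
        (202,22),(203,23),(204,24),(205,25)],
     Leaf [(12,1),(13,3),(14,4),(23,200),(24,202),(34,204)]]"
  by code_simp

lemma path_table_G2: "list_all2 (check (4 + 2)) (map (add_path G2_edges) (triples [101,102,103]))
    [Iso 5 [(1,1),(2,2),(3,3),(4,4),(12,12),(13,13),(14,14),(23,23),(24,24),(34,34),(101,101),(102,102),
        (103,103),(200,111),(201,112),(202,113)],
     Iso 5 [(1,1),(2,3),(3,2),(4,4),(12,13),(13,12),(14,14),(23,23),(24,34),(34,24),(101,101),(102,103),
        (103,102),(200,111),(201,112),(202,113)],
     Iso 5 [(1,1),(2,3),(3,4),(4,2),(12,13),(13,14),(14,12),(23,34),(24,23),(34,24),(101,103),(102,101),
        (103,102),(200,111),(201,112),(202,113)]]"
  by code_simp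

lemma hexagon_table_G2: "list_all2 (check (4 + 3)) (map (add_hexagon G2_edges) (sorted_triples [101,102,103]))
    [Iso 6 [(1,1),(2,2),(3,3),(4,4),(12,12),(13,13),(14,14),(23,23),(24,24),(34,34),(101,101),(102,102),
        (103,103),(200,120),(201,121),(202,122),(203,123),(204,124),(205,125)]]"
  by code_simp

text \<open>All sixty choices of ports admit a large matching, so a path at three ports makes no
  blob from G3.\<close>

lemma path_table_G3: "list_all2 (check (5 + 2)) (map (add_path G3_edges) (triples [11,13,15,21,23,25]))
    [Leaf [(21,20),(23,24),(2,1),(4,12),(6,14),(11,200),(15,202)],
     Leaf [(15,10),(2,1),(6,24),(23,22),(4,12),(11,200),(21,202)],
     Leaf [(15,10),(2,1),(6,24),(21,22),(4,12),(11,200),(23,202)],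
     Leaf [(15,10),(2,1),(6,24),(21,22),(4,12),(11,200),(25,202)],
     Leaf [(21,20),(23,24),(2,1),(4,12),(6,14),(11,200),(13,202)],
     Leaf [(13,12),(4,1),(6,24),(25,20),(2,10),(11,200),(21,202)],
     Leaf [(13,12),(4,1),(6,24),(21,20),(2,10),(11,200),(23,202)],
     Leaf [(13,12),(4,1),(6,24),(21,20),(2,10),(11,200),(25,202)],
     Leaf [(15,10),(2,1),(6,24),(23,22),(4,12),(11,200),(13,202)],
     Leaf [(13,12),(4,1),(6,24),(25,20),(2,10),(11,200),(15,202)],
     Leaf [(13,12),(15,10),(11,200),(201,202),(2,1),(4,22),(6,24)],
     Leaf [(13,12),(15,10),(11,200),(201,202),(2,1),(4,22),(6,24)],
     Leaf [(15,10),(2,1),(6,24),(21,22),(4,12),(11,200),(13,202)],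
     Leaf [(13,12),(4,1),(6,24),(21,20),(2,10),(11,200),(15,202)],
     Leaf [(13,12),(15,10),(11,200),(201,202),(2,1),(4,22),(6,24)],
     Leaf [(13,12),(15,10),(11,200),(201,202),(2,1),(4,22),(6,24)],
     Leaf [(15,10),(2,1),(6,24),(21,22),(4,12),(11,200),(13,202)],
     Leaf [(13,12),(4,1),(6,24),(21,20),(2,10),(11,200),(15,202)],
     Leaf [(13,12),(15,10),(11,200),(201,202),(2,1),(4,22),(6,24)],
     Leaf [(13,12),(15,10),(11,200),(201,202),(2,1),(4,22),(6,24)],
     Leaf [(21,20),(23,24),(2,1),(4,12),(6,14),(11,202),(13,200)],
     Leaf [(11,10),(2,1),(4,22),(21,202),(23,24),(6,14),(13,200)],
     Leaf [(11,10),(2,1),(4,22),(25,24),(6,14),(13,200),(23,202)],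
     Leaf [(11,10),(2,1),(4,22),(23,24),(6,14),(13,200),(25,202)],
     Leaf [(15,10),(2,1),(6,24),(23,22),(4,12),(11,202),(13,200)],
     Leaf [(11,10),(2,1),(4,22),(21,200),(13,14),(6,24),(15,202)],
     Leaf [(11,10),(15,14),(13,200),(201,202),(2,1),(4,22),(6,24)],
     Leaf [(11,10),(15,14),(13,200),(201,202),(2,1),(4,22),(6,24)],
     Leaf [(15,10),(2,1),(6,24),(21,22),(4,12),(11,202),(13,200)],
     Leaf [(11,10),(2,1),(4,22),(25,24),(6,14),(13,200),(15,202)],
     Leaf [(11,10),(15,14),(13,200),(201,202),(2,1),(4,22),(6,24)],
     Leaf [(11,10),(15,14),(13,200),(201,202),(2,1),(4,22),(6,24)],
     Leaf [(15,10),(2,1),(6,24),(21,22),(4,12),(11,202),(13,200)],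
     Leaf [(11,10),(2,1),(4,22),(23,24),(6,14),(13,200),(15,202)],
     Leaf [(11,10),(15,14),(13,200),(201,202),(2,1),(4,22),(6,24)],
     Leaf [(11,10),(15,14),(13,200),(201,202),(2,1),(4,22),(6,24)],
     Leaf [(13,12),(4,1),(6,24),(25,20),(2,10),(11,202),(15,200)],
     Leaf [(11,10),(2,1),(4,22),(21,200),(15,14),(6,24),(13,202)],
     Leaf [(11,10),(13,14),(15,200),(201,202),(2,1),(4,22),(6,24)],
     Leaf [(11,10),(13,14),(15,200),(201,202),(2,1),(4,22),(6,24)],
     Leaf [(13,12),(4,1),(6,24),(21,20),(2,10),(11,202),(15,200)],
     Leaf [(11,10),(2,1),(4,22),(25,24),(6,14),(13,202),(15,200)],
     Leaf [(11,10),(13,14),(15,200),(201,202),(2,1),(4,22),(6,24)],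
     Leaf [(11,10),(13,14),(15,200),(201,202),(2,1),(4,22),(6,24)],
     Leaf [(13,12),(4,1),(6,24),(21,20),(2,10),(11,202),(15,200)],
     Leaf [(11,10),(2,1),(4,22),(23,24),(6,14),(13,202),(15,200)],
     Leaf [(11,10),(13,14),(15,200),(201,202),(2,1),(4,22),(6,24)],
     Leaf [(11,10),(13,14),(15,200),(201,202),(2,1),(4,22),(6,24)],
     Leaf [(13,12),(15,10),(11,202),(201,200),(2,1),(4,22),(6,24)],
     Leaf [(11,10),(15,14),(13,202),(201,200),(2,1),(4,22),(6,24)],
     Leaf [(11,10),(13,14),(15,202),(201,200),(2,1),(4,22),(6,24)],
     Leaf [(11,10),(13,14),(2,1),(4,22),(6,24),(21,200),(25,202)],
     Leaf [(13,12),(15,10),(11,202),(201,200),(2,1),(4,22),(6,24)],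
     Leaf [(11,10),(15,14),(13,202),(201,200),(2,1),(4,22),(6,24)],
     Leaf [(11,10),(13,14),(15,202),(201,200),(2,1),(4,22),(6,24)],
     Leaf [(11,10),(13,14),(2,1),(4,22),(6,24),(21,200),(23,202)],
     Leaf [(13,12),(15,10),(11,202),(201,200),(2,1),(4,22),(6,24)],
     Leaf [(11,10),(15,14),(13,202),(201,200),(2,1),(4,22),(6,24)],
     Leaf [(11,10),(13,14),(15,202),(201,200),(2,1),(4,22),(6,24)],
     Leaf [(11,10),(13,14),(2,1),(4,22),(6,24),(21,202),(23,200)]]"
  by code_simp

text \<open>The origin of both G4 and G7, which differ in the position of the four ports.\<close>

lemma biforked_table_G3: "list_all2 (check (5 + 2)) (map (add_biforked_path G3_edges) (pairs_of_pairs [11,13,15,21,23,25]))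
    [Leaf [(23,24),(25,20),(21,202),(201,200),(2,1),(4,12),(6,14)],
     Leaf [(21,20),(25,24),(23,202),(201,200),(2,1),(4,12),(6,14)],
     Leaf [(21,20),(23,24),(25,202),(201,200),(2,1),(4,12),(6,14)],
     Square 11 200 13 12,
     Leaf [(15,10),(2,1),(6,24),(23,22),(4,12),(11,200),(21,202)],
     Leaf [(15,10),(2,1),(6,24),(21,22),(4,12),(11,200),(23,202)],
     Leaf [(23,24),(25,20),(21,202),(201,200),(2,1),(4,12),(6,14)],
     Leaf [(21,20),(25,24),(23,202),(201,200),(2,1),(4,12),(6,14)],
     Leaf [(21,20),(23,24),(25,202),(201,200),(2,1),(4,12),(6,14)],
     Leaf [(13,12),(4,1),(6,24),(23,202),(21,20),(2,10),(11,200)],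
     Square 10 11 200 15,
     Leaf [(13,12),(4,1),(6,24),(21,20),(2,10),(11,200),(23,202)],
     Leaf [(23,24),(25,20),(21,200),(201,202),(2,1),(4,12),(6,14)],
     Iso 4 [(1,2),(2,10),(4,1),(6,20),(10,11),(11,12),(12,4),(13,22),(14,21),(15,3),(20,15),(21,14),
        (22,6),(23,24),(24,25),(25,7),(200,13),(201,5),(202,23)],
     Leaf [(15,10),(2,1),(6,24),(23,22),(4,12),(11,200),(13,202)],
     Leaf [(13,12),(4,1),(6,24),(23,202),(15,10),(2,20),(11,200)],
     Iso 4 [(1,2),(2,1),(4,10),(6,20),(10,4),(11,12),(12,11),(13,3),(14,21),(15,22),(20,6),(21,14),
        (22,15),(23,7),(24,25),(25,24),(200,13),(201,5),(202,23)],
     Leaf [(13,12),(15,10),(11,200),(201,202),(2,1),(4,22),(6,24)],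
     Leaf [(21,20),(25,24),(23,200),(201,202),(2,1),(4,12),(6,14)],
     Iso 7 [(1,1),(2,2),(4,6),(6,4),(10,10),(11,15),(12,14),(13,13),(14,12),(15,11),(20,20),(21,25),
        (22,24),(23,23),(24,22),(25,21),(200,32),(201,30),(202,31)],
     Leaf [(15,10),(2,1),(6,24),(21,22),(4,12),(11,200),(13,202)],
     Leaf [(13,12),(4,1),(6,24),(23,200),(11,10),(2,20),(15,202)],
     Leaf [(13,12),(4,1),(6,24),(21,20),(2,10),(11,200),(15,202)],
     Leaf [(13,12),(15,10),(11,200),(201,202),(2,1),(4,22),(6,24)],
     Leaf [(21,20),(23,24),(25,200),(201,202),(2,1),(4,12),(6,14)],
     Leaf [(15,10),(2,1),(6,24),(23,22),(4,12),(11,200),(13,202)],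
     Leaf [(15,10),(2,1),(6,24),(21,22),(4,12),(11,200),(13,202)],
     Iso 7 [(1,1),(2,6),(4,2),(6,4),(10,14),(11,15),(12,10),(13,11),(14,12),(15,13),(20,24),(21,25),
        (22,20),(23,21),(24,22),(25,23),(200,32),(201,30),(202,31)],
     Leaf [(13,12),(4,1),(6,24),(21,20),(2,10),(11,200),(15,202)],
     Leaf [(13,12),(15,10),(11,200),(201,202),(2,1),(4,22),(6,24)],
     Leaf [(11,10),(2,1),(4,22),(21,202),(23,24),(6,14),(13,200)],
     Leaf [(11,10),(2,1),(4,22),(21,202),(23,24),(6,14),(13,200)],
     Square 13 200 15 14,
     Leaf [(11,10),(2,1),(4,22),(21,200),(13,14),(6,24),(15,202)],
     Leaf [(11,10),(2,1),(4,22),(21,200),(13,14),(6,24),(15,202)],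
     Leaf [(11,10),(15,14),(13,200),(201,202),(2,1),(4,22),(6,24)],
     Leaf [(11,10),(2,1),(4,22),(21,202),(15,14),(6,24),(13,200)],
     Iso 4 [(1,2),(2,10),(4,20),(6,1),(10,11),(11,3),(12,21),(13,22),(14,4),(15,12),(20,15),(21,7),
        (22,25),(23,24),(24,6),(25,14),(200,23),(201,5),(202,13)],
     Leaf [(11,10),(15,14),(13,200),(201,202),(2,1),(4,22),(6,24)],
     Leaf [(11,10),(2,1),(4,22),(21,202),(15,14),(6,24),(13,200)],
     Iso 7 [(1,1),(2,2),(4,4),(6,6),(10,10),(11,11),(12,12),(13,13),(14,14),(15,15),(20,20),(21,21),
        (22,22),(23,23),(24,24),(25,25),(200,31),(201,30),(202,32)],
     Leaf [(11,10),(15,14),(13,200),(201,202),(2,1),(4,22),(6,24)],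
     Leaf [(11,10),(13,14),(15,200),(201,202),(2,1),(4,22),(6,24)],
     Leaf [(11,10),(13,14),(15,200),(201,202),(2,1),(4,22),(6,24)],
     Leaf [(11,10),(13,14),(15,200),(201,202),(2,1),(4,22),(6,24)]]"
  by code_simp

lemma hexagon_table_G3: "list_all2 (check (5 + 3)) (map (add_hexagon G3_edges) (sorted_triples [11,13,15,21,23,25]))
    [Leaf [(21,20),(23,24),(2,1),(4,12),(6,14),(11,200),(13,202),(15,204)],
     Leaf [(15,10),(2,1),(6,24),(23,22),(4,12),(11,200),(13,202),(21,204)],
     Leaf [(15,10),(2,1),(6,24),(21,22),(4,12),(11,200),(13,202),(23,204)],
     Leaf [(15,10),(2,1),(6,24),(21,22),(4,12),(11,200),(13,202),(25,204)],
     Leaf [(13,12),(4,1),(6,24),(25,20),(2,10),(11,200),(15,202),(21,204)],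
     Leaf [(13,12),(4,1),(6,24),(21,20),(2,10),(11,200),(15,202),(23,204)],
     Leaf [(13,12),(4,1),(6,24),(21,20),(2,10),(11,200),(15,202),(25,204)],
     Leaf [(13,12),(15,10),(11,200),(201,202),(203,204),(2,1),(4,22),(6,24)],
     Leaf [(13,12),(15,10),(11,200),(201,202),(203,204),(2,1),(4,22),(6,24)],
     Leaf [(13,12),(15,10),(11,200),(201,202),(203,204),(2,1),(4,22),(6,24)],
     Leaf [(11,10),(2,1),(4,22),(21,204),(23,24),(6,14),(13,200),(15,202)],
     Leaf [(11,10),(2,1),(4,22),(25,24),(6,14),(13,200),(15,202),(23,204)],
     Leaf [(11,10),(2,1),(4,22),(23,24),(6,14),(13,200),(15,202),(25,204)],
     Leaf [(11,10),(15,14),(13,200),(201,202),(203,204),(2,1),(4,22),(6,24)],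
     Leaf [(11,10),(15,14),(13,200),(201,202),(203,204),(2,1),(4,22),(6,24)],
     Leaf [(11,10),(15,14),(13,200),(201,202),(203,204),(2,1),(4,22),(6,24)],
     Leaf [(11,10),(13,14),(15,200),(201,202),(203,204),(2,1),(4,22),(6,24)],
     Leaf [(11,10),(13,14),(15,200),(201,202),(203,204),(2,1),(4,22),(6,24)],
     Leaf [(11,10),(13,14),(15,200),(201,202),(203,204),(2,1),(4,22),(6,24)],
     Leaf [(11,10),(13,14),(2,1),(4,22),(6,24),(21,200),(23,202),(25,204)]]"
  by code_simp

lemma path_table_G4: "list_all2 (check (6 + 2)) (map (add_path G4_edges) (triples [3,5,7]))
    [Iso 8 [(1,1),(2,2),(3,3),(4,4),(5,5),(6,6),(7,7),(10,10),(11,11),(12,12),(13,13),(14,14),(15,15),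
        (20,20),(21,21),(22,22),(23,23),(24,24),(25,25),(200,40),(201,41),(202,42)],
     Iso 8 [(1,1),(2,4),(3,3),(4,2),(5,7),(6,6),(7,5),(10,12),(11,11),(12,10),(13,15),(14,14),(15,13),
        (20,22),(21,21),(22,20),(23,25),(24,24),(25,23),(200,40),(201,41),(202,42)],
     Iso 8 [(1,1),(2,6),(3,7),(4,2),(5,3),(6,4),(7,5),(10,14),(11,15),(12,10),(13,11),(14,12),(15,13),
        (20,24),(21,25),(22,20),(23,21),(24,22),(25,23),(200,40),(201,41),(202,42)]]"
  by code_simp

lemma hexagon_table_G4: "list_all2 (check (6 + 3)) (map (add_hexagon G4_edges) (sorted_triples [3,5,7]))
    [Iso 9 [(1,1),(2,2),(3,3),(4,4),(5,5),(6,6),(7,7),(10,10),(11,11),(12,12),(13,13),(14,14),(15,15),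
        (20,20),(21,21),(22,22),(23,23),(24,24),(25,25),(200,50),(201,51),(202,52),(203,53),(204,54),
        (205,55)]]"
  by code_simp

text \<open>The growth of the family ends here: G6, G7 and G9 have three ports each, but every
  gluing to them has a large matching, while G5 and G8 have too few ports.\<close>

lemma path_table_G6: "list_all2 (check (6 + 2)) (map (add_path G6_edges) (triples [121,123,125]))
    [Leaf [(202,201),(120,121),(200,123),(122,102),(124,103),(12,1),(13,3),(14,4)],
     Leaf [(202,201),(122,121),(200,125),(120,101),(124,103),(12,1),(13,3),(14,4)],
     Leaf [(202,201),(120,101),(200,123),(122,102),(124,103),(12,1),(13,3),(14,4)]]"
  by code_simp

lemma hexagon_table_G6: "list_all2 (check (6 + 3)) (map (add_hexagon G6_edges) (sorted_triples [121,123,125]))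
    [Leaf [(1,12),(2,24),(3,34),(101,120),(102,122),(103,124),(121,200),(123,202),(125,204)]]"
  by code_simp

lemma path_table_G7: "list_all2 (check (6 + 2)) (map (add_path G7_edges) (triples [11,21,30]))
    [Leaf [(202,201),(31,25),(12,11),(200,21),(20,2),(1,6),(10,15),(22,23)],
     Leaf [(202,201),(20,25),(10,11),(200,30),(31,13),(12,4),(1,6),(22,23)],
     Leaf [(202,201),(10,2),(20,25),(200,30),(31,13),(12,4),(1,6),(22,23)]]"
  by code_simp

lemma hexagon_table_G7: "list_all2 (check (6 + 3)) (map (add_hexagon G7_edges) (sorted_triples [11,21,30]))
    [Leaf [(2,1),(6,24),(15,32),(23,22),(4,12),(11,200),(13,31),(21,202),(30,204)]]"
  by code_simp

lemma path_table_G9: "list_all2 (check (8 + 2)) (map (add_path G9_edges) (triples [51,53,55]))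
    [Leaf [(202,201),(50,3),(200,53),(52,5),(54,7),(11,10),(13,14),(2,1),(4,22),(6,24)],
     Leaf [(202,201),(52,5),(200,55),(50,3),(54,7),(11,10),(13,14),(2,1),(4,22),(6,24)],
     Leaf [(202,201),(50,3),(200,53),(52,5),(54,7),(11,10),(13,14),(2,1),(4,22),(6,24)]]"
  by code_simp

lemma hexagon_table_G9: "list_all2 (check (8 + 3)) (map (add_hexagon G9_edges) (sorted_triples [51,53,55]))
    [Leaf [(1,2),(10,11),(12,13),(3,50),(20,25),(7,54),(22,23),(5,52),(51,200),(53,202),(55,204)]]"
  by code_simp

text \<open>The edges, a third of the order (rounded down), and the vertices of degree 2.\<close>

definition blobs :: "((nat \<times> nat) list \<times> nat \<times> nat list) list" where
  "blobs = [(G1_edges, 3, [12,13,14,23,24,34]),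
    (G2_edges, 4, [101,102,103]),
    (G3_edges, 5, [11,13,15,21,23,25]),
    (G4_edges, 6, [3,5,7]),
    (G5_edges, 5, [112,113]),
    (G6_edges, 6, [121,123,125]),
    (G7_edges, 6, [11,21,30]),
    (G8_edges, 7, [41,42]),
    (G9_edges, 8, [51,53,55])]"

text \<open>These tables serve the cubic case: a vertex joined to all three ports of a blob gives
  order \<open>3 * m + 2\<close>, and \<open>m + 1\<close> edges bring the deficiency from 2 to -1.
  Among the blobs with exactly three ports, only G2 and G4 resist, and they give H1 and H2.\<close>

lemma vertex_table_G6: "check (6 + 1) (G6_edges @ map (Pair 200) [121,123,125])
    (Leaf [(1,12),(2,24),(3,34),(101,120),(102,122),(103,124),(121,200)])"
  by code_simp

lemma vertex_table_G7: "check (6 + 1) (G7_edges @ map (Pair 200) [11,21,30])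
    (Leaf [(2,1),(6,24),(15,32),(23,22),(4,12),(11,200),(13,31)])"
  by code_simp

lemma vertex_table_G9: "check (8 + 1) (G9_edges @ map (Pair 200) [51,53,55])
    (Leaf [(1,2),(10,11),(12,13),(3,50),(20,25),(7,54),(22,23),(5,52),(51,200)])"
  by code_simp

lemma vertex_table_G2: "iso_check (G2_edges @ map (Pair 200) [101,102,103]) H1_edges
    [(1,1),(2,2),(3,3),(4,4),(12,12),(13,13),(14,14),(23,23),(24,24),(34,34),(101,101),(102,102),
        (103,103),(200,130)]"
  by code_simp

lemma vertex_table_G4: "iso_check (G4_edges @ map (Pair 200) [3,5,7]) H2_edges
    [(1,1),(2,2),(3,3),(4,4),(5,5),(6,6),(7,7),(10,10),(11,11),(12,12),(13,13),(14,14),(15,15),(20,20),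
        (21,21),(22,22),(23,23),(24,24),(25,25),(200,60)]"
  by code_simp

section \<open>Induced copies of the blobs\<close>

lemma iso_check_sound:
  assumes "iso_check es es' ps"
  obtains h where "bij_betw h (verts es) (verts es')"
    "\<And>x y. x \<in> verts es \<Longrightarrow> y \<in> verts es \<Longrightarrow> ladj es x y \<longleftrightarrow> ladj es' (h x) (h y)"
proof -
  define h where "h = (\<lambda>x. the (map_of ps x))"
  define g where "g = (\<lambda>x. the (map_of (map prod.swap ps) x))"
  have E: "ladj es' (h a) (h b) \<and> g (h a) = a \<and> g (h b) = b" if "(a, b) \<in> set es" for a b
    using assms that by (auto simp: iso_check_def h_def g_def Let_def list_all_iff ladj_def)
  have E': "ladj es (g a) (g b) \<and> h (g a) = a \<and> h (g b) = b" if "(a, b) \<in> set es'" for a b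
    using assms that by (auto simp: iso_check_def h_def g_def Let_def list_all_iff ladj_def)
  have gh: "g (h x) = x" "h x \<in> verts es'" if x: "x \<in> verts es" for x
  proof -
    obtain y where "(x, y) \<in> set es \<or> (y, x) \<in> set es" using x unfolding verts_def by force
    then show "g (h x) = x" "h x \<in> verts es'" using E ladj_verts by blast+
  qed
  have hg: "h (g x) = x" "g x \<in> verts es" if x: "x \<in> verts es'" for x
  proof -
    obtain y where "(x, y) \<in> set es' \<or> (y, x) \<in> set es'" using x unfolding verts_def by force
    then show "h (g x) = x" "g x \<in> verts es" using E' ladj_verts by blast+
  qed
  have "bij_betw h (verts es) (verts es')"
    using gh hg by (intro bij_betw_byWitness[where f' = g]) auto
  moreover have "ladj es x y \<longleftrightarrow> ladj es' (h x) (h y)" if "x \<in> verts es" "y \<in> verts es" for x y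
  proof
    show "ladj es x y \<Longrightarrow> ladj es' (h x) (h y)" using E ladj_iff by blast
  next
    assume "ladj es' (h x) (h y)"
    then have "ladj es (g (h x)) (g (h y))" using E' ladj_iff by blast
    then show "ladj es x y" using gh that by simp
  qed
  ultimately show thesis using that by blast
qed

lemma verts_append: "ns \<noteq> [] \<Longrightarrow> verts (es @ map (Pair l) ns) = insert l (verts es \<union> set ns)"
  by (auto simp: verts_def image_Un image_image image_constant_conv)

lemma set_lnbrs: "set (lnbrs es x) = {y. ladj es x y}"
  by (auto simp: ladj_def)

lemma list_all2_ex: "list_all2 P xs ys \<Longrightarrow> x \<in> set xs \<Longrightarrow> \<exists>y. P x y"
  by (auto simp: list_all2_conv_all_nth in_set_conv_nth)

lemma blobs_data:
  assumes "(es, m, ds) \<in> set blobs"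
  shows "\<exists>cs. blob_data es m ds cs"
  using assms blob_data_G1 blob_data_G2 blob_data_G3 blob_data_G4 blob_data_G5 blob_data_G6
    blob_data_G7 blob_data_G8 blob_data_G9
  unfolding blobs_def by auto

lemma blobs_facts:
  assumes "(es, m, ds) \<in> set blobs"
  shows "card (verts es) = 3 * m + 1"
    and "x \<in> verts es \<Longrightarrow> card {y. ladj es x y} = (if x \<in> set ds then 2 else 3)"
    and "x \<in> verts es \<Longrightarrow> x < 200"
    and "set ds \<subseteq> verts es"
    and "h \<in> set ds \<Longrightarrow> h' \<in> set ds \<Longrightarrow> h \<noteq> h' \<Longrightarrow>
      \<exists>ps. length ps = m \<and> leaf_order es ps \<and> h \<notin> fst ` set ps \<union> snd ` set ps
        \<and> h' \<notin> fst ` set ps \<union> snd ` set ps"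
proof -
  obtain cs where cs: "blob_data es m ds cs" using blobs_data assms by blast
  have vs: "verts es = set (remdups (map fst es @ map snd es))" by (auto simp: verts_def)
  have deg: "length (remdups (lnbrs es x)) = card {y. ladj es x y}" for x
    by (simp add: set_lnbrs[symmetric] length_remdups_card_conv)
  show "card (verts es) = 3 * m + 1"
    using cs unfolding vs by (simp add: blob_data_def Let_def length_remdups_card_conv)
  show "x \<in> verts es \<Longrightarrow> card {y. ladj es x y} = (if x \<in> set ds then 2 else 3)"
    and "x \<in> verts es \<Longrightarrow> x < 200" and "set ds \<subseteq> verts es"
    using cs unfolding vs blob_data_def Let_def list_all_iff deg by blast+
  have 1: "\<And>ps. ps \<in> set cs \<Longrightarrow> length ps = m \<and> leaf_order es ps"
    and 2: "\<And>h h'. h \<in> set ds \<Longrightarrow> h' \<in> set ds \<Longrightarrow> h = h' \<or> (\<exists>ps\<in>set cs.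
      h \<notin> fst ` set ps \<union> snd ` set ps \<and> h' \<notin> fst ` set ps \<union> snd ` set ps)"
    using cs by (simp_all add: blob_data_def Let_def list_all_iff list_ex_iff)
  show "\<exists>ps. length ps = m \<and> leaf_order es ps \<and> h \<notin> fst ` set ps \<union> snd ` set ps
        \<and> h' \<notin> fst ` set ps \<union> snd ` set ps"
    if "h \<in> set ds" "h' \<in> set ds" "h \<noteq> h'"
    using 1 2[OF that(1,2)] that(3) by blast
qed

text \<open>Dispatches over the entries of \<open>blobs\<close>. G5 and G8 have only two ports,
  hence an empty list of triples.\<close>

lemma path_table:
  assumes "(es, m, ds) \<in> set blobs" "(h1, h2, h3) \<in> set (triples ds)"
  shows "\<exists>w. check (m + 2) (add_path es (h1, h2, h3)) w"
proof -
  have "\<exists>ws. list_all2 (check (m + 2)) (map (add_path es) (triples ds)) ws"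
    using assms(1) unfolding blobs_def list.set insert_iff empty_iff prod.inject
    by (elim disjE conjE FalseE; simp only:)
      (rule exI, rule path_table_G1,
       rule exI, rule path_table_G2,
       rule exI, rule path_table_G3,
       rule exI, rule path_table_G4,
       rule exI[of _ "[]"], simp add: triples_def,
       rule exI, rule path_table_G6,
       rule exI, rule path_table_G7,
       rule exI[of _ "[]"], simp add: triples_def,
       rule exI, rule path_table_G9)
  then show ?thesis using list_all2_ex assms(2) by (metis image_eqI set_map)
qed

text \<open>Four distinct ports are required, so only G1 and G3 have nonempty tables.\<close>

lemma biforked_table:
  assumes "(es, m, ds) \<in> set blobs" "(h1, h2, h3, h4) \<in> set (pairs_of_pairs ds)"
  shows "\<exists>w. check (m + 2) (add_biforked_path es (h1, h2, h3, h4)) w"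
proof -
  have "\<exists>ws. list_all2 (check (m + 2)) (map (add_biforked_path es) (pairs_of_pairs ds)) ws"
    using assms(1) unfolding blobs_def list.set insert_iff empty_iff prod.inject
    by (elim disjE conjE FalseE; simp only:)
      (rule exI, rule biforked_table_G1,
       rule exI[of _ "[]"], simp add: pairs_of_pairs_def,
       rule exI, rule biforked_table_G3,
       rule exI[of _ "[]"], simp add: pairs_of_pairs_def,
       rule exI[of _ "[]"], simp add: pairs_of_pairs_def,
       rule exI[of _ "[]"], simp add: pairs_of_pairs_def,
       rule exI[of _ "[]"], simp add: pairs_of_pairs_def,
       rule exI[of _ "[]"], simp add: pairs_of_pairs_def,
       rule exI[of _ "[]"], simp add: pairs_of_pairs_def)
  then show ?thesis using list_all2_ex assms(2) by (metis image_eqI set_map)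
qed

lemma hexagon_table:
  assumes "(es, m, ds) \<in> set blobs" "(h1, h2, h3) \<in> set (sorted_triples ds)"
  shows "\<exists>w. check (m + 3) (add_hexagon es (h1, h2, h3)) w"
proof -
  have "\<exists>ws. list_all2 (check (m + 3)) (map (add_hexagon es) (sorted_triples ds)) ws"
    using assms(1) unfolding blobs_def list.set insert_iff empty_iff prod.inject
    by (elim disjE conjE FalseE; simp only:)
      (rule exI, rule hexagon_table_G1,
       rule exI, rule hexagon_table_G2,
       rule exI, rule hexagon_table_G3,
       rule exI, rule hexagon_table_G4,
       rule exI[of _ "[]"], simp add: sorted_triples_def,
       rule exI, rule hexagon_table_G6,
       rule exI, rule hexagon_table_G7,
       rule exI[of _ "[]"], simp add: sorted_triples_def,
       rule exI, rule hexagon_table_G9)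
  then show ?thesis using list_all2_ex assms(2) by (metis image_eqI set_map)
qed

lemma vertex_table:
  assumes "(es, m, ds) \<in> set blobs" "length ds = 3"
  shows "(\<exists>w. check (m + 1) (es @ map (Pair 200) ds) w)
    \<or> (\<exists>es'\<in>{H1_edges, H2_edges}. \<exists>ps. iso_check (es @ map (Pair 200) ds) es' ps)"
proof -
  have "(es, m, ds) = (G2_edges, 4, [101,102,103]) \<or> (es, m, ds) = (G4_edges, 6, [3,5,7])
      \<or> (es, m, ds) = (G6_edges, 6, [121,123,125]) \<or> (es, m, ds) = (G7_edges, 6, [11,21,30])
      \<or> (es, m, ds) = (G9_edges, 8, [51,53,55])"
    using assms unfolding blobs_def list.set insert_iff empty_iff by (elim disjE FalseE; simp)
  then show ?thesis
    unfolding prod.inject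
    by (elim disjE conjE; simp only:)
      (rule disjI2, rule bexI, rule exI, rule vertex_table_G2, simp,
       rule disjI2, rule bexI, rule exI, rule vertex_table_G4, simp,
       rule disjI1, rule exI, rule vertex_table_G6, rule disjI1, rule exI, rule vertex_table_G7,
       rule disjI1, rule exI, rule vertex_table_G9)
qed

lemma blob_edges_blobs: "\<exists>m ds. (blob_edges i, m, ds) \<in> set blobs"
proof -
  have "blob_edges i \<in> fst ` set blobs" by (simp add: blob_edges_def blobs_def)
  then show ?thesis by (metis imageE prod.collapse)
qed

context subcubic
begin

definition realizes :: "(nat \<times> nat) list \<Rightarrow> ('a \<Rightarrow> nat) \<Rightarrow> 'a set \<Rightarrow> bool" where
  "realizes es f X \<longleftrightarrow>
     bij_betw f X (verts es) \<and> (\<forall>u\<in>X. \<forall>v\<in>X. adj u v \<longleftrightarrow> ladj es (f u) (f v))"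

lemma iso_mk_graph:
  "iso X (induced_edges E X) (fst (mk_graph es)) (snd (mk_graph es)) \<longleftrightarrow> (\<exists>f. realizes es f X)"
  unfolding iso_def realizes_def fst_mk_graph snd_mk_graph induced_edges_def by auto

definition bblob :: "'a set \<Rightarrow> bool" where
  "bblob X \<longleftrightarrow> (\<exists>es m ds f. (es, m, ds) \<in> set blobs \<and> realizes es f X)"

lemma realizes_card: "realizes es f X \<Longrightarrow> card X = card (verts es)"
  unfolding realizes_def by (blast intro: bij_betw_same_card)

lemma realizes_deg:
  assumes "realizes es f X" "v \<in> X"
  shows "ecount {v} X = card {y. ladj es (f v) y}"
proof -
  have bij: "bij_betw f X (verts es)" and a: "\<And>u w. u \<in> X \<Longrightarrow> w \<in> X \<Longrightarrow> adj u w \<longleftrightarrow> ladj es (f u) (f w)"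
    using assms by (auto simp: realizes_def)
  have "bij_betw f {w \<in> X. adj v w} {y. ladj es (f v) y}"
    unfolding bij_betw_def
  proof
    show "inj_on f {w \<in> X. adj v w}"
      using bij by (auto simp: bij_betw_def inj_on_def)
    show "f ` {w \<in> X. adj v w} = {y. ladj es (f v) y}"
    proof (intro equalityI subsetI)
      fix y assume "y \<in> {y. ladj es (f v) y}"
      then have y: "ladj es (f v) y" by simp
      then have "y \<in> verts es" using ladj_verts by blast
      then obtain w where "w \<in> X" "y = f w" using bij by (auto simp: bij_betw_def)
      then show "y \<in> f ` {w \<in> X. adj v w}" using y a assms(2) by auto
    qed (use a assms(2) in auto)
  qed
  then show ?thesis unfolding ecount_single by (rule bij_betw_same_card)
qed

text \<open>Gadgets are built vertex by vertex: the labelling extends by \<open>l\<close> at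
  \<open>w\<close>, and only the neighbours of \<open>w\<close> in the part already labelled have to
  be known.\<close>

lemma realizes_insert:
  assumes r: "realizes es f Z" and w: "w \<notin> Z" and l: "l \<notin> verts es"
    and ns: "set ns \<subseteq> verts es" "ns \<noteq> []"
    and nb: "\<And>v. v \<in> Z \<Longrightarrow> adj w v \<longleftrightarrow> f v \<in> set ns"
  shows "realizes (es @ map (Pair l) ns) (f(w := l)) (insert w Z)"
proof -
  have bij: "bij_betw f Z (verts es)" and a: "\<And>u v. u \<in> Z \<Longrightarrow> v \<in> Z \<Longrightarrow> adj u v \<longleftrightarrow> ladj es (f u) (f v)"
    using r by (auto simp: realizes_def)
  have img: "f v \<in> verts es" if "v \<in> Z" for v using that bij by (auto simp: bij_betw_def)
  have V: "verts (es @ map (Pair l) ns) = insert l (verts es)"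
    using ns by (auto simp: verts_append)
  have L: "ladj (es @ map (Pair l) ns) x y \<longleftrightarrow>
      ladj es x y \<or> (x = l \<and> y \<in> set ns) \<or> (y = l \<and> x \<in> set ns)" for x y
    by (auto simp: ladj_iff)
  have "bij_betw (f(w := l)) (insert w Z) (insert l (verts es))"
  proof (rule bij_betw_imageI)
    show "inj_on (f(w := l)) (insert w Z)"
      using bij w l img by (auto simp: inj_on_def bij_betw_def)
    show "(f(w := l)) ` insert w Z = insert l (verts es)"
      using bij w by (auto simp: bij_betw_def)
  qed
  moreover have "adj u v \<longleftrightarrow> ladj (es @ map (Pair l) ns) ((f(w := l)) u) ((f(w := l)) v)"
    if uv: "u \<in> insert w Z" "v \<in> insert w Z" for u v
  proof -
    have lns: "l \<notin> set ns" using l ns by auto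
    have nl: "\<not> ladj es l x" "\<not> ladj es x l" for x using l ladj_verts by blast+
    consider "u = w" "v = w" | "u = w" "v \<in> Z" "v \<noteq> w" | "u \<in> Z" "v = w" "u \<noteq> w"
      | "u \<in> Z" "v \<in> Z" "u \<noteq> w" "v \<noteq> w" using uv w by blast
    then show ?thesis
    proof cases
      case 1
      then show ?thesis using lns nl by (simp add: L)
    next
      case 2
      then show ?thesis using lns nl img[of v] l nb[of v] by (auto simp: L)
    next
      case 3
      then show ?thesis using lns nl img[of u] l nb[of u] by (auto simp: L insert_commute)
    next
      case 4
      then show ?thesis using img[of u] img[of v] l a[of u v] by (auto simp: L)
    qed
  qed
  ultimately show ?thesis by (simp add: realizes_def V)
qed

lemma nu_edge: "adj u v \<Longrightarrow> 1 \<le> nu {u, v}"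
  using defic_edge[of u v] edge_card[of "{u, v}"] by (simp add: defic_def)

text \<open>Pairs are added from the end of the list. The vertex labelled \<open>u\<close> has no
  neighbour among the later pairs, so all edges from the new pair to them contain the other vertex
  \<open>y\<close>, and \<open>nu_Un\<close> applies with \<open>y\<close> as the common
  vertex.\<close>

lemma leaf_order_nu:
  assumes "realizes es f X" "leaf_order es ps"
  shows "length ps \<le> nu {x \<in> X. f x \<in> fst ` set ps \<union> snd ` set ps}"
  using assms(2)
proof (induction ps)
  case (Cons p ps)
  obtain u v where p: "p = (u, v)" by force
  define W where "W = fst ` set ps \<union> snd ` set ps"
  have lo: "u \<noteq> v" "ladj es u v" "u \<notin> W" "v \<notin> W" "\<And>w. ladj es u w \<Longrightarrow> w \<notin> W" "leaf_order es ps"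
    using Cons.prems by (auto simp: p W_def Let_def ladj_def list_all_iff)
  have bij: "bij_betw f X (verts es)" and a: "\<And>u v. u \<in> X \<Longrightarrow> v \<in> X \<Longrightarrow> adj u v \<longleftrightarrow> ladj es (f u) (f v)"
    using assms(1) by (auto simp: realizes_def)
  have "u \<in> verts es" "v \<in> verts es" using lo(2) ladj_verts by blast+
  then obtain x y where xy: "x \<in> X" "f x = u" "y \<in> X" "f y = v"
    using bij unfolding bij_betw_def by (metis imageE)
  have inj: "inj_on f X" using bij by (simp add: bij_betw_def)
  have e1: "{x \<in> X. f x \<in> insert u (insert v W)} = {x, y} \<union> {x \<in> X. f x \<in> W}"
    using xy inj by (auto dest: inj_onD)
  have e2: "nu {x, y} + nu {x \<in> X. f x \<in> W} \<le> nu ({x, y} \<union> {x \<in> X. f x \<in> W})"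
  proof (rule nu_Un[where x = y])
    show "{x, y} \<inter> {x \<in> X. f x \<in> W} = {}" using xy lo by auto
    fix s t assume st: "s \<in> {x, y}" "t \<in> {x \<in> X. f x \<in> W}" "adj s t"
    have "s \<noteq> x" using st a[of x t] lo(5) xy by blast
    then show "s = y \<or> t = y" using st by simp
  qed
  have e3: "1 \<le> nu {x, y}" using a[of x y] xy lo by (intro nu_edge) simp
  have e4: "length ps \<le> nu {x \<in> X. f x \<in> W}" using Cons.IH lo(6) by (simp add: W_def)
  have e5: "fst ` set (p # ps) \<union> snd ` set (p # ps) = insert u (insert v W)"
    by (auto simp: W_def p)
  show ?case unfolding e5 e1 using e2 e3 e4 by simp
qed simp

lemma realizes_iso_check:
  assumes "realizes es f X" "iso_check es es' ps"
  shows "\<exists>g. realizes es' g X"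
proof -
  obtain h where h: "bij_betw h (verts es) (verts es')"
    "\<And>x y. x \<in> verts es \<Longrightarrow> y \<in> verts es \<Longrightarrow> ladj es x y \<longleftrightarrow> ladj es' (h x) (h y)"
    using iso_check_sound[OF assms(2)] by blast
  have bij: "bij_betw f X (verts es)" and a: "\<And>u v. u \<in> X \<Longrightarrow> v \<in> X \<Longrightarrow> adj u v \<longleftrightarrow> ladj es (f u) (f v)"
    using assms(1) by (auto simp: realizes_def)
  have img: "f v \<in> verts es" if "v \<in> X" for v using that bij by (auto simp: bij_betw_def)
  have "realizes es' (h \<circ> f) X"
    using bij_betw_trans[OF bij h(1)] a img h(2) by (simp add: realizes_def)
  then show ?thesis by blast
qed

lemma check_sound:
  assumes "realizes es f X" "check k es w"
  shows "k \<le> nu X \<or> bblob X"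
proof (cases w)
  case (Leaf ps)
  then have "k \<le> length ps" "leaf_order es ps" using assms by auto
  then have "k \<le> nu {x \<in> X. f x \<in> fst ` set ps \<union> snd ` set ps}"
    using leaf_order_nu[OF assms(1)] order_trans by blast
  moreover have "\<dots> \<le> nu X" by (rule nu_mono) auto
  ultimately show ?thesis by simp
next
  case (Square a b c d)
  then have l: "ladj es a b" "ladj es b c" "ladj es c d" "ladj es d a" "a \<noteq> c" "b \<noteq> d"
    using assms(2) by (auto simp: ladj_def)
  have bij: "bij_betw f X (verts es)" and adj: "\<And>u v. u \<in> X \<Longrightarrow> v \<in> X \<Longrightarrow> adj u v \<longleftrightarrow> ladj es (f u) (f v)"
    using assms(1) by (auto simp: realizes_def)
  have "\<exists>x\<in>X. f x = v" if "v \<in> verts es" for v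
    using that bij unfolding bij_betw_def by (metis imageE)
  then obtain w x y z where "w \<in> X" "f w = a" "x \<in> X" "f x = b" "y \<in> X" "f y = c" "z \<in> X" "f z = d"
    using l ladj_verts by metis
  then have False using no_square[of w x y z] adj l by auto
  then show ?thesis ..
next
  case (Iso i ps)
  obtain m ds where blob: "(blob_edges i, m, ds) \<in> set blobs" using blob_edges_blobs by blast
  obtain g where "realizes (blob_edges i) g X"
    using realizes_iso_check[OF assms(1)] assms(2) Iso by auto
  then show ?thesis using blob unfolding bblob_def by blast
qed

lemma bblobE:
  assumes "bblob Z"
  obtains es m ds f where "(es, m, ds) \<in> set blobs" "realizes es f Z" "card Z = 3 * m + 1"
    "\<And>v. v \<in> Z \<Longrightarrow> f v < 200" "inj_on f Z"
    "\<And>v. v \<in> Z \<Longrightarrow> ecount {v} Z = (if f v \<in> set ds then 2 else 3)"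
proof -
  obtain es m ds f where 1: "(es, m, ds) \<in> set blobs" "realizes es f Z"
    using assms unfolding bblob_def by blast
  have bij: "bij_betw f Z (verts es)" using 1(2) by (simp add: realizes_def)
  then have img: "f v \<in> verts es" if "v \<in> Z" for v using that by (auto simp: bij_betw_def)
  show thesis
  proof (rule that[OF 1])
    show "card Z = 3 * m + 1" using realizes_card[OF 1(2)] blobs_facts(1)[OF 1(1)] by simp
    show "f v < 200" if "v \<in> Z" for v using blobs_facts(3)[OF 1(1)] img that by blast
    show "inj_on f Z" using bij by (simp add: bij_betw_def)
    show "ecount {v} Z = (if f v \<in> set ds then 2 else 3)" if "v \<in> Z" for v
      using realizes_deg[OF 1(2) that] blobs_facts(2)[OF 1(1) img[OF that]] by simp
  qed
qed

lemma bblob_deg: "bblob Z \<Longrightarrow> v \<in> Z \<Longrightarrow> 2 \<le> ecount {v} Z"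
  by (erule bblobE) auto

text \<open>The remaining \<open>3 * m - 1\<close> vertices still carry the \<open>m\<close>
  matching edges that the blob data provide for these two ports.\<close>

lemma bblob_remove_two:
  assumes "bblob Z" "h \<in> Z" "h' \<in> Z" "h \<noteq> h'" "ecount {h} Z \<le> 2" "ecount {h'} Z \<le> 2"
  shows "defic (Z - {h, h'}) \<le> - 1"
proof -
  obtain es m ds f where b: "(es, m, ds) \<in> set blobs" "realizes es f Z" "card Z = 3 * m + 1"
    "inj_on f Z" "\<And>v. v \<in> Z \<Longrightarrow> ecount {v} Z = (if f v \<in> set ds then 2 else 3)"
    using bblobE[OF assms(1)] by metis
  have "f h \<in> set ds" "f h' \<in> set ds" 
    using assms(2,3,5,6) b(5)[of h] b(5)[of h'] by (auto split: if_splits)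
  moreover have "f h \<noteq> f h'" using assms b(4) by (auto dest: inj_onD)
  ultimately obtain ps where ps: "length ps = m" "leaf_order es ps"
    "f h \<notin> fst ` set ps \<union> snd ` set ps" "f h' \<notin> fst ` set ps \<union> snd ` set ps"
    using blobs_facts(5)[OF b(1)] by blast
  have "m \<le> nu {x \<in> Z. f x \<in> fst ` set ps \<union> snd ` set ps}"
    using leaf_order_nu[OF b(2) ps(2)] ps(1) by simp
  also have "\<dots> \<le> nu (Z - {h, h'})" using ps by (intro nu_mono) auto
  finally have "m \<le> nu (Z - {h, h'})" .
  moreover have "card (Z - {h, h'}) = 3 * m + 1 - 2"
    using assms b(3) by (subst card_Diff_subset) auto
  \<comment> \<open>Excludes \<open>m = 0\<close>, where the truncated difference
    \<open>3 * m + 1 - 2\<close> would be wrong.\<close>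
  moreover have "card {h, h'} \<le> card Z"
    using assms(2,3) b(3) by (intro card_mono) (auto intro: card_ge_0_finite)
  ultimately show ?thesis
    using assms(4) b(3) unfolding defic_def by (cases m) auto
qed

end

section \<open>Trees of blobs\<close>

context subcubic
begin

text \<open>The three edges at \<open>y\<close> exhaust its degree, so \<open>y\<close> has no
  neighbour elsewhere in the graph and each part hangs on a single edge.\<close>

definition joined :: "'a \<Rightarrow> 'a set \<Rightarrow> 'a set \<Rightarrow> 'a set \<Rightarrow> bool" where
  "joined y X1 X2 X3 \<longleftrightarrow> y \<notin> X1 \<and> y \<notin> X2 \<and> y \<notin> X3
     \<and> X1 \<inter> X2 = {} \<and> X1 \<inter> X3 = {} \<and> X2 \<inter> X3 = {}
     \<and> ecount X1 X2 = 0 \<and> ecount X1 X3 = 0 \<and> ecount X2 X3 = 0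
     \<and> ecount {y} X1 = 1 \<and> ecount {y} X2 = 1 \<and> ecount {y} X3 = 1"

text \<open>The counterpart of \<open>calG\<close> inside the given graph: single vertices and blobs
  take the place of the vertices of the set D of the host tree, and the join vertices take the place
  of the vertices of its set A.\<close>

inductive calH :: "'a set \<Rightarrow> bool" where
  single: "calH {x}"
| blob: "bblob X \<Longrightarrow> calH X"
| join: "calH X1 \<Longrightarrow> calH X2 \<Longrightarrow> calH X3 \<Longrightarrow> joined y X1 X2 X3 \<Longrightarrow> calH (insert y (X1 \<union> X2 \<union> X3))"

lemma joined_swap12: "joined y X1 X2 X3 \<Longrightarrow> joined y X2 X1 X3"
  unfolding joined_def by (auto simp: ecount_sym)

lemma joined_swap23: "joined y X1 X2 X3 \<Longrightarrow> joined y X1 X3 X2"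
  unfolding joined_def by (auto simp: ecount_sym)

lemma joined_swap13: "joined y X1 X2 X3 \<Longrightarrow> joined y X3 X2 X1"
  unfolding joined_def by (auto simp: ecount_sym)

lemma bblob_nonempty: "bblob X \<Longrightarrow> X \<noteq> {}"
  by (erule bblobE) auto

lemma calH_nonempty: "calH X \<Longrightarrow> X \<noteq> {}"
  by (erule calH.cases) (auto dest: bblob_nonempty)

text \<open>Only one edge connects \<open>y\<close> with \<open>X1\<close>. If \<open>X1\<close>
  fell apart, one of the two pieces would miss that edge and be cut off from the whole set.\<close>

lemma joined_conn:
  assumes j: "joined y X1 X2 X3" and c: "conn (insert y (X1 \<union> X2 \<union> X3))" and ne: "X1 \<noteq> {}"
  shows "conn X1"
proof (rule ccontr)
  assume "\<not> conn X1"
  then obtain Z where Z: "Z \<subset> X1" "Z \<noteq> {}" "ecount Z (X1 - Z) = 0"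
    using ne unfolding econn_def by (metis less_Suc0 linorder_not_le)
  have no: False if W: "W \<subset> X1" "W \<noteq> {}" "ecount W (X1 - W) = 0" "ecount {y} W = 0" for W
  proof -
    let ?X = "insert y (X1 \<union> X2 \<union> X3)"
    have "\<not> adj w v" if "w \<in> W" "v \<in> ?X - W" for w v
    proof -
      have "w \<in> X1" using W that by blast
      moreover have "v = y \<or> v \<in> X1 - W \<or> v \<in> X2 \<or> v \<in> X3" using that by blast
      ultimately show ?thesis using j W that unfolding joined_def ecount_eq_0 by (metis adj_sym singletonI)
    qed
    then have "ecount W (?X - W) = 0" by (simp add: ecount_eq_0)
    moreover have "W \<subset> ?X" using W by blast
    ultimately show False using econnD[OF c, of W] W by simp
  qed
  have "ecount {y} Z + ecount {y} (X1 - Z) = 1"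
    using ecount_Un_right[of Z "X1 - Z" "{y}"] Z j by (simp add: Un_absorb1 psubset_imp_subset joined_def)
  then consider "ecount {y} Z = 0" | "ecount {y} (X1 - Z) = 0" by linarith
  then show False
  proof cases
    case 1 then show ?thesis using no Z by blast
  next
    case 2
    have "X1 - (X1 - Z) = Z" using Z by blast
    moreover have "ecount (X1 - Z) Z = 0" using Z ecount_sym by metis
    ultimately show ?thesis using no[of "X1 - Z"] Z 2 by auto
  qed
qed

lemma joined_subst:
  assumes j: "joined y X1 X2 X3" and x: "x \<in> X1"
    and W: "W \<inter> insert y (X1 \<union> X2 \<union> X3) = {x}"
    and e: "ecount (W - {x}) (insert y (X1 \<union> X2 \<union> X3) - {x}) = 0"
  shows "joined y (X1 \<union> W) X2 X3"
proof -
  let ?X = "insert y (X1 \<union> X2 \<union> X3)"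
  have none: "\<not> adj w v" if "w \<in> W - {x}" "v \<in> ?X - {x}" for w v
    using e that by (simp add: ecount_eq_0)
  have yx: "y \<noteq> x" and yW: "y \<notin> W" using j x W by (auto simp: joined_def)
  have xn: "x \<notin> X2" "x \<notin> X3" using j x unfolding joined_def by blast+
  have "X1 \<union> W = X1 \<union> (W - {x})" "X1 \<inter> (W - {x}) = {}" using x W by auto
  then have "ecount {y} (X1 \<union> W) = ecount {y} X1 + ecount {y} (W - {x})"
    using ecount_Un_right by metis
  moreover have "ecount {y} (W - {x}) = 0"
    unfolding ecount_eq_0 using none yx adj_sym by blast
  moreover have "ecount (X1 \<union> W) X2 = 0"
    unfolding ecount_eq_0
  proof (intro ballI)
    fix a b assume ab: "a \<in> X1 \<union> W" "b \<in> X2"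
    then have "b \<noteq> x" using xn by auto
    then show "\<not> adj a b"
      using none[of a b] ab x j unfolding joined_def ecount_eq_0 by blast
  qed
  moreover have "ecount (X1 \<union> W) X3 = 0"
    unfolding ecount_eq_0
  proof (intro ballI)
    fix a b assume ab: "a \<in> X1 \<union> W" "b \<in> X3"
    then have "b \<noteq> x" using xn by auto
    then show "\<not> adj a b"
      using none[of a b] ab x j unfolding joined_def ecount_eq_0 by blast
  qed
  moreover have "(X1 \<union> W) \<inter> X2 = {}" "(X1 \<union> W) \<inter> X3 = {}"
  proof -
    have "X1 \<inter> X2 = {}" "X1 \<inter> X3 = {}" using j by (simp_all add: joined_def)
    moreover have "w = x" if "w \<in> W" "w \<in> X2 \<union> X3" for w using W that by blast
    ultimately show "(X1 \<union> W) \<inter> X2 = {}" "(X1 \<union> W) \<inter> X3 = {}" using xn by blast+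
  qed
  ultimately show ?thesis using j yW by (simp add: joined_def)
qed

text \<open>Undoes the replacement of one side of a bridge by a vertex: a leaf \<open>x\<close> of
  one tree of blobs is expanded into another tree of blobs. In a join, \<open>x\<close> lies in a
  part, which is either \<open>{x}\<close> itself or has \<open>x\<close> as a leaf again; a blob
  has no leaf.\<close>

lemma calH_subst:
  assumes "calH X" "conn X" "x \<in> X" "ecount {x} X = 1"
    and "calH W" "W \<inter> X = {x}" "ecount (W - {x}) (X - {x}) = 0"
  shows "calH (X \<union> W)"
  using assms(1-4,6,7)
proof (induction rule: calH.induct)
  case (single x')
  then show ?case using \<open>calH W\<close> by (simp add: ecount_single_single)
next
  case (blob X)
  then show ?case using bblob_deg by fastforce
next
  case (join X1 X2 X3 y)
  have main: "calH (insert y (X1 \<union> X2 \<union> X3) \<union> W)"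
    if j: "joined y X1 X2 X3" and c: "conn (insert y (X1 \<union> X2 \<union> X3))"
      and x: "x \<in> X1" and e1: "ecount {x} (insert y (X1 \<union> X2 \<union> X3)) = 1"
      and W: "W \<inter> insert y (X1 \<union> X2 \<union> X3) = {x}"
      and e: "ecount (W - {x}) (insert y (X1 \<union> X2 \<union> X3) - {x}) = 0"
      and H: "calH X2" "calH X3"
      and IH: "conn X1 \<Longrightarrow> x \<in> X1 \<Longrightarrow> ecount {x} X1 = 1 \<Longrightarrow> W \<inter> X1 = {x} \<Longrightarrow>
        ecount (W - {x}) (X1 - {x}) = 0 \<Longrightarrow> calH (X1 \<union> W)"
    for X1 X2 X3
  proof -
    have c1: "conn X1" using joined_conn[OF j c] x by blast
    have sub: "ecount {x} X1 + ecount {x} {y} \<le> 1"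
    proof -
      have "ecount {x} (X1 \<union> {y}) \<le> ecount {x} (insert y (X1 \<union> X2 \<union> X3))"
        by (rule ecount_mono) auto
      then show ?thesis using e1 ecount_Un_right[of X1 "{y}" "{x}"] j by (auto simp: joined_def)
    qed
    have "calH (X1 \<union> W)"
    proof (cases "X1 = {x}")
      case True
      then have "X1 \<union> W = W" using W by blast
      then show ?thesis using \<open>calH W\<close> by simp
    next
      case False
      then have "1 \<le> ecount {x} (X1 - {x})" using econnD[OF c1, of "{x}"] x by auto
      moreover have "ecount {x} (X1 - {x}) \<le> ecount {x} X1" by (rule ecount_mono) auto
      ultimately have "ecount {x} X1 = 1" using sub by linarith
      moreover have "ecount (W - {x}) (X1 - {x}) = 0"
        using e unfolding ecount_eq_0 by blast
      moreover have "W \<inter> X1 = {x}" using W x by blast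
      ultimately show ?thesis using IH c1 x by blast
    qed
    then have "calH (insert y ((X1 \<union> W) \<union> X2 \<union> X3))"
      using H joined_subst[OF j x W e] by (rule calH.join)
    moreover have "insert y ((X1 \<union> W) \<union> X2 \<union> X3) = insert y (X1 \<union> X2 \<union> X3) \<union> W" by auto
    ultimately show ?thesis by (simp only:)
  qed
  have eqs: "X2 \<union> X1 \<union> X3 = X1 \<union> X2 \<union> X3" "X3 \<union> X2 \<union> X1 = X1 \<union> X2 \<union> X3" by auto
  have "x \<noteq> y"
  proof
    assume xy: "x = y"
    have "ecount {y} (X1 \<union> X2) \<le> ecount {y} (insert y (X1 \<union> X2 \<union> X3))"
      by (rule ecount_mono) auto
    moreover have "ecount {y} (X1 \<union> X2) = 2"
      using join.hyps ecount_Un_right[of X1 X2 "{y}"] by (simp add: joined_def)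
    ultimately show False using join.prems xy by simp
  qed
  then consider "x \<in> X1" | "x \<in> X2" | "x \<in> X3" using join.prems by blast
  then show ?case
  proof cases
    case 1
    show ?thesis by (rule main) (use 1 join in blast)+
  next
    case 2
    have "calH (insert y (X2 \<union> X1 \<union> X3) \<union> W)"
      by (rule main; (unfold eqs)?) (use 2 join joined_swap12 in blast)+
    then show ?thesis unfolding eqs .
  next
    case 3
    have "calH (insert y (X3 \<union> X2 \<union> X1) \<union> W)"
      by (rule main; (unfold eqs)?) (use 3 join joined_swap13 in blast)+
    then show ?thesis unfolding eqs .
  qed
qed

lemma joined_deg: "joined y X1 X2 X3 \<Longrightarrow> insert y (X1 \<union> X2 \<union> X3) = K \<Longrightarrow> v \<notin> K \<Longrightarrow> \<not> adj y v"
proof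
  assume j: "joined y X1 X2 X3" and K: "insert y (X1 \<union> X2 \<union> X3) = K" "v \<notin> K" and a: "adj y v"
  have "ecount {y} (X1 \<union> X2 \<union> X3) = ecount {y} (X1 \<union> X2) + ecount {y} X3"
    using j by (intro ecount_Un_right) (auto simp: joined_def)
  also have "ecount {y} (X1 \<union> X2) = ecount {y} X1 + ecount {y} X2"
    using j by (intro ecount_Un_right) (auto simp: joined_def)
  finally have "ecount {y} (X1 \<union> X2 \<union> X3) = 3" using j by (simp add: joined_def)
  moreover have "ecount {y} (X1 \<union> X2 \<union> X3) \<le> 2"
    using K a by (intro ecount_single_less[of v]) auto
  ultimately show False by simp
qed

lemma joined_leaving:
  assumes j: "joined y X1 X2 X3" and K: "K = insert y (X1 \<union> X2 \<union> X3)" and KX: "K \<subseteq> X"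
  shows "ecount X1 (X - X1) = ecount X1 (X - K) + 1"
    and "ecount K (X - K) = ecount X1 (X - K) + ecount X2 (X - K) + ecount X3 (X - K)"
proof -
  have "X - X1 = (X - K) \<union> ({y} \<union> (X2 \<union> X3))" using K KX j unfolding joined_def by blast
  then have "ecount X1 (X - X1) = ecount X1 (X - K) + ecount X1 ({y} \<union> (X2 \<union> X3))"
    using K by (simp only:) (rule ecount_Un_right, auto)
  also have "ecount X1 ({y} \<union> (X2 \<union> X3)) = ecount X1 {y} + ecount X1 (X2 \<union> X3)"
    using j by (intro ecount_Un_right) (auto simp: joined_def)
  also have "ecount X1 (X2 \<union> X3) = 0" using j unfolding joined_def ecount_eq_0 by blast
  also have "ecount X1 {y} = 1" using j by (simp add: joined_def ecount_sym)
  finally show "ecount X1 (X - X1) = ecount X1 (X - K) + 1" by simp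
  have "ecount K (X - K) = ecount ({y} \<union> (X1 \<union> X2 \<union> X3)) (X - K)" using K by simp
  also have "\<dots> = ecount {y} (X - K) + ecount (X1 \<union> X2 \<union> X3) (X - K)"
    using j by (intro ecount_Un_left) (auto simp: joined_def)
  also have "ecount {y} (X - K) = 0"
    unfolding ecount_eq_0 using joined_deg[OF j K[symmetric]] by blast
  also have "ecount (X1 \<union> X2 \<union> X3) (X - K) = ecount (X1 \<union> X2) (X - K) + ecount X3 (X - K)"
    using j by (intro ecount_Un_left) (auto simp: joined_def)
  also have "ecount (X1 \<union> X2) (X - K) = ecount X1 (X - K) + ecount X2 (X - K)"
    using j by (intro ecount_Un_left) (auto simp: joined_def)
  finally show "ecount K (X - K) = ecount X1 (X - K) + ecount X2 (X - K) + ecount X3 (X - K)" by simp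
qed

text \<open>Each part sends exactly one edge to \<open>y\<close>. Since \<open>X\<close> has no
  bridge, it sends another one, which must leave \<open>K\<close>; these are counted by
  \<open>l1\<close>, \<open>l2\<close>, \<open>l3\<close>.\<close>

lemma joined_parts:
  assumes j: "joined y X1 X2 X3" and K: "K = insert y (X1 \<union> X2 \<union> X3)" and KX: "K \<subseteq> X"
    and c: "econn 2 X" and ne: "X1 \<noteq> {}" "X2 \<noteq> {}" "X3 \<noteq> {}"
  obtains l1 l2 l3 where "ecount X1 (X - X1) = l1 + 1" "ecount X2 (X - X2) = l2 + 1"
    "ecount X3 (X - X3) = l3 + 1" "1 \<le> l1" "1 \<le> l2" "1 \<le> l3" "ecount K (X - K) = l1 + l2 + l3"
    "ecount X1 (X - K) = l1" "ecount X2 (X - K) = l2" "ecount X3 (X - K) = l3"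
proof -
  have K2: "K = insert y (X2 \<union> X1 \<union> X3)" and K3: "K = insert y (X3 \<union> X2 \<union> X1)" using K by auto
  note e1 = joined_leaving[OF j K KX]
    and e2 = joined_leaving(1)[OF joined_swap12[OF j] K2 KX]
    and e3 = joined_leaving(1)[OF joined_swap13[OF j] K3 KX]
  have "X1 \<subset> X" "X2 \<subset> X" "X3 \<subset> X" using j K KX unfolding joined_def by blast+
  then have "2 \<le> ecount X1 (X - X1)" "2 \<le> ecount X2 (X - X2)" "2 \<le> ecount X3 (X - X3)"
    using econnD[OF c] ne by blast+
  then show thesis using that e1 e2 e3 by simp
qed

lemma calH_cases:
  assumes "calH K" "K \<subseteq> X" "econn 2 X"
  obtains (single) x where "K = {x}" | (blob) "bblob K"
  | (join) y X1 X2 X3 where "joined y X1 X2 X3" "calH X1" "calH X2" "calH X3"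
      "K = insert y (X1 \<union> X2 \<union> X3)" "3 \<le> ecount K (X - K)"
  using assms(1)
proof cases
  case (join X1 X2 X3 y)
  have "3 \<le> ecount K (X - K)"
    by (rule joined_parts[OF join(5,1) assms(2,3) calH_nonempty[OF join(2)]
          calH_nonempty[OF join(3)] calH_nonempty[OF join(4)]]) simp
  then show ?thesis using join that(3) by blast
qed (use that in auto)

text \<open>Cut \<open>X\<close> into the blob without its two ports \<open>h1\<close>,
  \<open>h2\<close> (deficiency at most -1), the edge from \<open>h1\<close> to \<open>p\<close>
  (-1), the rest \<open>R\<close> (at most 1) and the vertex \<open>h2\<close> (1). The pieces are
  put together along cuts through \<open>p\<close> and then \<open>h1\<close>, and the sum is
  0.\<close>

lemma bblob_two_edge_cut:
  assumes X: "X \<subseteq> V" "econn 2 X" and IH: "\<And>Y. Y \<subset> X \<Longrightarrow> conn Y \<Longrightarrow> defic Y \<le> 1"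
    and Z: "bblob Z" "Z \<subset> X" "ecount Z (X - Z) = 2"
  shows "defic X \<le> 0"
proof -
  define C where "C = {(z, r). z \<in> Z \<and> r \<in> X - Z \<and> adj z r}"
  have "card C = 2" using Z(3) by (simp add: ecount_def C_def)
  then obtain h1 p h2 q where C: "C = {(h1, p), (h2, q)}" "(h1, p) \<noteq> (h2, q)"
    unfolding card_2_iff by (metis prod.collapse)
  have hp: "h1 \<in> Z" "p \<in> X - Z" "adj h1 p" and hq: "h2 \<in> Z" "q \<in> X - Z" "adj h2 q"
    using C by (auto simp: C_def set_eq_iff)
  have only: "(z, r) = (h1, p) \<or> (z, r) = (h2, q)" if "z \<in> Z" "r \<in> X - Z" "adj z r" for z r
  proof -
    have "(z, r) \<in> C" using that by (simp add: C_def)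
    then show ?thesis using C by blast
  qed
  have h12: "h1 \<noteq> h2"
  proof
    assume eq: "h1 = h2"
    then have pq: "p \<noteq> q" using C by auto
    have "ecount {h1} (Z \<union> {p, q}) = ecount {h1} Z + ecount {h1} {p, q}"
      using hp hq by (intro ecount_Un_right) auto
    moreover have "ecount {h1} {p, q} = 2"
      using pq hp hq eq ecount_insert_right[of p "{q}" "{h1}"]
      by (simp add: ecount_single_single adj_sym)
    moreover have "2 \<le> ecount {h1} Z" using bblob_deg Z hp by blast
    ultimately show False using ecount_single_le[of h1 "Z \<union> {p, q}"] by linarith
  qed
  have "ecount {h1} Z \<le> 2" "ecount {h2} Z \<le> 2"
    using hp hq by (auto intro: ecount_single_less)
  then have d1: "defic (Z - {h1, h2}) \<le> - 1"
    using bblob_remove_two[OF Z(1)] hp hq h12 by blast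
  define R where "R = X - Z - {p}"
  \<comment> \<open>At most two edges go from \<open>R\<close> to \<open>p\<close> and at most one
    goes to \<open>Z\<close>. Fewer than four edges cannot separate two components in a
    2-edge-connected set, so \<open>R\<close> is connected.\<close>
  have d2: "defic R \<le> 1"
  proof (cases "R = {}")
    case True
    then show ?thesis by (simp add: defic_def)
  next
    case False
    have RX: "R \<subset> X" using hp by (auto simp: R_def)
    have "X - R = insert p Z" using hp Z(2) by (auto simp: R_def)
    then have "ecount R (X - R) = ecount {p} R + ecount R Z"
      using hp by (simp add: ecount_insert_right)
    moreover have "ecount {p} R \<le> 2"
      using hp by (intro ecount_single_less[of h1]) (auto simp: R_def adj_sym)
    moreover have "ecount R Z \<le> 1"
    proof -
      have "X - Z = insert p R" "p \<notin> R" using hp by (auto simp: R_def)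
      then have "ecount Z (X - Z) = ecount {p} Z + ecount Z R"
        by (simp add: ecount_insert_right)
      moreover have "1 \<le> ecount {p} Z"
        using hp ecount_eq_0[of "{p}" Z] adj_sym by (metis insertI1 less_one linorder_not_le)
      ultimately show ?thesis using Z(3) by (simp add: ecount_sym)
    qed
    ultimately have "conn R" using conn_if_few_edges[OF X(2) RX False] by simp
    then show ?thesis using IH RX by blast
  qed
  have RV: "R \<subseteq> V" "Z \<subseteq> V" "h1 \<in> V" "p \<in> V" using X Z hp by (auto simp: R_def)
  have "defic ({h1, p} \<union> R) \<le> defic {h1, p} + defic R"
  proof (rule defic_Un[where x = p])
    show "{h1, p} \<inter> R = {}" using hp by (auto simp: R_def)
    fix s t assume st: "s \<in> {h1, p}" "t \<in> R" "adj s t"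
    show "s = p \<or> t = p"
    proof (cases "s = h1")
      case True
      then show ?thesis using only[of s t] st hp h12 by (auto simp: R_def)
    qed (use st in auto)
  qed (use RV in auto)
  moreover have "defic {h1, p} \<le> - 1" using hp defic_edge by blast
  moreover have "defic ((Z - {h1, h2}) \<union> ({h1, p} \<union> R)) \<le> defic (Z - {h1, h2}) + defic ({h1, p} \<union> R)"
  proof (rule defic_Un[where x = h1])
    show "(Z - {h1, h2}) \<inter> ({h1, p} \<union> R) = {}" using hp by (auto simp: R_def)
    fix s t assume st: "s \<in> Z - {h1, h2}" "t \<in> {h1, p} \<union> R" "adj s t"
    show "s = h1 \<or> t = h1"
    proof (rule ccontr)
      assume "\<not> ?thesis"
      then have "t \<in> X - Z" using st hp by (auto simp: R_def)
      then show False using only[of s t] st by auto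
    qed
  qed (use RV in auto)
  moreover have "defic (insert h2 ((Z - {h1, h2}) \<union> ({h1, p} \<union> R)))
      \<le> defic ((Z - {h1, h2}) \<union> ({h1, p} \<union> R)) + 1"
    using RV by (intro defic_insert) auto
  moreover have "insert h2 ((Z - {h1, h2}) \<union> ({h1, p} \<union> R)) = X"
    using hp hq Z(2) by (auto simp: R_def)
  ultimately show ?thesis using d1 d2 by simp
qed

section \<open>The induction claim, and the induction step at leaves and bridges\<close>

definition bounded :: "'a set \<Rightarrow> bool" where
  "bounded X \<longleftrightarrow> defic X \<le> 1 \<and> (defic X = 1 \<longrightarrow> calH X)"

lemma defic_parts:
  assumes "P \<union> Q \<subseteq> V" "P \<inter> Q = {}" "ecount P Q = 0"
  shows "defic (P \<union> Q) \<le> defic P + defic Q"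
  using assms by (intro defic_Un) (auto simp: ecount_eq_0)

text \<open>Removing the leaf \<open>u\<close> and its neighbour \<open>y\<close> lowers the bound
  by 1 and leaves at most two components, as \<open>y\<close> has at most two other neighbours.
  Deficiency 1 then needs two components of deficiency 1, and \<open>y\<close> joins them with
  \<open>{u}\<close>.\<close>

lemma bounded_leaf:
  assumes X: "X \<subseteq> V" "conn X" and u: "u \<in> X" "ecount {u} X = 1"
    and IH: "\<And>Y. Y \<subset> X \<Longrightarrow> conn Y \<Longrightarrow> bounded Y"
  shows "bounded X"
proof -
  obtain y where y: "{w \<in> X. adj u w} = {y}"
    using u(2) unfolding ecount_single by (metis card_1_singletonE One_nat_def)
  then have yX: "y \<in> X" "adj u y" "u \<noteq> y" by (auto simp: set_eq_iff)
  define Y where "Y = X - {u, y}"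
  have XY: "X - Y = {u, y}" "X = {u, y} \<union> Y" using u yX by (auto simp: Y_def)
  have uY: "\<not> adj u v" if "v \<in> Y" for v using y that by (auto simp: Y_def)
  have YV: "Y \<subseteq> V" "{u, y} \<subseteq> V" using X u yX by (auto simp: Y_def)
  have "defic ({u, y} \<union> Y) \<le> defic {u, y} + defic Y"
    by (rule defic_Un[where x = y]) (use YV uY in \<open>auto simp: Y_def\<close>)
  then have d: "defic X \<le> defic Y - 1" using XY defic_edge[OF yX(2)] by simp
  show ?thesis
  proof (cases "Y = {}")
    case True
    then have "defic Y \<le> 0" by simp
    then show ?thesis using d by (simp add: bounded_def)
  next
    case False
    have YX: "Y \<subset> X" using u by (auto simp: Y_def)
    have "ecount {u} Y = 0" using uY by (simp add: ecount_eq_0)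
    moreover have "ecount Y {u, y} = ecount {u} Y + ecount {y} Y"
      using ecount_insert_right[of u "{y}" Y] yX by (simp add: ecount_sym)
    ultimately have e: "ecount Y (X - Y) = ecount {y} Y" using XY by simp
    have le: "ecount {y} Y \<le> 2"
      using yX by (intro ecount_single_less[of u]) (auto simp: Y_def adj_sym)
    show ?thesis
    proof (cases "conn Y")
      case True
      then show ?thesis using IH[OF YX] d by (auto simp: bounded_def)
    next
      case nc: False
      obtain P Q where PQ: "Y = P \<union> Q" "P \<inter> Q = {}" "conn P" "conn Q" "ecount P Q = 0"
        "1 \<le> ecount P (X - Y)" "1 \<le> ecount Q (X - Y)"
        "ecount Y (X - Y) = ecount P (X - Y) + ecount Q (X - Y)"
        using two_parts_if_few_edges[OF X(2) YX False _ nc] e le by auto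
      have "P \<subset> X" "Q \<subset> X" using YX PQ(1) by auto
      then have b: "bounded P" "bounded Q" using IH[of P] IH[of Q] PQ by blast+
      have dY: "defic Y \<le> defic P + defic Q" using PQ YV defic_parts[of P Q] by simp
      show ?thesis
        unfolding bounded_def
      proof (intro conjI impI)
        show "defic X \<le> 1" using d dY b by (simp add: bounded_def)
        assume "defic X = 1"
        then have "defic P = 1" "defic Q = 1" using d dY b by (auto simp: bounded_def)
        then have H: "calH P" "calH Q" using b by (auto simp: bounded_def)
        have u0: "ecount {u} P = 0" "ecount {u} Q = 0" using uY PQ(1) by (auto simp: ecount_eq_0)
        have "ecount P (X - Y) = ecount {u} P + ecount {y} P" "ecount Q (X - Y) = ecount {u} Q + ecount {y} Q"
          unfolding XY(1) using ecount_insert_right[of u "{y}"] yX by (simp_all add: ecount_sym)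
        then have "ecount {y} P = 1" "ecount {y} Q = 1" using PQ(6-8) u0 e le by linarith+
        moreover have "ecount {y} {u} = 1" using yX by (simp add: ecount_single_single adj_sym)
        ultimately have "joined y {u} P Q"
          using PQ(1,2,5) u0 yX unfolding joined_def by (auto simp: Y_def)
        then have "calH (insert y ({u} \<union> P \<union> Q))" using H calH.single by (intro calH.join)
        moreover have "insert y ({u} \<union> P \<union> Q) = X" using XY PQ(1) by auto
        ultimately show "calH X" by simp
      qed
    qed
  qed
qed

lemma conn_insert:
  assumes "conn A" "a \<in> A" "adj x a"
  shows "conn (insert x A)"
proof -
  have "1 \<le> ecount Z (insert x A - Z)" if Z: "Z \<subset> insert x A" "Z \<noteq> {}" for Z
  proof (rule ccontr)
    assume "\<not> ?thesis"
    then have "ecount Z (insert x A - Z) = 0" by simp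
    then have none: "\<not> adj z w" if "z \<in> Z" "w \<in> insert x A - Z" for z w
      using that by (simp add: ecount_eq_0)
    have "Z \<inter> A = {} \<or> A \<subseteq> Z"
    proof (rule ccontr)
      assume "\<not> ?thesis"
      then have "Z \<inter> A \<subset> A" "Z \<inter> A \<noteq> {}" by auto
      then obtain v w where "v \<in> Z \<inter> A" "w \<in> A - (Z \<inter> A)" "adj v w"
        by (rule conn_edge_out[OF assms(1)])
      then show False using none[of v w] by auto
    qed
    then show False
    proof
      assume "Z \<inter> A = {}"
      then have "Z = {x}" "x \<notin> A" using Z by auto
      then show False using none[of x a] assms by auto
    next
      assume "A \<subseteq> Z"
      then have "x \<notin> Z" using Z by auto
      then show False using none[of a x] \<open>A \<subseteq> Z\<close> assms adj_sym by blast
    qed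
  qed
  then show ?thesis by (auto simp: econn_def)
qed

text \<open>Let \<open>x\<close> be the end of the bridge in \<open>Z\<close>. The set
  \<open>Z - {x}\<close> has order divisible by 3 and at most two components, so its deficiency is
  at most 2 and hence at most 0. Thus \<open>X\<close> is no worse than \<open>X'\<close>, in which
  \<open>Z\<close> has shrunk to the leaf \<open>x\<close>, and \<open>calH_subst\<close> expands
  the leaf again.\<close>

lemma bounded_bridge_side:
  assumes X: "X \<subseteq> V" "conn X" and deg: "\<And>v. v \<in> X \<Longrightarrow> 2 \<le> ecount {v} X"
    and IH: "\<And>Y. Y \<subset> X \<Longrightarrow> conn Y \<Longrightarrow> bounded Y"
    and Z: "Z \<subset> X" "Z \<noteq> {}" "ecount Z (X - Z) = 1" "defic Z = 1"
  shows "bounded X"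
proof -
  have cZ: "conn Z" using conn_if_few_edges[OF X(2) Z(1,2)] Z(3) by simp
  have "X - (X - Z) = Z" using Z by blast
  then have cR: "conn (X - Z)"
    using conn_if_few_edges[OF X(2), of "X - Z"] Z by (auto simp: ecount_sym)
  have "\<exists>!e. e \<in> {(z, r). z \<in> Z \<and> r \<in> X - Z \<and> adj z r}"
    using Z(3) unfolding ecount_def by (metis (no_types, lifting) card_1_singletonE singletonD singletonI One_nat_def)
  then obtain x r where xr: "x \<in> Z" "r \<in> X - Z" "adj x r"
    and only: "\<And>z w. z \<in> Z \<Longrightarrow> w \<in> X - Z \<Longrightarrow> adj z w \<Longrightarrow> z = x \<and> w = r" by blast
  define Y where "Y = Z - {x}"
  define X' where "X' = insert x (X - Z)"
  \<comment> \<open>If \<open>Z\<close> were \<open>{x}\<close>, the bridge would be the only edge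
    at \<open>x\<close>, against the minimum degree. So \<open>X'\<close> is a proper subset of
    \<open>X\<close>, and the induction hypothesis applies to it.\<close>
  have "Y \<noteq> {}"
  proof
    assume "Y = {}"
    then have "Z = {x}" using xr by (auto simp: Y_def)
    moreover have "ecount {x} X = ecount {x} {x} + ecount {x} (X - {x})"
      using ecount_Un_right[of "{x}" "X - {x}" "{x}"] xr Z by (simp add: insert_absorb subset_iff psubset_eq)
    ultimately show False using Z(3) deg[of x] xr Z by (auto simp: ecount_single_single)
  qed
  have YZ: "Y \<subset> Z" "Y \<subset> X" using xr Z by (auto simp: Y_def)
  have YV: "Y \<subseteq> V" using YZ X by auto
  have "card Z = Suc (card Y)"
    using xr finite_sub[of Z] X Z unfolding Y_def by (metis card.remove order_trans psubset_imp_subset)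
  then have "int (card Y) mod 3 = 0"
    using defic_mod[of Z] Z(4) by (simp add: mod_eq_dvd_iff) presburger
  then have dm: "defic Y mod 3 = 0" using defic_mod by simp
  have "Z - Y = {x}" using xr by (auto simp: Y_def)
  then have e: "ecount Y (Z - Y) = ecount {x} Y" by (simp add: ecount_sym)
  have le: "ecount {x} Y \<le> 2" using xr by (intro ecount_single_less[of r]) (auto simp: Y_def)
  have "defic Y \<le> 2"
  proof (cases "conn Y")
    case True
    then have "bounded Y" using IH YZ(2) by blast
    then show ?thesis by (simp add: bounded_def)
  next
    case False
    have "ecount Y (Z - Y) < 3 * Suc 0" using e le by simp
    then obtain P Q where PQ: "Y = P \<union> Q" "P \<inter> Q = {}" "conn P" "conn Q" "ecount P Q = 0"
      using two_parts_if_few_edges[OF cZ YZ(1) \<open>Y \<noteq> {}\<close> _ False] by metis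
    then have "P \<subset> X" "Q \<subset> X" using YZ by auto
    then have "bounded P" "bounded Q" using IH[of P] IH[of Q] PQ by blast+
    then show ?thesis using defic_parts[of P Q] PQ YV by (auto simp: bounded_def)
  qed
  then have dY: "defic Y \<le> 0" using dm by presburger
  have X'X: "X' \<subset> X" using xr Z \<open>Y \<noteq> {}\<close> by (auto simp: X'_def Y_def)
  have cX': "conn X'" unfolding X'_def using cR xr by (intro conn_insert[of _ r]) auto
  have "defic (Y \<union> X') \<le> defic Y + defic X'"
  proof (rule defic_Un[where x = x])
    show "Y \<inter> X' = {}" by (auto simp: Y_def X'_def)
    show "s = x \<or> t = x" if "s \<in> Y" "t \<in> X'" "adj s t" for s t
      using that only[of s t] by (auto simp: Y_def X'_def)
  qed (use YV X X'X in auto)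
  moreover have "Y \<union> X' = X" using xr Z by (auto simp: Y_def X'_def)
  ultimately have d: "defic X \<le> defic X'" using dY by simp
  have b: "bounded X'" "bounded Z" using IH[of X'] IH[of Z] X'X cX' Z cZ by blast+
  show ?thesis
    unfolding bounded_def
  proof (intro conjI impI)
    show "defic X \<le> 1" using d b by (simp add: bounded_def)
    assume "defic X = 1"
    then have H: "calH X'" "calH Z" using d b Z(4) by (auto simp: bounded_def)
    have "calH (X' \<union> Z)"
    proof (rule calH_subst[OF H(1) cX' _ _ H(2)])
      show "x \<in> X'" by (simp add: X'_def)
      show "Z \<inter> X' = {x}" using xr by (auto simp: X'_def)
      have "X' - {x} = X - Z" using xr by (auto simp: X'_def)
      then show "ecount (Z - {x}) (X' - {x}) = 0"
        using only by (auto simp: ecount_eq_0)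
      have "w = r" if "w \<in> X'" "adj x w" for w
        using that only[of x w] xr(1) by (auto simp: X'_def)
      moreover have "r \<in> X'" using xr by (simp add: X'_def)
      ultimately have "{w \<in> X'. adj x w} = {r}" using xr(3) by blast
      then show "ecount {x} X' = 1" by (simp add: ecount_single)
    qed
    moreover have "X' \<union> Z = X" using xr Z by (auto simp: X'_def)
    ultimately show "calH X" by simp
  qed
qed

text \<open>If neither side has deficiency 1, both have deficiency at most 0, and they are added
  along the bridge.\<close>

lemma bounded_bridge:
  assumes X: "X \<subseteq> V" "conn X" "\<not> econn 2 X" and deg: "\<And>v. v \<in> X \<Longrightarrow> 2 \<le> ecount {v} X"
    and IH: "\<And>Y. Y \<subset> X \<Longrightarrow> conn Y \<Longrightarrow> bounded Y"
  shows "bounded X"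
proof -
  obtain Z where Z: "Z \<subset> X" "Z \<noteq> {}" "\<not> 2 \<le> ecount Z (X - Z)"
    using X(2,3) econn_nonempty unfolding econn_def by blast
  have Z1: "ecount Z (X - Z) = 1" using econnD[OF X(2) Z(1,2)] Z(3) by simp
  have XX: "X - (X - Z) = Z" "X - Z \<subset> X" "X - Z \<noteq> {}" using Z by auto
  have Z1': "ecount (X - Z) (X - (X - Z)) = 1" using Z1 XX by (simp add: ecount_sym)
  have c: "conn Z" "conn (X - Z)"
    using conn_if_few_edges[OF X(2)] Z XX Z1 Z1' by simp_all
  have b: "bounded Z" "bounded (X - Z)" using IH[of Z] IH[of "X - Z"] c Z XX by blast+
  show ?thesis
  proof (cases "defic Z = 1 \<or> defic (X - Z) = 1")
    case True
    then show ?thesis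
      using bounded_bridge_side[OF X(1,2) deg IH] Z(1,2) Z1 Z1' XX(2,3) by blast
  next
    case False
    have "\<exists>!e. e \<in> {(z, r). z \<in> Z \<and> r \<in> X - Z \<and> adj z r}"
      using Z1 unfolding ecount_def by (metis (no_types, lifting) card_1_singletonE singletonD singletonI One_nat_def)
    then obtain x r where "\<And>z w. z \<in> Z \<Longrightarrow> w \<in> X - Z \<Longrightarrow> adj z w \<Longrightarrow> z = x \<and> w = r" by blast
    then have "defic (Z \<union> (X - Z)) \<le> defic Z + defic (X - Z)"
      using X Z by (intro defic_Un[where x = x]) auto
    moreover have "Z \<union> (X - Z) = X" using Z by auto
    ultimately show ?thesis using b False by (auto simp: bounded_def)
  qed
qed

end

section \<open>Gluing paths and hexagons to a blob\<close>

lemma verts_simps: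
  "verts (xs @ ys) = verts xs \<union> verts ys" "verts ((a, b) # es) = insert a (insert b (verts es))"
  "verts [] = {}"
  by (auto simp: verts_def)

lemma set_triples:
  "(h1, h2, h3) \<in> set (triples ds) \<longleftrightarrow>
    {h1, h2, h3} \<subseteq> set ds \<and> h1 < h2 \<and> h3 \<noteq> h1 \<and> h3 \<noteq> h2"
  by (auto simp: triples_def)

lemma set_pairs_of_pairs:
  "(h1, h2, h3, h4) \<in> set (pairs_of_pairs ds) \<longleftrightarrow>
    {h1, h2, h3, h4} \<subseteq> set ds \<and> h1 < h2 \<and> h3 < h4 \<and> h1 < h3 \<and> h2 \<noteq> h3 \<and> h2 \<noteq> h4"
  by (auto simp: pairs_of_pairs_def)

lemma set_sorted_triples:
  "(h1, h2, h3) \<in> set (sorted_triples ds) \<longleftrightarrow> {h1, h2, h3} \<subseteq> set ds \<and> h1 < h2 \<and> h2 < h3"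
  by (auto simp: sorted_triples_def)

lemma blobs_distinct: "(es, m, ds) \<in> set blobs \<Longrightarrow> distinct ds"
  unfolding blobs_def list.set insert_iff empty_iff prod.inject
  by (elim disjE conjE FalseE; simp)

context subcubic
begin

lemma three_nbrs:
  assumes "adj v a" "adj v b" "adj v c" "distinct [a, b, c]"
  shows "adj v w \<longleftrightarrow> w = a \<or> w = b \<or> w = c"
proof
  assume w: "adj v w"
  show "w = a \<or> w = b \<or> w = c"
  proof (rule ccontr)
    assume "\<not> ?thesis"
    then have "card {a, b, c, w} = 4" using assms(4) by auto
    moreover have "card {a, b, c, w} \<le> card {w. adj v w}"
      using assms w by (intro card_mono finite_adj) auto
    ultimately show False using card_adj[of v] by simp
  qed
qed (use assms in auto)

lemma two_nbrs:
  assumes "ecount {s} X = 2" "adj s p" "adj s q" "p \<noteq> q" "p \<in> X" "q \<in> X" "v \<in> X"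
  shows "adj s v \<longleftrightarrow> v = p \<or> v = q"
proof -
  have "{p, q} = {w \<in> X. adj s w}"
  proof (rule card_subset_eq)
    show "finite {w \<in> X. adj s w}" by (rule finite_subset[OF _ finite_adj[of s]]) auto
    show "card {p, q} = card {w \<in> X. adj s w}" using assms by (simp add: ecount_single)
  qed (use assms in auto)
  then show ?thesis using assms(7) by auto
qed

lemma ecount_1E:
  assumes "ecount {v} Y = 1"
  obtains h where "h \<in> Y" "\<And>w. w \<in> Y \<Longrightarrow> adj v w \<longleftrightarrow> w = h"
proof -
  obtain h where "{w \<in> Y. adj v w} = {h}"
    using assms unfolding ecount_single by (metis card_1_singletonE One_nat_def)
  then show thesis using that by (auto simp: set_eq_iff)
qed

lemma ecount_2E:
  assumes "ecount {v} Y = 2"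
  obtains h h' where "h \<in> Y" "h' \<in> Y" "h \<noteq> h'" "\<And>w. w \<in> Y \<Longrightarrow> adj v w \<longleftrightarrow> w = h \<or> w = h'"
proof -
  obtain h h' where "{w \<in> Y. adj v w} = {h, h'}" "h \<noteq> h'"
    using assms unfolding ecount_single card_2_iff by metis
  then show thesis using that by (auto simp: set_eq_iff)
qed

lemma port:
  assumes "\<And>v. v \<in> Z \<Longrightarrow> ecount {v} Z = (if f v \<in> set ds then 2 else 3)"
    and "h \<in> Z" "adj r h" "r \<notin> Z"
  shows "f h \<in> set ds"
proof -
  have "ecount {h} Z \<le> 2" using assms by (intro ecount_single_less[of r]) (auto intro: adj_sym)
  then show ?thesis using assms(1)[OF assms(2)] by (simp split: if_splits)
qed

text \<open>The table covers only increasing labels at \<open>a\<close>; \<open>core\<close> assumes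
  this order, and exchanging \<open>h1\<close> and \<open>h2\<close> gives the other one.\<close>

lemma path_gadget:
  assumes Z: "bblob Z" and out: "a \<notin> Z" "u \<notin> Z" "b \<notin> Z"
    and e: "adj a u" "adj u b" "\<not> adj a b" "a \<noteq> b"
    and Na: "\<And>v. v \<in> Z \<Longrightarrow> adj a v \<longleftrightarrow> v = h1 \<or> v = h2"
    and Nb: "\<And>v. v \<in> Z \<Longrightarrow> adj b v \<longleftrightarrow> v = h3"
    and Nu: "\<And>v. v \<in> Z \<Longrightarrow> \<not> adj u v"
    and h: "h1 \<in> Z" "h2 \<in> Z" "h3 \<in> Z" "h1 \<noteq> h2" "h3 \<noteq> h1" "h3 \<noteq> h2"
  shows "defic (Z \<union> {a, u, b}) \<le> 0 \<or> bblob (Z \<union> {a, u, b})"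
proof -
  obtain es m ds f where b: "(es, m, ds) \<in> set blobs" "realizes es f Z" "card Z = 3 * m + 1"
    and lt: "\<And>v. v \<in> Z \<Longrightarrow> f v < 200" and inj: "inj_on f Z"
    and deg: "\<And>v. v \<in> Z \<Longrightarrow> ecount {v} Z = (if f v \<in> set ds then 2 else 3)"
    using bblobE[OF Z] by metis
  have ne: "u \<noteq> a" "u \<noteq> b" using e by auto
  have "adj b u" "adj u a" "\<not> adj b a" using e by (auto simp: insert_commute)
  note e = e this
  have core: ?thesis if o: "f h1 < f h2" and Na: "\<And>v. v \<in> Z \<Longrightarrow> adj a v \<longleftrightarrow> v = h1 \<or> v = h2"
    and h: "h1 \<in> Z" "h2 \<in> Z" "h3 \<noteq> h1" "h3 \<noteq> h2" for h1 h2
  proof -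
    have ports: "{f h1, f h2, f h3} \<subseteq> set ds"
      using port[OF deg, of h1 a] port[OF deg, of h2 a] port[OF deg, of h3 b]
        Na Nb h \<open>h3 \<in> Z\<close> out by auto
    then have vs: "{f h1, f h2, f h3} \<subseteq> verts es" using blobs_facts(4)[OF b(1)] by blast
    have big: "x \<notin> verts es" if "200 \<le> x" for x using blobs_facts(3)[OF b(1), of x] that by auto
    have fe: "f v = f w \<longleftrightarrow> v = w" if "v \<in> Z" "w \<in> Z" for v w using inj that by (auto dest: inj_onD)
    have r1: "realizes (es @ map (Pair 200) [f h1, f h2]) (f(a := 200)) (insert a Z)"
      by (rule realizes_insert[OF b(2)])
        (use out vs big Na fe h in \<open>auto simp: verts_simps dest: lt\<close>)
    have r2: "realizes ((es @ map (Pair 200) [f h1, f h2]) @ map (Pair 201) [200])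
        (f(a := 200, u := 201)) (insert u (insert a Z))"
      by (rule realizes_insert[OF r1])
        (use out vs big Nu lt e ne in \<open>auto simp: verts_simps dest: lt\<close>)
    have r3: "realizes (((es @ map (Pair 200) [f h1, f h2]) @ map (Pair 201) [200])
        @ map (Pair 202) [201, f h3])
        (f(a := 200, u := 201, b := 202)) (insert b (insert u (insert a Z)))"
      by (rule realizes_insert[OF r2])
        (use out vs big Nb lt e ne fe \<open>h3 \<in> Z\<close> in \<open>auto simp: verts_simps dest: lt\<close>)
    have eq: "insert b (insert u (insert a Z)) = Z \<union> {a, u, b}" by auto
    have r: "realizes (add_path es (f h1, f h2, f h3)) (f(a := 200, u := 201, b := 202))
        (Z \<union> {a, u, b})"
      using r3 unfolding eq by (simp add: add_path_def)
    have "(f h1, f h2, f h3) \<in> set (triples ds)"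
      using ports o fe h \<open>h3 \<in> Z\<close> by (simp add: set_triples)
    then obtain w where "check (m + 2) (add_path es (f h1, f h2, f h3)) w"
      using path_table[OF b(1)] by blast
    then have "m + 2 \<le> nu (Z \<union> {a, u, b}) \<or> bblob (Z \<union> {a, u, b})" using check_sound[OF r] by blast
    moreover have "card (Z \<union> {a, u, b}) = 3 * m + 4"
      using b(3) out ne e(4) by (subst card_Un_disjoint) (auto intro: card_ge_0_finite)
    ultimately show ?thesis by (auto simp: defic_def)
  qed
  have "f h1 \<noteq> f h2" using inj h by (auto dest: inj_onD)
  then consider "f h1 < f h2" | "f h2 < f h1" by linarith
  then show ?thesis
    using core[of h1 h2] core[of h2 h1] Na h by cases blast+
qed

text \<open>Stated as a predicate so that the symmetries which bring the port labels into the order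
  of the table are lemmas about it.\<close>

definition biforked :: "'a set \<Rightarrow> 'a set \<Rightarrow> 'a \<Rightarrow> 'a \<Rightarrow> 'a \<Rightarrow> 'a \<Rightarrow> 'a \<Rightarrow> 'a \<Rightarrow> 'a \<Rightarrow> bool" where
  "biforked X Z u a b h1 h2 h3 h4 \<longleftrightarrow> X = Z \<union> {a, u, b} \<and> a \<notin> Z \<and> u \<notin> Z \<and> b \<notin> Z
     \<and> adj a u \<and> adj u b \<and> \<not> adj a b \<and> a \<noteq> b
     \<and> (\<forall>v\<in>Z. (adj a v \<longleftrightarrow> v = h1 \<or> v = h2) \<and> (adj b v \<longleftrightarrow> v = h3 \<or> v = h4) \<and> \<not> adj u v)
     \<and> {h1, h2, h3, h4} \<subseteq> Z \<and> distinct [h1, h2, h3, h4]"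

lemma biforked_sym:
  assumes "biforked X Z u a b h1 h2 h3 h4"
  shows "biforked X Z u a b h2 h1 h3 h4" "biforked X Z u a b h1 h2 h4 h3"
    "biforked X Z u b a h3 h4 h1 h2"
  using assms unfolding biforked_def by (auto simp: insert_commute)

lemma biforked_gadget:
  assumes Z: "bblob Z" and bf: "biforked X Z u a b h1 h2 h3 h4"
  shows "defic X \<le> 0 \<or> bblob X"
proof -
  obtain es m ds f where b: "(es, m, ds) \<in> set blobs" "realizes es f Z" "card Z = 3 * m + 1"
    and lt: "\<And>v. v \<in> Z \<Longrightarrow> f v < 200" and inj: "inj_on f Z"
    and deg: "\<And>v. v \<in> Z \<Longrightarrow> ecount {v} Z = (if f v \<in> set ds then 2 else 3)"
    using bblobE[OF Z] by metis
  have core: ?thesis if bf: "biforked X Z u a b h1 h2 h3 h4" 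
    and o: "f h1 < f h2" "f h3 < f h4" "f h1 < f h3" for a b h1 h2 h3 h4
  proof -
    have out: "a \<notin> Z" "u \<notin> Z" "b \<notin> Z" and e: "adj a u" "adj u b" "\<not> adj a b" "a \<noteq> b"
      and h: "h1 \<in> Z" "h2 \<in> Z" "h3 \<in> Z" "h4 \<in> Z" "distinct [h1, h2, h3, h4]"
      and XZ: "X = Z \<union> {a, u, b}"
      using bf by (auto simp: biforked_def)
    have N: "adj a v \<longleftrightarrow> v = h1 \<or> v = h2" "adj b v \<longleftrightarrow> v = h3 \<or> v = h4" "\<not> adj u v" if "v \<in> Z" for v
      using bf that by (auto simp: biforked_def)
    have ne: "u \<noteq> a" "u \<noteq> b" using e by auto
    have "adj b u" "adj u a" "\<not> adj b a" using e by (auto simp: insert_commute)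
    note e = e this
    have ports: "{f h1, f h2, f h3, f h4} \<subseteq> set ds"
      using port[OF deg, of h1 a] port[OF deg, of h2 a] port[OF deg, of h3 b]
        port[OF deg, of h4 b] N h out by auto
    then have vs: "{f h1, f h2, f h3, f h4} \<subseteq> verts es" using blobs_facts(4)[OF b(1)] by blast
    have big: "x \<notin> verts es" if "200 \<le> x" for x using blobs_facts(3)[OF b(1), of x] that by auto
    have fe: "f v = f w \<longleftrightarrow> v = w" if "v \<in> Z" "w \<in> Z" for v w using inj that by (auto dest: inj_onD)
    have r1: "realizes (es @ map (Pair 200) [f h1, f h2]) (f(a := 200)) (insert a Z)"
      by (rule realizes_insert[OF b(2)])
        (use out vs big N(1) fe h in \<open>auto simp: verts_simps dest: lt\<close>)
    have r2: "realizes ((es @ map (Pair 200) [f h1, f h2]) @ map (Pair 201) [200])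
        (f(a := 200, u := 201)) (insert u (insert a Z))"
      by (rule realizes_insert[OF r1])
        (use out vs big N(3) lt e ne in \<open>auto simp: verts_simps dest: lt\<close>)
    have r3: "realizes (((es @ map (Pair 200) [f h1, f h2]) @ map (Pair 201) [200])
        @ map (Pair 202) [201, f h3, f h4])
        (f(a := 200, u := 201, b := 202)) (insert b (insert u (insert a Z)))"
      by (rule realizes_insert[OF r2])
        (use out vs big N(2) lt e ne fe h in \<open>auto simp: verts_simps dest: lt\<close>)
    have eq: "insert b (insert u (insert a Z)) = X" using XZ by auto
    have r: "realizes (add_biforked_path es (f h1, f h2, f h3, f h4))
        (f(a := 200, u := 201, b := 202)) X"
      using r3 unfolding eq by (simp add: add_biforked_path_def)
    have "(f h1, f h2, f h3, f h4) \<in> set (pairs_of_pairs ds)"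
      using ports o fe h by (simp add: set_pairs_of_pairs)
    then obtain w where "check (m + 2) (add_biforked_path es (f h1, f h2, f h3, f h4)) w"
      using biforked_table[OF b(1)] by blast
    then have "m + 2 \<le> nu X \<or> bblob X" using check_sound[OF r] by blast
    moreover have "card X = 3 * m + 4"
      unfolding XZ using b(3) out ne e(4) by (subst card_Un_disjoint) (auto intro: card_ge_0_finite)
    ultimately show ?thesis by (auto simp: defic_def)
  qed
  have fe: "f v \<noteq> f w" if "v \<in> Z" "w \<in> Z" "v \<noteq> w" for v w using inj that by (auto dest: inj_onD)
  have core2: ?thesis if bf: "biforked X Z u a b h1 h2 h3 h4" and o: "f h1 < f h2" "f h3 < f h4"
    for a b h1 h2 h3 h4
  proof -
    have "f h1 \<noteq> f h3" using bf by (intro fe) (auto simp: biforked_def)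
    then consider "f h1 < f h3" | "f h3 < f h1" by linarith
    then show ?thesis using core[OF bf o] core[OF biforked_sym(3)[OF bf] o(2,1)] by cases blast+
  qed
  have "h1 \<in> Z" "h2 \<in> Z" "h3 \<in> Z" "h4 \<in> Z" "h1 \<noteq> h2" "h3 \<noteq> h4"
    using bf by (auto simp: biforked_def)
  then have "f h1 \<noteq> f h2" "f h3 \<noteq> f h4" using fe by blast+
  then consider "f h1 < f h2" "f h3 < f h4" | "f h2 < f h1" "f h3 < f h4"
    | "f h1 < f h2" "f h4 < f h3" | "f h2 < f h1" "f h4 < f h3" by linarith
  then show ?thesis
    using core2[OF bf] core2[OF biforked_sym(1)[OF bf]] core2[OF biforked_sym(2)[OF bf]]
      core2[OF biforked_sym(2)[OF biforked_sym(1)[OF bf]]] by cases blast+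
qed

text \<open>The missing chords and the complete lists of neighbours in \<open>Z\<close> are
  included, because the labelled graph has to match the induced subgraph exactly.\<close>

definition hexagon ::
  "'a set \<Rightarrow> 'a set \<Rightarrow> 'a \<Rightarrow> 'a \<Rightarrow> 'a \<Rightarrow> 'a \<Rightarrow> 'a \<Rightarrow> 'a \<Rightarrow> 'a \<Rightarrow> 'a \<Rightarrow> 'a \<Rightarrow> bool" where
  "hexagon X Z c0 c1 c2 c3 c4 c5 h0 h1 h2 \<longleftrightarrow> X = Z \<union> {c0, c1, c2, c3, c4, c5}
     \<and> distinct [c0, c1, c2, c3, c4, c5] \<and> {c0, c1, c2, c3, c4, c5} \<inter> Z = {}
     \<and> adj c0 c1 \<and> adj c1 c2 \<and> adj c2 c3 \<and> adj c3 c4 \<and> adj c4 c5 \<and> adj c5 c0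
     \<and> \<not> adj c0 c2 \<and> \<not> adj c0 c3 \<and> \<not> adj c0 c4 \<and> \<not> adj c1 c3 \<and> \<not> adj c1 c4
     \<and> \<not> adj c1 c5 \<and> \<not> adj c2 c4 \<and> \<not> adj c2 c5 \<and> \<not> adj c3 c5
     \<and> (\<forall>v\<in>Z. (adj c0 v \<longleftrightarrow> v = h0) \<and> (adj c2 v \<longleftrightarrow> v = h1) \<and> (adj c4 v \<longleftrightarrow> v = h2)
          \<and> \<not> adj c1 v \<and> \<not> adj c3 v \<and> \<not> adj c5 v)
     \<and> {h0, h1, h2} \<subseteq> Z \<and> distinct [h0, h1, h2]"

lemma hexagon_rotate:
  "hexagon X Z c0 c1 c2 c3 c4 c5 h0 h1 h2 \<Longrightarrow> hexagon X Z c2 c3 c4 c5 c0 c1 h1 h2 h0"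
  unfolding hexagon_def by (auto simp: insert_commute)

lemma hexagon_reflect:
  "hexagon X Z c0 c1 c2 c3 c4 c5 h0 h1 h2 \<Longrightarrow> hexagon X Z c0 c5 c4 c3 c2 c1 h0 h2 h1"
  unfolding hexagon_def by (auto simp: insert_commute)

lemma hexagon_gadget:
  assumes Z: "bblob Z" and hx: "hexagon X Z c0 c1 c2 c3 c4 c5 h0 h1 h2"
  shows "defic X \<le> 0 \<or> bblob X"
proof -
  obtain es m ds f where b: "(es, m, ds) \<in> set blobs" "realizes es f Z" "card Z = 3 * m + 1"
    and lt: "\<And>v. v \<in> Z \<Longrightarrow> f v < 200" and inj: "inj_on f Z"
    and deg: "\<And>v. v \<in> Z \<Longrightarrow> ecount {v} Z = (if f v \<in> set ds then 2 else 3)"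
    using bblobE[OF Z] by metis
  have core: ?thesis if hx: "hexagon X Z c0 c1 c2 c3 c4 c5 h0 h1 h2" 
    and o: "f h0 < f h1" "f h1 < f h2" for c0 c1 c2 c3 c4 c5 h0 h1 h2
  proof -
    have out: "c0 \<notin> Z" "c1 \<notin> Z" "c2 \<notin> Z" "c3 \<notin> Z" "c4 \<notin> Z" "c5 \<notin> Z"
      and di: "distinct [c0, c1, c2, c3, c4, c5]"
      and h: "h0 \<in> Z" "h1 \<in> Z" "h2 \<in> Z"
      and XZ: "X = Z \<union> {c0, c1, c2, c3, c4, c5}"
      and e: "adj c1 c0" "adj c2 c1" "adj c3 c2" "adj c4 c3" "adj c5 c4" "adj c5 c0"
        "\<not> adj c2 c0" "\<not> adj c3 c0" "\<not> adj c4 c0" "\<not> adj c3 c1" "\<not> adj c4 c1"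
        "\<not> adj c5 c1" "\<not> adj c4 c2" "\<not> adj c5 c2" "\<not> adj c5 c3"
      using hx by (auto simp: hexagon_def insert_commute)
    have N: "adj c0 v \<longleftrightarrow> v = h0" "adj c2 v \<longleftrightarrow> v = h1" "adj c4 v \<longleftrightarrow> v = h2"
      "\<not> adj c1 v" "\<not> adj c3 v" "\<not> adj c5 v" if "v \<in> Z" for v
      using hx that by (auto simp: hexagon_def)
    have ports: "{f h0, f h1, f h2} \<subseteq> set ds"
      using port[OF deg, of h0 c0] port[OF deg, of h1 c2] port[OF deg, of h2 c4] N h out by auto
    then have vs: "{f h0, f h1, f h2} \<subseteq> verts es" using blobs_facts(4)[OF b(1)] by blast
    have big: "x \<notin> verts es" if "200 \<le> x" for x using blobs_facts(3)[OF b(1), of x] that by auto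
    have fe: "f v = f w \<longleftrightarrow> v = w" if "v \<in> Z" "w \<in> Z" for v w using inj that by (auto dest: inj_onD)
    let ?e0 = "es @ map (Pair 200) [f h0]"
    let ?e1 = "?e0 @ map (Pair 201) [200]"
    let ?e2 = "?e1 @ map (Pair 202) [201, f h1]"
    let ?e3 = "?e2 @ map (Pair 203) [202]"
    let ?e4 = "?e3 @ map (Pair 204) [203, f h2]"
    let ?e5 = "?e4 @ map (Pair 205) [204, 200]"
    have r1: "realizes ?e0 (f(c0 := 200)) (insert c0 Z)"
      by (rule realizes_insert[OF b(2)])
        (use out vs big N(1) fe h in \<open>auto simp: verts_simps dest: lt\<close>)
    have r2: "realizes ?e1 (f(c0 := 200, c1 := 201)) (insert c1 (insert c0 Z))"
      by (rule realizes_insert[OF r1])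
        (use out vs big N(4) e di in \<open>auto simp: verts_simps dest: lt\<close>)
    have r3: "realizes ?e2 (f(c0 := 200, c1 := 201, c2 := 202)) (insert c2 (insert c1 (insert c0 Z)))"
      by (rule realizes_insert[OF r2])
        (use out vs big N(2) e di fe h in \<open>auto simp: verts_simps dest: lt\<close>)
    have r4: "realizes ?e3 (f(c0 := 200, c1 := 201, c2 := 202, c3 := 203))
        (insert c3 (insert c2 (insert c1 (insert c0 Z))))"
      by (rule realizes_insert[OF r3])
        (use out vs big N(5) e di in \<open>auto simp: verts_simps dest: lt\<close>)
    have r5: "realizes ?e4 (f(c0 := 200, c1 := 201, c2 := 202, c3 := 203, c4 := 204))
        (insert c4 (insert c3 (insert c2 (insert c1 (insert c0 Z)))))"
      by (rule realizes_insert[OF r4])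
        (use out vs big N(3) e di fe h in \<open>auto simp: verts_simps dest: lt\<close>)
    have r6: "realizes ?e5 (f(c0 := 200, c1 := 201, c2 := 202, c3 := 203, c4 := 204, c5 := 205))
        (insert c5 (insert c4 (insert c3 (insert c2 (insert c1 (insert c0 Z))))))"
      by (rule realizes_insert[OF r5])
        (use out vs big N(6) e di in \<open>auto simp: verts_simps dest: lt\<close>)
    have eq: "insert c5 (insert c4 (insert c3 (insert c2 (insert c1 (insert c0 Z))))) = X"
      unfolding XZ by auto
    have r: "realizes (add_hexagon es (f h0, f h1, f h2))
        (f(c0 := 200, c1 := 201, c2 := 202, c3 := 203, c4 := 204, c5 := 205)) X"
      using r6 unfolding eq by (simp add: add_hexagon_def)
    have "(f h0, f h1, f h2) \<in> set (sorted_triples ds)"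
      using ports o by (simp add: set_sorted_triples)
    then obtain w where "check (m + 3) (add_hexagon es (f h0, f h1, f h2)) w"
      using hexagon_table[OF b(1)] by blast
    then have "m + 3 \<le> nu X \<or> bblob X" using check_sound[OF r] by blast
    moreover have "card X = 3 * m + 7"
      unfolding XZ using b(3) out di by (subst card_Un_disjoint) (auto intro: card_ge_0_finite)
    ultimately show ?thesis by (auto simp: defic_def)
  qed
  have fe: "f v \<noteq> f w" if "v \<in> Z" "w \<in> Z" "v \<noteq> w" for v w using inj that by (auto dest: inj_onD)
  have "h0 \<in> Z" "h1 \<in> Z" "h2 \<in> Z" "h0 \<noteq> h1" "h0 \<noteq> h2" "h1 \<noteq> h2"
    using hx by (auto simp: hexagon_def)
  then have "f h0 \<noteq> f h1" "f h0 \<noteq> f h2" "f h1 \<noteq> f h2" using fe by blast+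
  then consider "f h0 < f h1" "f h1 < f h2" | "f h1 < f h2" "f h2 < f h0" | "f h2 < f h0" "f h0 < f h1"
    | "f h0 < f h2" "f h2 < f h1" | "f h2 < f h1" "f h1 < f h0" | "f h1 < f h0" "f h0 < f h2"
    by linarith
  then show ?thesis
    using core[OF hx] core[OF hexagon_rotate[OF hx]] core[OF hexagon_rotate[OF hexagon_rotate[OF hx]]]
      core[OF hexagon_reflect[OF hx]] core[OF hexagon_rotate[OF hexagon_reflect[OF hx]]]
      core[OF hexagon_rotate[OF hexagon_rotate[OF hexagon_reflect[OF hx]]]]
    by cases blast+
qed

end

section \<open>The bridgeless case\<close>

text \<open>The bijection is the identity; the first list merely has its edges in the order in which
  vertices are inserted. It starts from an edge, since an edge list cannot contain an isolated
  vertex.\<close>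

lemma G1_check: "iso_check
   (((((((((([(12,1)]) @ map (Pair 2) [12]) @ map (Pair 13) [1]) @ map (Pair 14) [1])
     @ map (Pair 23) [2]) @ map (Pair 24) [2]) @ map (Pair 3) [13,23]) @ map (Pair 4) [14,24])
     @ map (Pair 34) [3,4]))
   (blob_edges 1)
   [(1,1),(2,2),(3,3),(4,4),(12,12),(13,13),(14,14),(23,23),(24,24),(34,34)]"
  by code_simp

context subcubic
begin

text \<open>The vertices \<open>y\<close>, \<open>y'\<close>, \<open>a\<close>, \<open>b\<close> are
  the branch vertices 1 to 4 of the subdivided K4, and the other six lie on its edges. The degree
  bound determines the neighbourhoods of the branch vertices.\<close>

lemma G1_gadget:
  assumes X: "X = {y, z1, y', x2, x3, z2, z3, a, b, u}"
    and di: "distinct [y, z1, y', x2, x3, z2, z3, a, b, u]"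
    and Nz1: "\<And>v. v \<in> X \<Longrightarrow> adj z1 v \<longleftrightarrow> v = y \<or> v = y'"
    and Nx2: "\<And>v. v \<in> X \<Longrightarrow> adj x2 v \<longleftrightarrow> v = y \<or> v = a"
    and Nx3: "\<And>v. v \<in> X \<Longrightarrow> adj x3 v \<longleftrightarrow> v = y \<or> v = b"
    and Nz2: "\<And>v. v \<in> X \<Longrightarrow> adj z2 v \<longleftrightarrow> v = y' \<or> v = a"
    and Nz3: "\<And>v. v \<in> X \<Longrightarrow> adj z3 v \<longleftrightarrow> v = y' \<or> v = b"
    and Nu: "\<And>v. v \<in> X \<Longrightarrow> adj u v \<longleftrightarrow> v = a \<or> v = b"
  shows "bblob X"
proof -
  have "adj y z1" "adj y x2" "adj y x3"
    using Nz1[of y] Nx2[of y] Nx3[of y] by (auto simp: X adj_sym)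
  then have Ny: "adj y v \<longleftrightarrow> v = z1 \<or> v = x2 \<or> v = x3" for v using di by (intro three_nbrs) auto
  have "adj y' z1" "adj y' z2" "adj y' z3"
    using Nz1[of y'] Nz2[of y'] Nz3[of y'] by (auto simp: X adj_sym)
  then have Ny': "adj y' v \<longleftrightarrow> v = z1 \<or> v = z2 \<or> v = z3" for v using di by (intro three_nbrs) auto
  have "adj a x2" "adj a z2" "adj a u"
    using Nx2[of a] Nz2[of a] Nu[of a] by (auto simp: X adj_sym)
  then have Na: "adj a v \<longleftrightarrow> v = x2 \<or> v = z2 \<or> v = u" for v using di by (intro three_nbrs) auto
  have "adj b x3" "adj b z3" "adj b u"
    using Nx3[of b] Nz3[of b] Nu[of b] by (auto simp: X adj_sym)
  then have Nb: "adj b v \<longleftrightarrow> v = x3 \<or> v = z3 \<or> v = u" for v using di by (intro three_nbrs) auto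
  have yz: "y \<noteq> z1" "z1 \<noteq> y" using di by auto
  let ?f0 = "(\<lambda>x. 0)(y := 1, z1 := 12)"
  have r0: "realizes [(12, 1)] ?f0 {y, z1}"
    unfolding realizes_def
  proof
    show "bij_betw ?f0 {y, z1} (verts [(12, 1)])"
      using yz by (auto simp: bij_betw_def verts_simps)
    have "adj y z1" "adj z1 y" using Ny Nz1 by (auto simp: X)
    then show "\<forall>u\<in>{y, z1}. \<forall>v\<in>{y, z1}. adj u v \<longleftrightarrow> ladj [(12, 1)] (?f0 u) (?f0 v)"
      using yz by (auto simp: ladj_iff)
  qed
  let ?e0 = "[(12, 1)] :: (nat \<times> nat) list" and ?X0 = "{y, z1}"
  let ?e1 = "?e0 @ map (Pair 2) [12]" and ?f1 = "?f0(y' := 2)" and ?X1 = "insert y' ?X0"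
  let ?e2 = "?e1 @ map (Pair 13) [1]" and ?f2 = "?f1(x2 := 13)" and ?X2 = "insert x2 ?X1"
  let ?e3 = "?e2 @ map (Pair 14) [1]" and ?f3 = "?f2(x3 := 14)" and ?X3 = "insert x3 ?X2"
  let ?e4 = "?e3 @ map (Pair 23) [2]" and ?f4 = "?f3(z2 := 23)" and ?X4 = "insert z2 ?X3"
  let ?e5 = "?e4 @ map (Pair 24) [2]" and ?f5 = "?f4(z3 := 24)" and ?X5 = "insert z3 ?X4"
  let ?e6 = "?e5 @ map (Pair 3) [13, 23]" and ?f6 = "?f5(a := 3)" and ?X6 = "insert a ?X5"
  let ?e7 = "?e6 @ map (Pair 4) [14, 24]" and ?f7 = "?f6(b := 4)" and ?X7 = "insert b ?X6"
  let ?e8 = "?e7 @ map (Pair 34) [3, 4]" and ?f8 = "?f7(u := 34)" and ?X8 = "insert u ?X7"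
  have r1: "realizes ?e1 ?f1 ?X1"
    by (rule realizes_insert[OF r0]) (use di Ny' in \<open>auto simp: verts_simps\<close>)
  have r2: "realizes ?e2 ?f2 ?X2"
    by (rule realizes_insert[OF r1]) (use di Nx2 X in \<open>auto simp: verts_simps\<close>)
  have r3: "realizes ?e3 ?f3 ?X3"
    by (rule realizes_insert[OF r2]) (use di Nx3 X in \<open>auto simp: verts_simps\<close>)
  have r4: "realizes ?e4 ?f4 ?X4"
    by (rule realizes_insert[OF r3]) (use di Nz2 X in \<open>auto simp: verts_simps\<close>)
  have r5: "realizes ?e5 ?f5 ?X5"
    by (rule realizes_insert[OF r4]) (use di Nz3 X in \<open>auto simp: verts_simps\<close>)
  have r6: "realizes ?e6 ?f6 ?X6"
    by (rule realizes_insert[OF r5]) (use di Na X in \<open>auto simp: verts_simps\<close>)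
  have r7: "realizes ?e7 ?f7 ?X7"
    by (rule realizes_insert[OF r6]) (use di Nb X in \<open>auto simp: verts_simps\<close>)
  have r8: "realizes ?e8 ?f8 ?X8"
    by (rule realizes_insert[OF r7]) (use di Nu X in \<open>auto simp: verts_simps\<close>)
  have "?X8 = X"
    unfolding X by auto
  then obtain g where "realizes (blob_edges 1) g X"
    using realizes_iso_check[OF r8 G1_check] by auto
  then show ?thesis using blob_edges_blobs[of 1] unfolding bblob_def by blast
qed

text \<open>A join sends out at least three edges, and a blob with two leaving edges contradicts
  positive deficiency.\<close>

lemma calH_two_out:
  assumes "calH B" "B \<subset> X" "ecount B (X - B) = 2" "X \<subseteq> V" "econn 2 X"
    and IH: "\<And>Y. Y \<subset> X \<Longrightarrow> conn Y \<Longrightarrow> defic Y \<le> 1" and d: "0 < defic X"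
  obtains x where "B = {x}"
  using assms(1) psubset_imp_subset[OF assms(2)] assms(5)
proof (cases rule: calH_cases)
  case blob
  then show ?thesis using bblob_two_edge_cut[OF assms(4,5) IH _ assms(2,3)] d by fastforce
next
  case join
  then show ?thesis using assms(3) by simp
qed (use that in blast)

lemma ecount_self: "ecount {v} X = ecount {v} (X - {v})"
  unfolding ecount_single by (rule arg_cong[where f = card]) auto

lemma bounded_two_conn:
  assumes X: "X \<subseteq> V" "econn 2 X" and u: "u \<in> X" "ecount {u} X = 2"
    and IH: "\<And>Y. Y \<subset> X \<Longrightarrow> conn Y \<Longrightarrow> bounded Y"
  shows "bounded X"
proof -
  have IH1: "defic Y \<le> 1" if "Y \<subset> X" "conn Y" for Y
    using IH[OF that] by (simp add: bounded_def)
  obtain a b where ab: "a \<in> X" "b \<in> X" "a \<noteq> b" and Nu: "\<And>w. w \<in> X \<Longrightarrow> adj u w \<longleftrightarrow> w = a \<or> w = b"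
    using ecount_2E[OF u(2)] by metis
  have ua: "adj u a" "adj u b" "adj a u" "adj b u" using Nu[of a] Nu[of b] ab by (auto simp: adj_sym)
  have ne: "u \<noteq> a" "u \<noteq> b" using ua by auto
  have nab: "\<not> adj a b" "\<not> adj b a"
    using no_triangle[of u a b] ua by (auto simp: insert_commute)
  define Y where "Y = X - {u, a, b}"
  have XY: "X - Y = {u, a, b}" "X = insert b ({u, a} \<union> Y)" using u ab by (auto simp: Y_def)
  have uY: "\<not> adj u v" if "v \<in> Y" for v using Nu[of v] that by (auto simp: Y_def)
  have YX: "Y \<subset> X" using u by (auto simp: Y_def)
  have YV: "Y \<subseteq> V" "{u, a} \<subseteq> V" using X u ab by (auto simp: Y_def)
  have out: "ecount P {u, a, b} = ecount {a} P + ecount {b} P" if "P \<subseteq> Y" for P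
  proof -
    have "ecount {u} P = 0" using that uY by (auto simp: ecount_eq_0)
    then show ?thesis
      using ecount_insert_right[of u "{a, b}" P] ecount_insert_right[of a "{b}" P] ne ab
      by (simp add: ecount_sym)
  qed
  \<comment> \<open>A common neighbour of \<open>a\<close> and \<open>b\<close> other than
    \<open>u\<close> would close a 4-cycle.\<close>
  have sq: "\<not> (adj a x \<and> adj b x)" if "x \<in> Y" for x
    using no_square[of u a x b] ua ab that by (auto simp: Y_def insert_commute)
  have no_single: False if "{x} \<subseteq> Y" "2 \<le> ecount {x} {u, a, b}" for x
    using out[OF that(1)] that sq[of x] by (auto simp: ecount_single_single split: if_splits)
  have dXY: "defic X \<le> defic Y"
  proof -
    have "defic ({u, a} \<union> Y) \<le> defic {u, a} + defic Y"
      by (rule defic_Un[where x = a]) (use YV uY in \<open>auto simp: Y_def\<close>)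
    moreover have "defic X \<le> defic ({u, a} \<union> Y) + 1"
      unfolding XY(2) using YV by (intro defic_insert) auto
    ultimately show ?thesis using defic_edge[OF ua(1)] by simp
  qed
  have le2: "ecount {a} Y \<le> 2" "ecount {b} Y \<le> 2"
    using ua by (auto intro!: ecount_single_less[of u] simp: Y_def)
  have ge1: "1 \<le> ecount {a} Y" "1 \<le> ecount {b} Y"
  proof -
    have *: "1 \<le> ecount {v} Y" if v: "v \<in> X" "X - {v} = {u, w} \<union> Y" "\<not> adj v w" "u \<noteq> w" "w \<notin> Y" for v w
    proof -
      have "2 \<le> ecount {v} (X - {v})" using econnD[OF X(2), of "{v}"] v u by auto
      also have "\<dots> = ecount {v} {u, w} + ecount {v} Y"
        unfolding v(2) using v by (intro ecount_Un_right) (auto simp: Y_def)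
      also have "ecount {v} {u, w} \<le> 1"
        using ecount_insert_right[of u "{w}" "{v}"] v by (simp add: ecount_single_single)
      finally show ?thesis by simp
    qed
    show "1 \<le> ecount {a} Y" by (rule *[of a b]) (use ab ne nab u in \<open>auto simp: Y_def\<close>)
    show "1 \<le> ecount {b} Y" by (rule *[of b a]) (use ab ne nab u in \<open>auto simp: Y_def\<close>)
  qed
  then have Yne: "Y \<noteq> {}" by auto
  have eY: "ecount Y (X - Y) = ecount {a} Y + ecount {b} Y" unfolding XY(1) by (rule out) simp
  show ?thesis
  proof (cases "conn Y")
    case False
    have "ecount Y (X - Y) < 3 * 2" using eY le2 by simp
    then obtain P Q where PQ: "Y = P \<union> Q" "P \<inter> Q = {}" "conn P" "conn Q" "ecount P Q = 0"
      "2 \<le> ecount P (X - Y)" "2 \<le> ecount Q (X - Y)"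
      "ecount Y (X - Y) = ecount P (X - Y) + ecount Q (X - Y)"
      using two_parts_if_few_edges[OF X(2) YX Yne _ False] by metis
    have PQX: "P \<subset> X" "Q \<subset> X" using PQ(1) YX by auto
    have two: "ecount P (X - Y) = 2" "ecount Q (X - Y) = 2" using PQ(6-8) eY le2 by linarith+
    \<comment> \<open>A part of deficiency 1 would be a tree of blobs with two leaving edges, hence
      a single vertex adjacent to both \<open>a\<close> and \<open>b\<close>.\<close>
    have le0: "defic R \<le> 0 \<or> defic X \<le> 0" if R: "R \<subset> X" "conn R" "R \<subseteq> Y" "ecount R (X - Y) = 2" "ecount R (Y - R) = 0" for R
    proof (rule ccontr)
      assume *: "\<not> ?thesis"
      then have "calH R" using IH[OF R(1,2)] by (simp add: bounded_def)
      have "X - R = (X - Y) \<union> (Y - R)" using R(3) YX by auto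
      then have "ecount R (X - R) = 2"
        using ecount_Un_right[of "X - Y" "Y - R" R] R by auto
      then obtain x where "R = {x}"
        using calH_two_out[OF \<open>calH R\<close> R(1) _ X IH1] * by auto
      then show False using no_single[of x] R XY by simp
    qed
    have "Y - P = Q" "Y - Q = P" using PQ(1,2) by auto
    then have "defic P \<le> 0 \<or> defic X \<le> 0" "defic Q \<le> 0 \<or> defic X \<le> 0"
      using le0[of P] le0[of Q] PQ two PQX by (auto simp: ecount_sym)
    moreover have "defic Y \<le> defic P + defic Q" using defic_parts[of P Q] PQ YV by simp
    ultimately have "defic X \<le> 0" using dXY by auto
    then show ?thesis by (simp add: bounded_def)
  next
    case True
    note bY = IH[OF YX True]
    show ?thesis
    proof (cases "defic X \<le> 0")
      case False
      then have dX: "0 < defic X" by simp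
      then have HY: "calH Y" using bY dXY by (auto simp: bounded_def)
      have "bblob X"
        using HY psubset_imp_subset[OF YX] X(2)
      proof (cases rule: calH_cases)
        case (single x)
        have "2 \<le> ecount Y (X - Y)" using econnD[OF X(2) YX Yne] .
        then show ?thesis using no_single[of x] single XY by auto
      next
        case blob
        have aY: "a \<notin> Y" "b \<notin> Y" "u \<notin> Y" by (auto simp: Y_def)
        have XY': "X = Y \<union> {a, u, b}" "X = Y \<union> {b, u, a}" using XY by auto
        have "ecount Y (X - Y) \<noteq> 2"
          using bblob_two_edge_cut[OF X IH1 blob YX] dX by auto
        then consider "ecount {a} Y = 2" "ecount {b} Y = 1" | "ecount {a} Y = 1" "ecount {b} Y = 2"
          | "ecount {a} Y = 2" "ecount {b} Y = 2" using eY le2 ge1 by linarith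
        then show ?thesis
        proof cases
          case 1
          obtain h1 h2 where h12: "h1 \<in> Y" "h2 \<in> Y" "h1 \<noteq> h2" 
            "\<And>w. w \<in> Y \<Longrightarrow> adj a w \<longleftrightarrow> w = h1 \<or> w = h2" using ecount_2E[OF 1(1)] by metis
          obtain h3 where h3: "h3 \<in> Y" "\<And>w. w \<in> Y \<Longrightarrow> adj b w \<longleftrightarrow> w = h3"
            using ecount_1E[OF 1(2)] by metis
          have "h3 \<noteq> h1" "h3 \<noteq> h2" using sq[of h3] h12 h3 by auto
          then have "defic (Y \<union> {a, u, b}) \<le> 0 \<or> bblob (Y \<union> {a, u, b})"
            using blob aY ua nab ab h12 h3 uY by (intro path_gadget[of Y a u b h1 h2 h3]) auto
          then show ?thesis using dX XY' by auto
        next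
          case 2
          obtain h1 h2 where h12: "h1 \<in> Y" "h2 \<in> Y" "h1 \<noteq> h2" 
            "\<And>w. w \<in> Y \<Longrightarrow> adj b w \<longleftrightarrow> w = h1 \<or> w = h2" using ecount_2E[OF 2(2)] by metis
          obtain h3 where h3: "h3 \<in> Y" "\<And>w. w \<in> Y \<Longrightarrow> adj a w \<longleftrightarrow> w = h3"
            using ecount_1E[OF 2(1)] by metis
          have "h3 \<noteq> h1" "h3 \<noteq> h2" using sq[of h3] h12 h3 by auto
          then have "defic (Y \<union> {b, u, a}) \<le> 0 \<or> bblob (Y \<union> {b, u, a})"
            using blob aY ua nab ab h12 h3 uY by (intro path_gadget[of Y b u a h1 h2 h3]) auto
          then show ?thesis using dX XY' by auto
        next
          case 3
          obtain h1 h2 where h12: "h1 \<in> Y" "h2 \<in> Y" "h1 \<noteq> h2" 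
            "\<And>w. w \<in> Y \<Longrightarrow> adj a w \<longleftrightarrow> w = h1 \<or> w = h2" using ecount_2E[OF 3(1)] by metis
          obtain h3 h4 where h34: "h3 \<in> Y" "h4 \<in> Y" "h3 \<noteq> h4" 
            "\<And>w. w \<in> Y \<Longrightarrow> adj b w \<longleftrightarrow> w = h3 \<or> w = h4" using ecount_2E[OF 3(2)] by metis
          have "h3 \<noteq> h1" "h3 \<noteq> h2" "h4 \<noteq> h1" "h4 \<noteq> h2" using sq[of h3] sq[of h4] h12 h34 by auto
          then have "biforked X Y u a b h1 h2 h3 h4"
            unfolding biforked_def using aY ua nab ab h12 h34 uY XY'(1) by auto
          then show ?thesis using biforked_gadget[OF blob] dX by fastforce
        qed
      next
        case (join y X1 X2 X3)
        have yX: "y \<in> Y" using join by auto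
        \<comment> \<open>Every part sends at least two edges out, one of them to \<open>y\<close>. As at most four edges leave
          \<open>Y\<close>, two of the parts send out exactly two edges, so they are single vertices.\<close>
        have main: "bblob X" if j: "joined y B1 B2 B3" and H: "calH B1" "calH B2" "calH B3"
          and YB: "Y = insert y (B1 \<union> B2 \<union> B3)"
          and l: "ecount B2 (X - B2) = 2" "ecount B3 (X - B3) = 2" "ecount B1 (X - B1) \<le> 3" for B1 B2 B3
        proof -
          have BX: "B1 \<subset> X" "B2 \<subset> X" "B3 \<subset> X" using YB YX by auto
          obtain x2 where x2: "B2 = {x2}" using calH_two_out[OF H(2) BX(2) l(1) X IH1 dX] by auto
          obtain x3 where x3: "B3 = {x3}" using calH_two_out[OF H(3) BX(3) l(2) X IH1 dX] by auto
          \<comment> \<open>Now \<open>y\<close>, \<open>x2\<close>, \<open>a\<close>,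
            \<open>u\<close>, \<open>b\<close>, \<open>x3\<close> form a hexagon, and
            \<open>X\<close> consists of it and \<open>B1\<close>. The cases distinguish the shape
            of \<open>B1\<close>.\<close>
          have core: ?thesis if j: "joined y B1 {x2} {x3}" and YB: "Y = insert y (B1 \<union> {x2} \<union> {x3})"
            and x2: "adj a x2" "ecount {x2} X = 2" and x3: "adj b x3" "ecount {x3} X = 2" for x2 x3
          proof -
            have dis: "y \<notin> B1" "x2 \<notin> B1" "x3 \<notin> B1" "x2 \<noteq> x3" "y \<noteq> x2" "y \<noteq> x3" "y \<in> X" "x2 \<in> X" "x3 \<in> X"
              "x2 \<in> Y" "x3 \<in> Y" "y \<in> Y" "B1 \<subseteq> Y"
              using j YB YX by (auto simp: joined_def)
            have yuab: "u \<notin> Y" "a \<notin> Y" "b \<notin> Y" by (auto simp: Y_def)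
            have yx: "adj y x2" "adj y x3" "adj x2 y" "adj x3 y"
              using j by (auto simp: joined_def ecount_single_single insert_commute split: if_splits)
            have ax: "adj x2 a" "adj x3 b" using x2 x3 by (auto simp: adj_sym)
            have Nx2: "adj x2 v \<longleftrightarrow> v = y \<or> v = a" if "v \<in> X" for v
              using two_nbrs[OF x2(2) yx(3) ax(1)] dis yuab ab that by auto
            have Nx3: "adj x3 v \<longleftrightarrow> v = y \<or> v = b" if "v \<in> X" for v
              using two_nbrs[OF x3(2) yx(4) ax(2)] dis yuab ab that by auto
            have Xeq: "X = insert y (B1 \<union> {x2} \<union> {x3}) \<union> {u, a, b}" using XY YB by auto
            have K: "Y \<subseteq> X" using YX by blast
            note jl = joined_leaving[OF j YB K]
            have B1out: "ecount B1 {u, a, b} = ecount {a} B1 + ecount {b} B1" by (rule out) (use dis in auto)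
            have eB1: "ecount {y} B1 = 1" using j by (simp add: joined_def)
            have sqa: "\<not> adj a v" "\<not> adj b v" if "v \<in> Y" "adj y v" "v \<noteq> x2" "v \<noteq> x3" for v
              using no_square[of y v a x2] no_square[of y v b x3] that yx ax x2 x3 dis yuab
              by (auto simp: insert_commute)
            have B1X: "B1 \<subset> X" "B1 \<subseteq> X" using BX by auto
            show ?thesis
              using H(1) B1X(2) X(2)
            proof (cases rule: calH_cases)
              case (single x)
              then have "adj y x" using eB1 by (simp add: ecount_single_single split: if_splits)
              then have "\<not> adj a x" "\<not> adj b x" using sqa[of x] single dis by auto
              then have "ecount B1 (X - Y) = 0"
                using B1out single XY(1) by (simp add: ecount_single_single)
              then have "ecount B1 (X - B1) = 1" using jl(1) by simp
              moreover have "2 \<le> ecount B1 (X - B1)" using econnD[OF X(2) B1X(1)] single by simp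
              ultimately show ?thesis by simp
            next
              case blob
              have "ecount B1 (X - B1) \<noteq> 2" using bblob_two_edge_cut[OF X IH1 blob B1X(1)] dX by auto
              moreover have "2 \<le> ecount B1 (X - B1)"
                using econnD[OF X(2) B1X(1)] bblob_nonempty[OF blob] by simp
              \<comment> \<open>Exactly three edges leave \<open>B1\<close>, one of them to
                \<open>y\<close>. Since \<open>a\<close> already has the neighbours \<open>u\<close>
                and \<open>x2\<close>, and \<open>b\<close> has \<open>u\<close> and
                \<open>x3\<close>, each of them takes one of the other two edges.\<close>
              ultimately have "ecount {a} B1 + ecount {b} B1 = 2" using jl(1) l(3) B1out XY(1) by simp
              moreover have "ecount {a} B1 \<le> 1" "ecount {b} B1 \<le> 1"
              proof -
                have ux: "u \<noteq> x2" "u \<noteq> x3" using dis yuab by auto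
                have "ecount {a} (B1 \<union> {u, x2}) = ecount {a} B1 + ecount {a} {u, x2}"
                  using dis yuab by (intro ecount_Un_right) auto
                moreover have "ecount {a} {u, x2} = 2"
                  using ecount_insert_right[of u "{x2}" "{a}"] ua x2 ux by (simp add: ecount_single_single)
                ultimately show "ecount {a} B1 \<le> 1" using ecount_single_le[of a "B1 \<union> {u, x2}"] by simp
                have "ecount {b} (B1 \<union> {u, x3}) = ecount {b} B1 + ecount {b} {u, x3}"
                  using dis yuab by (intro ecount_Un_right) auto
                moreover have "ecount {b} {u, x3} = 2"
                  using ecount_insert_right[of u "{x3}" "{b}"] ua x3 ux by (simp add: ecount_single_single)
                ultimately show "ecount {b} B1 \<le> 1" using ecount_single_le[of b "B1 \<union> {u, x3}"] by simp
              qed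
              ultimately have e1: "ecount {a} B1 = 1" "ecount {b} B1 = 1" by linarith+
              obtain h0 where h0: "h0 \<in> B1" "\<And>w. w \<in> B1 \<Longrightarrow> adj y w \<longleftrightarrow> w = h0"
                using ecount_1E[OF eB1] by metis
              obtain h1 where h1: "h1 \<in> B1" "\<And>w. w \<in> B1 \<Longrightarrow> adj a w \<longleftrightarrow> w = h1"
                using ecount_1E[OF e1(1)] by metis
              obtain h2 where h2: "h2 \<in> B1" "\<And>w. w \<in> B1 \<Longrightarrow> adj b w \<longleftrightarrow> w = h2"
                using ecount_1E[OF e1(2)] by metis
              have hn: "h0 \<noteq> h1" "h0 \<noteq> h2" "h1 \<noteq> h2"
              proof -
                have "h0 \<noteq> x2" "h0 \<noteq> x3" "h0 \<in> Y" using h0(1) dis by auto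
                then have "\<not> adj a h0" "\<not> adj b h0" using sqa[of h0] h0 by auto
                then show "h0 \<noteq> h1" "h0 \<noteq> h2" using h1 h2 h0(1) by auto
                show "h1 \<noteq> h2" using sq[of h1] h1 h2 dis by auto
              qed
              have ya: "\<not> adj y a" "\<not> adj y b" "\<not> adj y u"
                using no_triangle[of y a x2] no_triangle[of y b x3] uY[of y] yx x2 x3 ax dis
                by (auto simp: insert_commute)
              have B1n: "\<not> adj x2 v" "\<not> adj x3 v" "\<not> adj u v" if "v \<in> B1" for v
                using Nx2[of v] Nx3[of v] uY[of v] that dis yuab B1X by auto
              have xn: "\<not> adj x2 u" "\<not> adj x2 b" "\<not> adj x2 x3" "\<not> adj a x3" "\<not> adj u x3"
                using Nx2[of u] Nx2[of b] Nx2[of x3] Nx3[of a] Nx3[of u] dis yuab u ab ne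
                by (auto simp: insert_commute)
              have "hexagon X B1 y x2 a u b x3 h0 h1 h2"
                unfolding hexagon_def
              proof (intro conjI ballI)
                show "X = B1 \<union> {y, x2, a, u, b, x3}" using Xeq by auto
                show "distinct [y, x2, a, u, b, x3]" using dis yuab ab ne by auto
                show "{y, x2, a, u, b, x3} \<inter> B1 = {}" using dis yuab by auto
              qed (use yx ax ua x2(1) x3(1) ya xn nab B1n h0 h1 h2 hn in \<open>auto simp: insert_commute\<close>)
              then show ?thesis using hexagon_gadget[OF blob] dX by fastforce
            next
              \<comment> \<open>At most three edges leave \<open>B1\<close>, so each part of this
                inner join sends out exactly two and is a single vertex. Then \<open>X\<close> has
                ten vertices and turns out to be G1.\<close>
              case (join y' Z1 Z2 Z3)
              have Zne: "Z1 \<noteq> {}" "Z2 \<noteq> {}" "Z3 \<noteq> {}" using join calH_nonempty by auto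
              have "ecount B1 (X - B1) = 3" using join(6) l(3) by simp
              then have lz: "ecount Z1 (X - Z1) = 2" "ecount Z2 (X - Z2) = 2" "ecount Z3 (X - Z3) = 2"
                by - (rule joined_parts[OF join(1,5) B1X(2) X(2) Zne], linarith)+
              have ZX: "Z1 \<subset> X" "Z2 \<subset> X" "Z3 \<subset> X" using join(5) BX by auto
              obtain z1 where z1: "Z1 = {z1}" using calH_two_out[OF join(2) ZX(1) lz(1) X IH1 dX] by auto
              obtain z2 where z2: "Z2 = {z2}" using calH_two_out[OF join(3) ZX(2) lz(2) X IH1 dX] by auto
              obtain z3 where z3: "Z3 = {z3}" using calH_two_out[OF join(4) ZX(3) lz(3) X IH1 dX] by auto
              have ez: "ecount {z1} X = 2" "ecount {z2} X = 2" "ecount {z3} X = 2"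
                using lz z1 z2 z3 by (simp_all add: ecount_self[of _ X])
              have B1eq: "B1 = {y', z1, z2, z3}" using join(5) z1 z2 z3 by auto
              have y'out: "\<not> adj y' v" if "v \<notin> B1" for v
                using joined_deg[OF join(1) join(5)[symmetric]] that by blast
              have y'z: "adj y' z1" "adj y' z2" "adj y' z3" "distinct [y', z1, z2, z3]"
                using join(1) z1 z2 z3
                by (auto simp: joined_def ecount_single_single split: if_splits)
              obtain h0 where h0: "h0 \<in> B1" "\<And>w. w \<in> B1 \<Longrightarrow> adj y w \<longleftrightarrow> w = h0"
                using ecount_1E[OF eB1] by metis
              have fin: ?thesis if z: "distinct [y', z1, z2, z3]" "B1 = {y', z1, z2, z3}" "h0 = z1"
                "adj y' z1" "adj y' z2" "adj y' z3" "ecount {z1} X = 2" "ecount {z2} X = 2" "ecount {z3} X = 2"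
                for z1 z2 z3
              proof -
                have zY: "z1 \<in> Y" "z2 \<in> Y" "z3 \<in> Y" "y' \<in> Y" using z(2) dis by auto
                have zX: "z1 \<in> X" "z2 \<in> X" "z3 \<in> X" "y' \<in> X" using z(2) B1X by auto
                have "adj y z1" "\<not> adj y z2" "\<not> adj y z3"
                  using h0(2)[of z1] h0(2)[of z2] h0(2)[of z3] z(1-3) by auto
                then have yz: "adj y z1" "adj z1 y" "\<not> adj y z2" "\<not> adj y z3"
                  by (auto intro: adj_sym)
                have zy': "adj z1 y'" "adj z2 y'" "adj z3 y'" using z(4-6) by (auto intro: adj_sym)
                have Nz1: "adj z1 v \<longleftrightarrow> v = y \<or> v = y'" if "v \<in> X" for v
                  using two_nbrs[OF z(7) yz(2) zy'(1)] that dis zX z(2) by auto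
                \<comment> \<open>The second neighbour of \<open>s\<close> can only be
                  \<open>a\<close> or \<open>b\<close>: the neighbours of \<open>x2\<close>,
                  \<open>x3\<close> and \<open>u\<close> are known, \<open>y\<close> is excluded by
                  assumption, and a neighbour among the \<open>z\<close> vertices would form a
                  triangle with \<open>y'\<close>.\<close>
                have nxt: "adj s a \<or> adj s b" if s: "s \<in> B1" "s \<noteq> y'" "adj s y'" "ecount {s} X = 2" "\<not> adj y s" for s
                proof (rule ccontr)
                  assume *: "\<not> ?thesis"
                  have "v = y'" if v: "v \<in> X" "adj s v" for v
                  proof (rule ccontr)
                    assume "v \<noteq> y'"
                    then have Ns: "adj s w \<longleftrightarrow> w = v \<or> w = y'" if "w \<in> X" for w
                      using two_nbrs[OF s(4) v(2) s(3)] that v zX by auto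
                    have "v \<noteq> y" using v s(5) by (auto simp: insert_commute)
                    moreover have "v \<noteq> x2" "v \<noteq> x3"
                      using Nx2[of s] Nx3[of s] v s dis yuab B1X by (auto simp: insert_commute)
                    moreover have "v \<noteq> u" using uY[of s] v s dis by (auto simp: insert_commute)
                    moreover have "v \<noteq> a" "v \<noteq> b" using * v by auto
                    ultimately have "v \<in> B1" using v Xeq by auto
                    have "v \<notin> {z1, z2, z3} \<or> s \<notin> {z1, z2, z3}"
                      using no_triangle[of y' s v] v(2) z(4-6) s(3)
                      by (auto simp: insert_commute)
                    then show False using \<open>v \<in> B1\<close> \<open>v \<noteq> y'\<close> s(1,2) z(2) by auto
                  qed
                  then have "{w \<in> X. adj s w} \<subseteq> {y'}" by blast
                  then have "card {w \<in> X. adj s w} \<le> 1" using card_mono[of "{y'}"] by fastforce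
                  then show False using s(4) by (simp add: ecount_single)
                qed
                have z2ab: "adj z2 a \<or> adj z2 b" using nxt[of z2] z zy' yz by auto
                have z3ab: "adj z3 a \<or> adj z3 b" using nxt[of z3] z zy' yz by auto
                have y'ab: "y' \<noteq> a" "y' \<noteq> b" "y' \<noteq> u" using zY yuab by auto
                have nsq: "\<not> (adj z2 a \<and> adj z3 a)" "\<not> (adj z2 b \<and> adj z3 b)"
                  using no_square[of y' z2 a z3] no_square[of y' z2 b z3] y'ab z
                  by (auto simp: insert_commute)
                have G: "bblob X" if zz: "adj p2 a" "adj p3 b" "{p2, p3} = {z2, z3}" "p2 \<noteq> p3" for p2 p3
                proof -
                  have p: "ecount {p2} X = 2" "ecount {p3} X = 2" "adj p2 y'" "adj p3 y'" "p2 \<in> X" "p3 \<in> X"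
                    "p2 \<in> Y" "p3 \<in> Y" "p2 \<in> B1" "p3 \<in> B1" "p2 \<noteq> y'" "p3 \<noteq> y'" "z1 \<noteq> p2" "z1 \<noteq> p3"
                    using zz z zy' zX zY by (auto simp: doubleton_eq_iff)
                  have Nz2: "adj p2 v \<longleftrightarrow> v = y' \<or> v = a" if "v \<in> X" for v
                    using two_nbrs[OF p(1) p(3) zz(1)] that zX ab y'ab by auto
                  have Nz3: "adj p3 v \<longleftrightarrow> v = y' \<or> v = b" if "v \<in> X" for v
                    using two_nbrs[OF p(2) p(4) zz(2)] that zX ab y'ab by auto
                  show ?thesis
                  proof (rule G1_gadget[of X y z1 y' x2 x3 p2 p3 a b u])
                    have "B1 = {y', z1, p2, p3}" using z(2) zz(3) by auto
                    then show "X = {y, z1, y', x2, x3, p2, p3, a, b, u}" using Xeq by auto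
                    show "distinct [y, z1, y', x2, x3, p2, p3, a, b, u]"
                      using dis yuab p zY z(1,2) zz(4) ab ne by auto
                  qed (use Nz1 Nx2 Nx3 Nz2 Nz3 Nu in blast)+
                qed
                show ?thesis
                  using z2ab z3ab nsq G[of z2 z3] G[of z3 z2] z(1) by (auto simp: insert_commute)
              qed
              have "h0 \<noteq> y'" using y'out[of y] h0 dis by (auto simp: insert_commute)
              then consider "h0 = z1" | "h0 = z2" | "h0 = z3" using h0(1) B1eq by auto
              then show ?thesis
              proof cases
                case 1
                show ?thesis by (rule fin[of z1 z2 z3]) (use 1 y'z B1eq ez in auto)
              next
                case 2
                show ?thesis by (rule fin[of z2 z1 z3]) (use 2 y'z B1eq ez in auto)
              next
                case 3
                show ?thesis by (rule fin[of z3 z1 z2]) (use 3 y'z B1eq ez in auto)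
              qed
            qed
          qed
          have K: "Y \<subseteq> X" using YX by blast
          have YB': "Y = insert y (B2 \<union> B1 \<union> B3)" "Y = insert y (B3 \<union> B2 \<union> B1)" "Y = insert y (B1 \<union> B3 \<union> B2)"
            using YB by auto
          have "ecount B2 (X - Y) = 1" using joined_leaving(1)[OF joined_swap12[OF j] YB'(1) K] l by simp
          moreover have "ecount B3 (X - Y) = 1" using joined_leaving(1)[OF joined_swap13[OF j] YB'(2) K] l by simp
          ultimately have e1: "ecount {a} {x2} + ecount {b} {x2} = 1" "ecount {a} {x3} + ecount {b} {x3} = 1"
            using out[of B2] out[of B3] XY(1) x2 x3 YB by auto
          have j': "joined y B1 {x2} {x3}" "joined y B1 {x3} {x2}" using j joined_swap23[OF j] x2 x3 by auto
          have YBx: "Y = insert y (B1 \<union> {x2} \<union> {x3})" "Y = insert y (B1 \<union> {x3} \<union> {x2})" using YB x2 x3 by auto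
          have yx: "adj y x2" "adj y x3" "x2 \<noteq> x3"
            using j'(1) by (auto simp: joined_def ecount_single_single split: if_splits)
          have ye: "y \<noteq> a" "y \<noteq> b" using yX by (auto simp: Y_def)
          have "\<not> (adj a x2 \<and> adj a x3)" "\<not> (adj b x2 \<and> adj b x3)"
            using no_square[of y x2 a x3] no_square[of y x2 b x3] yx ye by (auto simp: insert_commute)
          moreover have "adj a x2 \<or> adj b x2" "adj a x3 \<or> adj b x3"
            using ecount_eq_0[of "{a}" "{x2}"] ecount_eq_0[of "{b}" "{x2}"] ecount_eq_0[of "{a}" "{x3}"]
              ecount_eq_0[of "{b}" "{x3}"] e1 by force+
          ultimately have or: "adj a x2 \<and> adj b x3 \<or> adj a x3 \<and> adj b x2" by blast
          have e2: "ecount {x2} X = 2" "ecount {x3} X = 2"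
            using l x2 x3 by (simp_all add: ecount_self[of _ X])
          show ?thesis
            using core[OF j'(1) YBx(1) _ e2(1) _ e2(2)] core[OF j'(2) YBx(2) _ e2(2) _ e2(1)] or by blast
        qed
        have "ecount Y (X - Y) \<le> 4" using eY le2 by simp
        then obtain l1 l2 l3 where ls: "ecount X1 (X - X1) = l1 + 1" "ecount X2 (X - X2) = l2 + 1"
          "ecount X3 (X - X3) = l3 + 1" "1 \<le> l1" "1 \<le> l2" "1 \<le> l3" "l1 + l2 + l3 \<le> 4"
          using joined_parts[OF join(1,5) psubset_imp_subset[OF YX] X(2) calH_nonempty[OF join(2)]
              calH_nonempty[OF join(3)] calH_nonempty[OF join(4)]] by metis
        then consider "l2 = 1" "l3 = 1" "l1 \<le> 2" | "l1 = 1" "l3 = 1" "l2 \<le> 2" | "l1 = 1" "l2 = 1" "l3 \<le> 2"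
          by linarith
        then show ?thesis
        proof cases
          case 1
          then show ?thesis using main[OF join(1-5)] ls by simp
        next
          case 2
          have "Y = insert y (X2 \<union> X1 \<union> X3)" using join(5) by auto
          then show ?thesis using main[OF joined_swap12[OF join(1)] join(3,2,4)] ls 2 by simp
        next
          case 3
          have "Y = insert y (X3 \<union> X2 \<union> X1)" using join(5) by auto
          then show ?thesis using main[OF joined_swap13[OF join(1)] join(4,3,2)] ls 3 by simp
        qed
      qed
      then show ?thesis using dXY bY calH.blob by (auto simp: bounded_def)
    qed (simp add: bounded_def)
  qed
qed

end

section \<open>Joining host trees\<close>

text \<open>Otherwise \<open>P\<close> would propagate from \<open>i\<close> around the whole cycle
  and reach \<open>j\<close>.\<close>

lemma cyclic_crossing:
  fixes i j n :: nat
  assumes "i < n" "P i" "j < n" "\<not> P j"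
  obtains k where "k < n" "P k" "\<not> P ((k + 1) mod n)"
proof -
  have "\<exists>k<n. P k \<and> \<not> P ((k + 1) mod n)"
  proof (rule ccontr)
    assume "\<not> ?thesis"
    then have step: "P ((k + 1) mod n)" if "k < n" "P k" for k using that by blast
    have "P ((i + k) mod n)" for k
    proof (induction k)
      case 0
      then show ?case using assms by simp
    next
      case (Suc k)
      have "(i + k) mod n < n" using assms by simp
      then have "P (((i + k) mod n + 1) mod n)" using step Suc by blast
      then show ?case by (simp add: mod_simps)
    qed
    from this[of "n - i + j"] show False using assms by (simp add: mod_simps)
  qed
  then show thesis using that by blast
qed

lemma graph_edgeD: "graph X F \<Longrightarrow> {u, v} \<in> F \<Longrightarrow> u \<in> X \<and> v \<in> X \<and> u \<noteq> v"
  unfolding graph_def by (metis doubleton_eq_iff)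

lemma graph_bridge:
  assumes "graph X F" "graph X' F'" "X \<inter> X' = {}" "x \<in> X" "x' \<in> X'"
  shows "graph (X \<union> X') (F \<union> F' \<union> {{x, x'}})"
proof -
  have "\<exists>u v. e = {u, v} \<and> u \<noteq> v \<and> u \<in> X \<union> X' \<and> v \<in> X \<union> X'" if "e \<in> F \<union> F' \<union> {{x, x'}}" for e
    using that
  proof (elim UnE)
    assume "e \<in> F"
    then show ?thesis using assms(1) unfolding graph_def by blast
  next
    assume "e \<in> F'"
    then show ?thesis using assms(2) unfolding graph_def by blast
  next
    assume "e \<in> {{x, x'}}"
    then show ?thesis using assms(3-5) by blast
  qed
  then show ?thesis using assms(1,2) by (simp add: graph_def)
qed

lemma reach_sym: "reach F u v \<Longrightarrow> reach F v u"
  unfolding reach_def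
proof (induction rule: rtranclp_induct)
  case (step y z)
  have "{z, y} \<in> F" using step(2) by (simp add: insert_commute)
  then show ?case using step(3) by (rule converse_rtranclp_into_rtranclp)
qed simp

lemma reach_mono: "reach F u v \<Longrightarrow> F \<subseteq> F' \<Longrightarrow> reach F' u v"
  unfolding reach_def by (erule rtranclp_mono[THEN predicate2D, rotated]) auto

text \<open>A cycle meeting both sides steps from \<open>x\<close> to \<open>x'\<close> at some
  position and back from \<open>x'\<close> to \<open>x\<close> at another. As its entries are
  distinct, the two positions follow each other cyclically, so its length divides 2.\<close>

lemma tree_bridge:
  assumes T: "tree X F" "tree X' F'" and d: "X \<inter> X' = {}" and x: "x \<in> X" "x' \<in> X'"
  shows "tree (X \<union> X') (F \<union> F' \<union> {{x, x'}})"
proof -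
  let ?F = "F \<union> F' \<union> {{x, x'}}"
  have g: "graph X F" "graph X' F'" using T by (auto simp: tree_def)
  have c: "\<And>u v. u \<in> X \<Longrightarrow> v \<in> X \<Longrightarrow> reach F u v" "\<And>u v. u \<in> X' \<Longrightarrow> v \<in> X' \<Longrightarrow> reach F' u v"
    using T by (auto simp: tree_def connected_graph_def)
  have r: "reach ?F x v" if v: "v \<in> X \<union> X'" for v
  proof (cases "v \<in> X")
    case True
    show ?thesis by (rule reach_mono[OF c(1)[OF x(1) True]]) blast
  next
    case False
    then have "v \<in> X'" using v by blast
    have "reach ?F x' v" by (rule reach_mono[OF c(2)[OF x(2) \<open>v \<in> X'\<close>]]) blast
    moreover have "{x, x'} \<in> ?F" by blast
    ultimately show ?thesis
      unfolding reach_def using converse_rtranclp_into_rtranclp[of "\<lambda>x y. {x, y} \<in> ?F" x x' v] by simp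
  qed
  have conn: "connected_graph (X \<union> X') ?F"
    unfolding connected_graph_def
  proof (intro ballI)
    fix u v assume u: "u \<in> X \<union> X'" and v: "v \<in> X \<union> X'"
    show "reach ?F u v"
      using reach_sym[OF r[OF u]] r[OF v] unfolding reach_def by (rule rtranclp_trans)
  qed
  have acyc: "\<not> is_cycle ?F xs" for xs
  proof
    assume cyc: "is_cycle ?F xs"
    let ?n = "length xs"
    have n: "3 \<le> ?n" and dist: "distinct xs"
      and e: "\<And>i. i < ?n \<Longrightarrow> {xs ! i, xs ! ((i + 1) mod ?n)} \<in> ?F"
      using cyc by (auto simp: is_cycle_def)
    have in_F: "{a, b} \<in> F" if "{a, b} \<in> ?F" "a \<in> X" "b \<in> X" for a b
    proof -
      have "{a, b} \<notin> F'" using graph_edgeD[OF g(2), of a b] that d by blast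
      moreover have "{a, b} \<noteq> {x, x'}" using that d x by (auto simp: doubleton_eq_iff)
      ultimately show ?thesis using that by blast
    qed
    have in_F': "{a, b} \<in> F'" if "{a, b} \<in> ?F" "a \<in> X'" "b \<in> X'" for a b
    proof -
      have "{a, b} \<notin> F" using graph_edgeD[OF g(1), of a b] that d by blast
      moreover have "{a, b} \<noteq> {x, x'}" using that d x by (auto simp: doubleton_eq_iff)
      ultimately show ?thesis using that by blast
    qed
    have cross: "a = x \<and> b = x'" if "{a, b} \<in> ?F" "a \<in> X" "b \<notin> X" for a b
    proof -
      have "{a, b} \<notin> F" using graph_edgeD[OF g(1), of a b] that by blast
      moreover have "{a, b} \<notin> F'" using graph_edgeD[OF g(2), of a b] that d by blast
      ultimately have "{a, b} = {x, x'}" using that by blast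
      then show ?thesis using that x by (auto simp: doubleton_eq_iff)
    qed
    have memb: "xs ! i \<in> X \<union> X'" if "i < ?n" for i
      using graph_edgeD[OF graph_bridge[OF g d x] e[OF that]] by blast
    have lt: "(i + 1) mod ?n < ?n" for i using n by (intro mod_less_divisor) linarith
    show False
    proof (cases "(\<exists>i<?n. xs ! i \<in> X) \<and> (\<exists>j<?n. xs ! j \<notin> X)")
      case False
      then consider "\<And>i. i < ?n \<Longrightarrow> xs ! i \<in> X" | "\<And>i. i < ?n \<Longrightarrow> xs ! i \<in> X'" using memb by blast
      then show False
      proof cases
        case 1
        then have "is_cycle F xs"
          unfolding is_cycle_def using n dist in_F[OF e _ _] lt by auto
        then show False using T(1) by (auto simp: tree_def)
      next
        case 2
        then have "is_cycle F' xs"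
          unfolding is_cycle_def using n dist in_F'[OF e _ _] lt by auto
        then show False using T(2) by (auto simp: tree_def)
      qed
    next
      case True
      then obtain i j where ij: "i < ?n" "xs ! i \<in> X" "j < ?n" "xs ! j \<notin> X" by blast
      obtain k where k: "k < ?n" "xs ! k \<in> X" "xs ! ((k + 1) mod ?n) \<notin> X"
        using cyclic_crossing[of i ?n "\<lambda>i. xs ! i \<in> X" j] ij by blast
      obtain l where l: "l < ?n" "xs ! l \<notin> X" "\<not> xs ! ((l + 1) mod ?n) \<notin> X"
        using cyclic_crossing[of j ?n "\<lambda>i. xs ! i \<notin> X" i] ij by blast
      have kx: "xs ! k = x" "xs ! ((k + 1) mod ?n) = x'" using cross[OF e[OF k(1)] k(2,3)] by auto
      have "{xs ! ((l + 1) mod ?n), xs ! l} \<in> ?F" using e[OF l(1)] by (simp add: insert_commute)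
      then have lx: "xs ! ((l + 1) mod ?n) = x" "xs ! l = x'" using cross l(2,3) by blast+
      have lk: "l = (k + 1) mod ?n" using kx(2) lx(2) nth_eq_iff_index_eq[OF dist l(1) lt] by metis
      have kl: "k = (l + 1) mod ?n" using kx(1) lx(1) nth_eq_iff_index_eq[OF dist k(1) lt] by metis
      have "(k + 2) mod ?n = ((k + 1) mod ?n + 1) mod ?n" by (simp add: mod_simps)
      also have "\<dots> = k" using lk kl by (simp only:)
      finally have "(k + 2) mod ?n = k mod ?n" using k(1) by simp
      then have "?n dvd 2" using mod_eq_dvd_iff_nat[of k "k + 2" ?n] by simp
      then show False using n by (auto dest: dvd_imp_le)
    qed
  qed
  show ?thesis
    unfolding tree_def using graph_bridge[OF g d x] conn acyc x by auto
qed

lemma no_cycle_empty: "\<not> is_cycle {} xs"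
  unfolding is_cycle_def by (metis empty_iff not_numeral_le_zero not_gr_zero)

lemma tree_single: "tree {x} {}"
  unfolding tree_def using no_cycle_empty by (auto simp: graph_def connected_graph_def reach_def)

lemma matching_number_ge: "finite E \<Longrightarrow> matching E M \<Longrightarrow> card M \<le> matching_number E"
  unfolding matching_number_def
  by (rule Max_ge) (auto intro!: finite_imageI finite_subset[of _ "Pow E"] simp: matching_def)

lemma matching_number_witness:
  assumes "finite E" shows "\<exists>M. matching E M \<and> card M = matching_number E"
proof -
  have "matching_number E \<in> card ` {M. matching E M}"
    unfolding matching_number_def
  proof (rule Max_in)
    show "finite (card ` {M. matching E M})"
      using assms by (auto intro!: finite_imageI finite_subset[of _ "Pow E"] simp: matching_def)
    have "matching E {}" by (simp add: matching_def)
    then show "card ` {M. matching E M} \<noteq> {}" by blast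
  qed
  then show ?thesis by auto
qed

lemma graph_finite_edges: "graph X F \<Longrightarrow> finite F"
  by (rule finite_subset[of _ "Pow X"]) (auto simp: graph_def)

lemma calT_single: "calT {x} {}" "GE_D {x} {} = {x}"
proof -
  have m: "matching {} M \<longleftrightarrow> M = {}" for M :: "'a set set" by (auto simp: matching_def)
  have 0: "matching_number ({} :: 'a set set) = 0" by (simp add: matching_number_def m)
  show D: "GE_D {x} {} = {x}" by (auto simp: GE_D_def m 0)
  show "calT {x} {}" using tree_single by (auto simp: calT_def GE_A_def 0 D)
qed

lemma matching_Un:
  assumes "matching F M" "matching F' M'" "\<Union>M \<inter> \<Union>M' = {}"
  shows "matching (F \<union> F') (M \<union> M')"
proof -
  have "e \<inter> f = {}" if "e \<in> M" "f \<in> M'" for e f using that assms(3) by blast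
  then show ?thesis using assms(1,2) unfolding matching_def by (metis UnE Un_mono inf_commute)
qed

text \<open>A join of host trees. Each of \<open>x1\<close>, \<open>x2\<close>, \<open>x3\<close> is
  missed by some maximum matching of its tree and is then free for \<open>y\<close>; this puts
  \<open>y\<close> into the set A of the union.\<close>

locale three_trees =
  fixes X1 X2 X3 :: "'a set" and F1 F2 F3 and y x1 x2 x3
  assumes T1: "calT X1 F1" and T2: "calT X2 F2" and T3: "calT X3 F3"
    and d: "X1 \<inter> X2 = {}" "X1 \<inter> X3 = {}" "X2 \<inter> X3 = {}" "y \<notin> X1" "y \<notin> X2" "y \<notin> X3"
    and x1: "x1 \<in> GE_D X1 F1" and x2: "x2 \<in> GE_D X2 F2" and x3: "x3 \<in> GE_D X3 F3"
begin

abbreviation "Y \<equiv> {{y, x1}, {y, x2}, {y, x3}}"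
abbreviation "J \<equiv> insert y (X1 \<union> X2 \<union> X3)"
abbreviation "F \<equiv> F1 \<union> F2 \<union> F3 \<union> Y"

lemma graphs: "graph X1 F1" "graph X2 F2" "graph X3 F3"
  using T1 T2 T3 by (auto simp: calT_def tree_def)

lemma x_in: "x1 \<in> X1" "x2 \<in> X2" "x3 \<in> X3"
  using x1 x2 x3 by (auto simp: GE_D_def)

lemma in_X: "e \<in> F1 \<Longrightarrow> e \<subseteq> X1" "e \<in> F2 \<Longrightarrow> e \<subseteq> X2" "e \<in> F3 \<Longrightarrow> e \<subseteq> X3"
  using graphs unfolding graph_def by fastforce+

lemma nonempty_edge: "e \<in> F \<Longrightarrow> e \<noteq> {}"
  using graphs unfolding graph_def by fastforce

lemma edges_disjoint: "F1 \<inter> F2 = {}" "F1 \<inter> F3 = {}" "F2 \<inter> F3 = {}" "F1 \<inter> Y = {}" "F2 \<inter> Y = {}" "F3 \<inter> Y = {}"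
proof -
  have ne: "e \<noteq> {}" if "e \<in> F1 \<or> e \<in> F2 \<or> e \<in> F3" for e using nonempty_edge that by blast
  show "F1 \<inter> F2 = {}" using in_X(1,2) ne d(1) by (metis Int_emptyI Int_greatest subset_empty)
  show "F1 \<inter> F3 = {}" using in_X(1,3) ne d(2) by (metis Int_emptyI Int_greatest subset_empty)
  show "F2 \<inter> F3 = {}" using in_X(2,3) ne d(3) by (metis Int_emptyI Int_greatest subset_empty)
  show "F1 \<inter> Y = {}" "F2 \<inter> Y = {}" "F3 \<inter> Y = {}" using in_X d by auto
qed

lemma finite_edges: "finite F1" "finite F2" "finite F3" "finite F"
  using graphs graph_finite_edges by auto

lemma matching_card:
  assumes "matching F M"
  shows "card M = card (M \<inter> F1) + card (M \<inter> F2) + card (M \<inter> F3) + card (M \<inter> Y)"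
    and "card (M \<inter> Y) \<le> 1"
proof -
  have MF: "M \<subseteq> F" using assms by (auto simp: matching_def)
  then have fin: "finite M" using finite_edges(4) finite_subset by blast
  have "M = (M \<inter> F1) \<union> (M \<inter> F2) \<union> (M \<inter> F3) \<union> (M \<inter> Y)" using MF by blast
  also have "card \<dots> = card ((M \<inter> F1) \<union> (M \<inter> F2) \<union> (M \<inter> F3)) + card (M \<inter> Y)"
    using fin edges_disjoint by (intro card_Un_disjoint) auto
  also have "card ((M \<inter> F1) \<union> (M \<inter> F2) \<union> (M \<inter> F3)) = card ((M \<inter> F1) \<union> (M \<inter> F2)) + card (M \<inter> F3)"
    using fin edges_disjoint by (intro card_Un_disjoint) auto
  also have "card ((M \<inter> F1) \<union> (M \<inter> F2)) = card (M \<inter> F1) + card (M \<inter> F2)"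
    using fin edges_disjoint by (intro card_Un_disjoint) auto
  finally show "card M = card (M \<inter> F1) + card (M \<inter> F2) + card (M \<inter> F3) + card (M \<inter> Y)" .
  have "e = f" if "e \<in> M \<inter> Y" "f \<in> M \<inter> Y" for e f
  proof -
    have "y \<in> e \<inter> f" using that by auto
    moreover have "\<forall>e\<in>M. \<forall>f\<in>M. e \<noteq> f \<longrightarrow> e \<inter> f = {}" using assms by (simp add: matching_def)
    ultimately show ?thesis using that by (metis IntD1 empty_iff)
  qed
  then have "\<forall>e\<in>M \<inter> Y. \<forall>f\<in>M \<inter> Y. e = f" by blast
  moreover have "finite (M \<inter> Y)" using fin by simp
  ultimately have "card (M \<inter> Y) \<le> Suc 0" using card_le_Suc0_iff_eq by blast
  then show "card (M \<inter> Y) \<le> 1" by simp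
qed

abbreviation "k1 \<equiv> matching_number F1"
abbreviation "k2 \<equiv> matching_number F2"
abbreviation "k3 \<equiv> matching_number F3"

lemma matching_parts:
  assumes "matching F M"
  shows "matching F1 (M \<inter> F1)" "matching F2 (M \<inter> F2)" "matching F3 (M \<inter> F3)"
  using assms by (simp_all add: matching_def)

lemma matching_le:
  assumes "matching F M"
  shows "card (M \<inter> F1) \<le> k1" "card (M \<inter> F2) \<le> k2" "card (M \<inter> F3) \<le> k3"
  using matching_parts[OF assms] finite_edges by (auto intro: matching_number_ge)

lemma combine:
  assumes M: "matching F1 M1" "matching F2 M2" "matching F3 M3"
    and e: "e = {y, x}" "e \<in> Y" "x \<notin> \<Union>M1 \<union> \<Union>M2 \<union> \<Union>M3"
  shows "matching F (insert e (M1 \<union> M2 \<union> M3))"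
    and "card (insert e (M1 \<union> M2 \<union> M3)) = card M1 + card M2 + card M3 + 1"
proof -
  have sub: "M1 \<subseteq> F1" "M2 \<subseteq> F2" "M3 \<subseteq> F3" using M by (auto simp: matching_def)
  have cov: "\<Union>M1 \<subseteq> X1" "\<Union>M2 \<subseteq> X2" "\<Union>M3 \<subseteq> X3" using sub in_X by blast+
  have cd: "\<Union>M1 \<inter> \<Union>M2 = {}" "\<Union>(M1 \<union> M2) \<inter> \<Union>M3 = {}" "y \<notin> \<Union>M1" "y \<notin> \<Union>M2" "y \<notin> \<Union>M3"
    using cov d by blast+
  have m12: "matching (F1 \<union> F2) (M1 \<union> M2)" by (rule matching_Un[OF M(1,2) cd(1)])
  have m123: "matching (F1 \<union> F2 \<union> F3) (M1 \<union> M2 \<union> M3)" by (rule matching_Un[OF m12 M(3) cd(2)])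
  have me: "matching Y {e}" using e by (simp add: matching_def)
  have "\<Union>(M1 \<union> M2 \<union> M3) \<inter> \<Union>{e} = {}" using e(1,3) cd(3-5) by blast
  then have "matching F ((M1 \<union> M2 \<union> M3) \<union> {e})" by (rule matching_Un[OF m123 me])
  then show m: "matching F (insert e (M1 \<union> M2 \<union> M3))" by simp
  have "insert e (M1 \<union> M2 \<union> M3) \<inter> F1 = M1" "insert e (M1 \<union> M2 \<union> M3) \<inter> F2 = M2"
    "insert e (M1 \<union> M2 \<union> M3) \<inter> F3 = M3" "insert e (M1 \<union> M2 \<union> M3) \<inter> Y = {e}"
    using sub edges_disjoint e(2) by blast+
  then show "card (insert e (M1 \<union> M2 \<union> M3)) = card M1 + card M2 + card M3 + 1"
    using matching_card(1)[OF m] by simp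
qed

lemma max_missing:
  shows "\<exists>M. matching F1 M \<and> card M = k1 \<and> x1 \<notin> \<Union>M" "\<exists>M. matching F2 M \<and> card M = k2 \<and> x2 \<notin> \<Union>M"
    "\<exists>M. matching F3 M \<and> card M = k3 \<and> x3 \<notin> \<Union>M"
  using x1 x2 x3 by (auto simp: GE_D_def)

lemma cover: "matching F1 M \<Longrightarrow> \<Union>M \<subseteq> X1" "matching F2 M \<Longrightarrow> \<Union>M \<subseteq> X2" "matching F3 M \<Longrightarrow> \<Union>M \<subseteq> X3"
  using in_X by (meson Sup_least matching_def subsetD)+

text \<open>A matching contains at most one edge at \<open>y\<close>, and one can be had in addition
  to maximum matchings of the trees because \<open>x1\<close> may be left uncovered.\<close>

lemma joined_number: "matching_number F = k1 + k2 + k3 + 1"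
proof (rule antisym)
  obtain M where M: "matching F M" "card M = matching_number F"
    using matching_number_witness[OF finite_edges(4)] by blast
  show "matching_number F \<le> k1 + k2 + k3 + 1"
    using M matching_card[OF M(1)] matching_le[OF M(1)] by linarith
  obtain M1 M2 M3 where m: "matching F1 M1" "card M1 = k1" "x1 \<notin> \<Union>M1" "matching F2 M2" "card M2 = k2"
    "matching F3 M3" "card M3 = k3"
    using max_missing by meson
  have "x1 \<notin> \<Union>M1 \<union> \<Union>M2 \<union> \<Union>M3" using m cover(2)[OF m(4)] cover(3)[OF m(6)] x_in d by blast
  from combine[OF m(1,4,6) refl _ this] show "k1 + k2 + k3 + 1 \<le> matching_number F"
    using matching_number_ge[OF finite_edges(4)] m by fastforce
qed

text \<open>A maximum matching of the union covers \<open>y\<close> and is maximum on every tree, so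
  a vertex it misses lies in one of the three D sets. Conversely, if a maximum matching of one tree
  misses \<open>v\<close>, then \<open>y\<close> is matched into another tree and \<open>v\<close>
  stays uncovered.\<close>

lemma joined_D: "GE_D J F = GE_D X1 F1 \<union> GE_D X2 F2 \<union> GE_D X3 F3"
proof (intro equalityI subsetI)
  fix v assume "v \<in> GE_D J F"
  then obtain M where v: "v \<in> J" and M: "matching F M" "card M = matching_number F" "v \<notin> \<Union>M"
    by (auto simp: GE_D_def)
  have eq: "card (M \<inter> F1) = k1" "card (M \<inter> F2) = k2" "card (M \<inter> F3) = k3" "card (M \<inter> Y) = 1"
    using matching_card[OF M(1)] matching_le[OF M(1)] M(2) joined_number by linarith+
  have "v \<noteq> y"
  proof
    assume "v = y"
    then have "M \<inter> Y = {}" using M(3) by auto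
    then show False using eq(4) by simp
  qed
  then consider "v \<in> X1" | "v \<in> X2" | "v \<in> X3" using v by blast
  then show "v \<in> GE_D X1 F1 \<union> GE_D X2 F2 \<union> GE_D X3 F3"
    using matching_parts[OF M(1)] eq M(3) by cases (auto simp: GE_D_def)
next
  obtain N1 N2 N3 where n: "matching F1 N1" "card N1 = k1" "x1 \<notin> \<Union>N1" "matching F2 N2" "card N2 = k2"
    "x2 \<notin> \<Union>N2" "matching F3 N3" "card N3 = k3" "x3 \<notin> \<Union>N3"
    using max_missing by meson
  have ne: "x1 \<notin> X2" "x1 \<notin> X3" "x2 \<notin> X1" "x2 \<notin> X3" "x3 \<notin> X1" "x3 \<notin> X2" using x_in d by blast+
  fix v assume "v \<in> GE_D X1 F1 \<union> GE_D X2 F2 \<union> GE_D X3 F3"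
  then consider (1) M where "v \<in> X1" "matching F1 M" "card M = k1" "v \<notin> \<Union>M"
    | (2) M where "v \<in> X2" "matching F2 M" "card M = k2" "v \<notin> \<Union>M"
    | (3) M where "v \<in> X3" "matching F3 M" "card M = k3" "v \<notin> \<Union>M"
    by (auto simp: GE_D_def)
  then show "v \<in> GE_D J F"
  proof cases
    case 1
    have "x2 \<notin> \<Union>M \<union> \<Union>N2 \<union> \<Union>N3" using n cover(1)[OF 1(2)] cover(3)[OF n(7)] ne by blast
    note c = combine[OF 1(2) n(4,7) refl _ this]
    have "v \<notin> \<Union>(insert {y, x2} (M \<union> N2 \<union> N3))"
      using 1 cover(2)[OF n(4)] cover(3)[OF n(7)] d ne by auto
    then show ?thesis using c 1 n joined_number by (auto simp: GE_D_def)
  next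
    case 2
    have "x1 \<notin> \<Union>N1 \<union> \<Union>M \<union> \<Union>N3" using n cover(2)[OF 2(2)] cover(3)[OF n(7)] ne by blast
    note c = combine[OF n(1) 2(2) n(7) refl _ this]
    have "v \<notin> \<Union>(insert {y, x1} (N1 \<union> M \<union> N3))"
      using 2 cover(1)[OF n(1)] cover(3)[OF n(7)] d ne by auto
    then show ?thesis using c 2 n joined_number by (auto simp: GE_D_def)
  next
    case 3
    have "x1 \<notin> \<Union>N1 \<union> \<Union>N2 \<union> \<Union>M" using n cover(2)[OF n(4)] cover(3)[OF 3(2)] ne by blast
    note c = combine[OF n(1,4) 3(2) refl _ this]
    have "v \<notin> \<Union>(insert {y, x1} (N1 \<union> N2 \<union> M))"
      using 3 cover(1)[OF n(1)] cover(2)[OF n(4)] d ne by auto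
    then show ?thesis using c 3 n joined_number by (auto simp: GE_D_def)
  qed
qed

lemma joined_tree: "tree J F"
proof -
  have t: "tree X1 F1" "tree X2 F2" "tree X3 F3" using T1 T2 T3 by (auto simp: calT_def)
  have a: "tree ({y} \<union> X1) ({} \<union> F1 \<union> {{y, x1}})"
    by (rule tree_bridge[OF tree_single t(1)]) (use d x_in in auto)
  have b: "tree ({y} \<union> X1 \<union> X2) ({} \<union> F1 \<union> {{y, x1}} \<union> F2 \<union> {{y, x2}})"
    by (rule tree_bridge[OF a t(2)]) (use d x_in in auto)
  have "tree ({y} \<union> X1 \<union> X2 \<union> X3) ({} \<union> F1 \<union> {{y, x1}} \<union> F2 \<union> {{y, x2}} \<union> F3 \<union> {{y, x3}})"
    by (rule tree_bridge[OF b t(3)]) (use d x_in in auto)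
  moreover have "{y} \<union> X1 \<union> X2 \<union> X3 = J" by auto
  moreover have "{} \<union> F1 \<union> {{y, x1}} \<union> F2 \<union> {{y, x2}} \<union> F3 \<union> {{y, x3}} = F" by auto
  ultimately show ?thesis by (simp only:)
qed

lemma degree_part:
  assumes "v \<in> X1 \<and> v \<noteq> x1 \<and> G = F1 \<or> v \<in> X2 \<and> v \<noteq> x2 \<and> G = F2 \<or> v \<in> X3 \<and> v \<noteq> x3 \<and> G = F3"
  shows "{u, v} \<in> F \<longleftrightarrow> {u, v} \<in> G"
proof -
  have Yv: "{u, v} \<notin> Y" using assms d x_in by (auto simp: doubleton_eq_iff)
  have "{u, v} \<in> F1 \<Longrightarrow> v \<in> X1" "{u, v} \<in> F2 \<Longrightarrow> v \<in> X2" "{u, v} \<in> F3 \<Longrightarrow> v \<in> X3"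
    using in_X by blast+
  then show ?thesis using assms Yv d by blast
qed

text \<open>The vertex \<open>y\<close> has at most three neighbours. Any other vertex of A lies
  outside D, hence differs from \<open>x1\<close>, \<open>x2\<close>, \<open>x3\<close>, and has
  gained no edge.\<close>

lemma joined_degrees:
  assumes "v \<in> GE_A J F"
  shows "degree F v \<le> 3"
proof (cases "v = y")
  case True
  have "{u. {u, y} \<in> F} \<subseteq> {x1, x2, x3}"
    using in_X d by (auto simp: doubleton_eq_iff)
  then have "degree F y \<le> card {x1, x2, x3}" unfolding degree_def by (intro card_mono) auto
  also have "\<dots> \<le> 3" by (simp add: card_insert_if)
  finally show ?thesis using True by simp
next
  case False
  obtain w where w: "w \<in> GE_D J F" "{w, v} \<in> F" and v: "v \<in> J" "v \<notin> GE_D J F"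
    using assms by (auto simp: GE_A_def)
  have vD: "v \<notin> GE_D X1 F1" "v \<notin> GE_D X2 F2" "v \<notin> GE_D X3 F3" using v joined_D by auto
  then have vx: "v \<noteq> x1" "v \<noteq> x2" "v \<noteq> x3" using x1 x2 x3 by auto
  have A: "\<forall>v\<in>GE_A X1 F1. degree F1 v \<le> 3" "\<forall>v\<in>GE_A X2 F2. degree F2 v \<le> 3" "\<forall>v\<in>GE_A X3 F3. degree F3 v \<le> 3"
    using T1 T2 T3 by (auto simp: calT_def)
  have Dsub: "GE_D X1 F1 \<subseteq> X1" "GE_D X2 F2 \<subseteq> X2" "GE_D X3 F3 \<subseteq> X3" by (auto simp: GE_D_def)
  consider "v \<in> X1" | "v \<in> X2" | "v \<in> X3" using v False by blast
  then show ?thesis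
  proof cases
    case 1
    then have eq: "{u, v} \<in> F \<longleftrightarrow> {u, v} \<in> F1" for u using vx by (intro degree_part) auto
    then have wF: "{w, v} \<in> F1" using w(2) by metis
    then have "w \<in> X1" using graph_edgeD[OF graphs(1)] by metis
    then have "w \<in> GE_D X1 F1" using w(1) Dsub d(1-3) unfolding joined_D by blast
    then have "v \<in> GE_A X1 F1" using 1 vD(1) wF unfolding GE_A_def by blast
    then show ?thesis using A(1) unfolding degree_def eq by metis
  next
    case 2
    then have eq: "{u, v} \<in> F \<longleftrightarrow> {u, v} \<in> F2" for u using vx by (intro degree_part) auto
    then have wF: "{w, v} \<in> F2" using w(2) by metis
    then have "w \<in> X2" using graph_edgeD[OF graphs(2)] by metis
    then have "w \<in> GE_D X2 F2" using w(1) Dsub d(1-3) unfolding joined_D by blast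
    then have "v \<in> GE_A X2 F2" using 2 vD(2) wF unfolding GE_A_def by blast
    then show ?thesis using A(2) unfolding degree_def eq by metis
  next
    case 3
    then have eq: "{u, v} \<in> F \<longleftrightarrow> {u, v} \<in> F3" for u using vx by (intro degree_part) auto
    then have wF: "{w, v} \<in> F3" using w(2) by metis
    then have "w \<in> X3" using graph_edgeD[OF graphs(3)] by metis
    then have "w \<in> GE_D X3 F3" using w(1) Dsub d(1-3) unfolding joined_D by blast
    then have "v \<in> GE_A X3 F3" using 3 vD(3) wF unfolding GE_A_def by blast
    then show ?thesis using A(3) unfolding degree_def eq by metis
  qed
qed

lemma joined_calT: "calT J F"
proof -
  have fin: "finite X1" "finite X2" "finite X3" using graphs by (auto simp: graph_def)
  have "card J = Suc (card (X1 \<union> X2 \<union> X3))" using fin d by simp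
  also have "card (X1 \<union> X2 \<union> X3) = card (X1 \<union> X2) + card X3"
    using fin d by (intro card_Un_disjoint) auto
  also have "card (X1 \<union> X2) = card X1 + card X2" using fin d by (intro card_Un_disjoint) auto
  finally have "card J = Suc (card X1 + card X2 + card X3)" .
  moreover have "3 * k1 + 1 = card X1" "3 * k2 + 1 = card X2" "3 * k3 + 1 = card X3"
    using T1 T2 T3 by (auto simp: calT_def)
  ultimately have "3 * matching_number F + 1 = card J" using joined_number by linarith
  then show ?thesis using joined_tree joined_degrees by (simp add: calT_def)
qed

end

section \<open>Generating the family with ports\<close>

definition ports :: "nat set \<Rightarrow> nat set set \<Rightarrow> nat set" where
  "ports VH EH = {x \<in> VH. degree EH x = 2}"

text \<open>A version of \<open>gen\<close> that records in \<open>P\<close> the vertices of inserted blobs that can still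
  receive an edge, and in which the replaced vertex is reused by the blob.\<close>

inductive pgen :: "nat set \<Rightarrow> nat set \<Rightarrow> nat set \<Rightarrow> nat set set \<Rightarrow> bool" where
  base: "calT V E \<Longrightarrow> pgen (GE_D V E) {} V E"
| step: "pgen R P V E \<Longrightarrow> u \<in> R \<Longrightarrow> (VH, EH) \<in> calB \<Longrightarrow> inj_on f VH \<Longrightarrow> u \<in> f ` VH \<Longrightarrow>
    f ` VH \<inter> (V - {u}) = {} \<Longrightarrow> N = {v \<in> V. {u, v} \<in> E} \<Longrightarrow> inj_on g N \<Longrightarrow> g ` N \<subseteq> ports VH EH \<Longrightarrow>
    P' \<subseteq> P \<union> f ` (ports VH EH - g ` N) \<Longrightarrow> V' = (V - {u}) \<union> f ` VH \<Longrightarrow>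
    E' = {e \<in> E. u \<notin> e} \<union> (\<lambda>e. f ` e) ` EH \<union> {{f (g v), v} | v. v \<in> N} \<Longrightarrow>
    pgen (R - {u}) P' V' E'"

lemma pgen_gen: "pgen R P V E \<Longrightarrow> gen R V E"
proof (induction rule: pgen.induct)
  case (base V E)
  then show ?case by (rule gen.base)
next
  case (step R P V E u VH EH f N g P' V' E')
  have "replace V E u VH EH V' E'"
    unfolding replace_def Let_def
    by (rule exI[of _ f], rule exI[of _ g])
      (use step.hyps in \<open>simp add: ports_def\<close>)
  then show ?case by (rule gen.step[OF step.IH step.hyps(2,3)])
qed

text \<open>The step rule bounds \<open>P'\<close> only from above, so ports can be forgotten at the
  last step.\<close>

lemma pgen_mono: "pgen R P V E \<Longrightarrow> Q \<subseteq> P \<Longrightarrow> pgen R Q V E"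
proof (erule pgen.cases, goal_cases)
  case (1 V E)
  then show ?case using pgen.base by auto
next
  case (2 R P V E u VH EH f N g P' V' E')
  then show ?case using pgen.step[OF 2(6-14) _ 2(16,17), of Q] by auto
qed

lemma calB_edge: "(VH, EH) \<in> calB \<Longrightarrow> e \<in> EH \<Longrightarrow> e \<subseteq> VH"
proof -
  assume "(VH, EH) \<in> calB" and e: "e \<in> EH"
  then obtain es where "(VH, EH) = mk_graph es" unfolding calB_def by (metis imageE)
  then have VH: "VH = fst ` set es \<union> snd ` set es" and EH: "EH = (\<lambda>(a, b). {a, b}) ` set es"
    by (simp_all add: mk_graph_def)
  obtain a b where ab: "(a, b) \<in> set es" "e = {a, b}" using e unfolding EH by auto
  have "a \<in> fst ` set es" "b \<in> snd ` set es"
    using imageI[OF ab(1), of fst] imageI[OF ab(1), of snd] by simp_all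
  then show ?thesis using ab(2) VH by simp
qed

lemma pgen_invariants:
  "pgen R P V E \<Longrightarrow> R \<subseteq> V \<and> P \<subseteq> V \<and> R \<inter> P = {} \<and> (\<forall>e\<in>E. e \<subseteq> V)"
proof (induction rule: pgen.induct)
  case (base V E)
  then have "graph V E" by (simp add: calT_def tree_def)
  then have "\<forall>e\<in>E. e \<subseteq> V" unfolding graph_def by fastforce
  then show ?case by (auto simp: GE_D_def)
next
  case (step R P V E u VH EH f N g P' V' E')
  have sub: "ports VH EH \<subseteq> VH" by (auto simp: ports_def)
  have RV: "R \<subseteq> V" and PV: "P \<subseteq> V" and RP: "R \<inter> P = {}" and EV: "\<And>e. e \<in> E \<Longrightarrow> e \<subseteq> V"
    using step.IH by auto
  have VV': "V \<subseteq> V'" "f ` VH \<subseteq> V'" using step.hyps(5,11) by auto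
  have "R - {u} \<subseteq> V'" using RV VV' by blast
  moreover have "P' \<subseteq> V'"
  proof -
    have "f ` (ports VH EH - g ` N) \<subseteq> V'" using sub VV'(2) by blast
    moreover have "P \<subseteq> V'" using PV VV'(1) by blast
    ultimately show ?thesis using step.hyps(10) by blast
  qed
  moreover have "(R - {u}) \<inter> P' = {}"
  proof -
    have "R - {u} \<subseteq> V - {u}" using RV by blast
    moreover have "f ` (ports VH EH - g ` N) \<subseteq> f ` VH" using sub by blast
    ultimately have "(R - {u}) \<inter> f ` (ports VH EH - g ` N) = {}" using step.hyps(6) by blast
    then show ?thesis using RP step.hyps(10) by (meson Diff_subset Int_Un_distrib disjoint_iff subsetD UnE)
  qed
  moreover have "e \<subseteq> V'" if eE: "e \<in> E'" for e
  proof -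
    have nb: "f (g v) \<in> V'" "v \<in> V'" if "v \<in> N" for v
    proof -
      have "g v \<in> VH" using that step.hyps(9) sub by blast
      then show "f (g v) \<in> V'" using step.hyps(11) by blast
      have "v \<in> V" "{u, v} \<in> E" using that step.hyps(7) by auto
      then show "v \<in> V'" using step.hyps(5,11) by (cases "v = u") auto
    qed
    have fe: "f ` e \<subseteq> V'" if "e \<in> EH" for e
      using calB_edge[OF step.hyps(3) that] step.hyps(11) by blast
    have ee: "e \<subseteq> V'" if "e \<in> E" "u \<notin> e" for e
      using EV[OF that(1)] VV'(1) by blast
    consider "e \<in> E" "u \<notin> e" | e0 where "e0 \<in> EH" "e = f ` e0" | v where "v \<in> N" "e = {f (g v), v}"
      using eE unfolding step.hyps(12) by blast
    then show ?thesis using ee fe nb by cases simp_all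
  qed
  ultimately show ?case by blast
qed

text \<open>Pushes the attachment of \<open>y\<close> and \<open>W\<close> back through the
  replacements to the host tree, where \<open>base\<close> handles it, and then replays the
  replacements. The edge at \<open>y\<close> ends in an unreplaced vertex of D or in a free port,
  and a port that is used is withdrawn from \<open>Q\<close>.\<close>

lemma pgen_attach:
  assumes "pgen R P X F" "X \<inter> insert y W = {}" "x \<in> R \<union> P" "Q \<subseteq> (P - {x}) \<union> P0"
    and base: "\<And>X F x. calT X F \<Longrightarrow> X \<inter> insert y W = {} \<Longrightarrow> x \<in> GE_D X F \<Longrightarrow>
      pgen (GE_D X F \<union> R0) P0 (insert y (X \<union> W)) (F \<union> G \<union> {{y, x}})"
    and G: "\<And>e. e \<in> G \<Longrightarrow> e \<subseteq> insert y W" and R0: "R0 \<subseteq> insert y W"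
  shows "pgen (R \<union> R0) Q (insert y (X \<union> W)) (F \<union> G \<union> {{y, x}})"
  using assms(1-4)
proof (induction arbitrary: x Q rule: pgen.induct)
  case (base V E)
  then show ?case using assms(5)[of V E x] pgen_mono by auto
next
  case (step R P V E u VH EH f N g P' V' E')
  note inv = pgen_invariants[OF step.hyps(1)]
  have uV: "u \<in> V" using inv step.hyps(2) by blast
  \<comment> \<open>Since the blob reuses \<open>u\<close>, the vertex set only grows, and
    disjointness from \<open>y\<close> and \<open>W\<close> passes to the earlier stage.\<close>
  have VV': "V \<subseteq> V'" using step.hyps(5,11) by auto
  then have dV: "V \<inter> insert y W = {}" using step.prems(1) by blast
  have yV': "y \<notin> V'" "u \<noteq> y" "u \<notin> W" "y \<notin> V" using step.prems(1) dV uV by auto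
  have fW: "f ` VH \<inter> insert y W = {}" using step.prems(1) step.hyps(11) by blast
  have uG: "u \<notin> e" if "e \<in> G" for e using G[OF that] yV' by blast
  have EV: "e \<subseteq> V" if "e \<in> E" for e using inv that by blast
  have Req: "(R - {u}) \<union> R0 = (R \<union> R0) - {u}" using R0 yV' by blast
  have IH: "pgen (R \<union> R0) Q (insert y (V \<union> W)) (E \<union> G \<union> {{y, x}})"
    if "x \<in> R \<union> P" "Q \<subseteq> P - {x} \<union> P0" for x Q
    using step.IH[OF dV that] .
  have fd: "f ` VH \<inter> (insert y (V \<union> W) - {u}) = {}" using step.hyps(6) fW by blast
  have Veq: "insert y (V' \<union> W) = (insert y (V \<union> W) - {u}) \<union> f ` VH"
    using step.hyps(11) yV' by blast
  have RV: "R \<subseteq> V" and PV: "P \<subseteq> V" and uP: "u \<notin> P" using inv step.hyps(2) by auto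
  have "x \<in> R - {u} \<or> x \<in> P \<or> x \<in> f ` (ports VH EH - g ` N)"
    using step.prems(2) step.hyps(10) by blast
  then consider (new) k where "x = f k" "k \<in> ports VH EH" "k \<notin> g ` N" | (old) "x \<in> V - {u}" "x \<in> R \<union> P"
    using RV PV uP by blast
  then show ?case
  proof cases
    \<comment> \<open>Here \<open>x\<close> belongs to the blob inserted last. In the earlier stage
      \<open>y\<close> is attached to \<open>u\<close> instead, and the blob then receives
      \<open>y\<close> as an additional neighbour at its port \<open>k\<close>.\<close>
    case new
    define g' where "g' = g(y := k)"
    have yN: "y \<notin> N" using step.hyps(7) yV' by blast
    have N': "insert y N = {v \<in> insert y (V \<union> W). {u, v} \<in> E \<union> G \<union> {{y, u}}}"
    proof -
      have "{u, v} \<in> E \<union> G \<union> {{y, u}} \<longleftrightarrow> {u, v} \<in> E \<or> v = y" for v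
        using uG[of "{u, v}"] yV' by (auto simp: doubleton_eq_iff)
      moreover have "{u, v} \<in> E \<Longrightarrow> v \<in> V" for v using EV[of "{u, v}"] by auto
      ultimately show ?thesis unfolding step.hyps(7) by blast
    qed
    have gg: "g' y = k" "\<And>v. v \<in> N \<Longrightarrow> g' v = g v" using yN by (auto simp: g'_def)
    have g'N: "g' ` insert y N = insert k (g ` N)" using gg by auto
    have "g' ` N = g ` N" by (rule image_cong[OF refl gg(2)])
    moreover have "inj_on g' N" using step.hyps(8) inj_on_cong[of N g' g] gg(2) by simp
    ultimately have inj: "inj_on g' (insert y N)" using gg(1) new(3) yN by simp
    have "pgen ((R \<union> R0) - {u}) Q (insert y (V' \<union> W)) (E' \<union> G \<union> {{y, x}})"
    proof (rule pgen.step[OF IH[of u "P \<union> P0"] _ step.hyps(3-5) fd N' inj _ _ Veq])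
      show "u \<in> R \<union> P" "u \<in> R \<union> R0" using step.hyps(2) by auto
      show "P \<union> P0 \<subseteq> P - {u} \<union> P0" using uP by blast
      show "g' ` insert y N \<subseteq> ports VH EH" unfolding g'N using step.hyps(9) new by blast
      show "Q \<subseteq> P \<union> P0 \<union> f ` (ports VH EH - g' ` insert y N)"
        unfolding g'N using step.prems(3) step.hyps(10) new(1) by blast
      have "{{f (g' v), v} |v. v \<in> insert y N} = {{f (g v), v} |v. v \<in> N} \<union> {{y, x}}"
      proof -
        have "{{f (g' v), v} |v. v \<in> insert y N} = (\<lambda>v. {f (g' v), v}) ` insert y N" by blast
        also have "\<dots> = insert {x, y} ((\<lambda>v. {f (g v), v}) ` N)" using gg new(1) by auto
        also have "\<dots> = {{f (g v), v} |v. v \<in> N} \<union> {{y, x}}" by (auto simp: insert_commute)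
        finally show ?thesis .
      qed
      moreover have "{e \<in> E \<union> G \<union> {{y, u}}. u \<notin> e} = {e \<in> E. u \<notin> e} \<union> G" using uG by auto
      ultimately show "E' \<union> G \<union> {{y, x}} = {e \<in> E \<union> G \<union> {{y, u}}. u \<notin> e} \<union> (\<lambda>e. f ` e) ` EH
          \<union> {{f (g' v), v} |v. v \<in> insert y N}"
        unfolding step.hyps(12) by (simp only: Un_ac)
    qed
    then show ?thesis unfolding Req .
  next
    \<comment> \<open>Here \<open>x\<close> was present before and differs from \<open>u\<close>, so
      the new edge does not affect the replacement of \<open>u\<close>.\<close>
    case old
    have N': "N = {v \<in> insert y (V \<union> W). {u, v} \<in> E \<union> G \<union> {{y, x}}}"
    proof -
      have "{u, v} \<in> E \<union> G \<union> {{y, x}} \<longleftrightarrow> {u, v} \<in> E" for v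
        using uG[of "{u, v}"] yV' old by (auto simp: doubleton_eq_iff)
      moreover have "{u, v} \<in> E \<Longrightarrow> v \<in> V" for v using EV[of "{u, v}"] by auto
      ultimately show ?thesis unfolding step.hyps(7) by blast
    qed
    have "pgen ((R \<union> R0) - {u}) Q (insert y (V' \<union> W)) (E' \<union> G \<union> {{y, x}})"
    proof (rule pgen.step[OF IH[of x "P - {x} \<union> P0"] _ step.hyps(3-5) fd N' step.hyps(8,9) _ Veq])
      show "x \<in> R \<union> P" "u \<in> R \<union> R0" using old step.hyps(2) by auto
      show "P - {x} \<union> P0 \<subseteq> P - {x} \<union> P0" by simp
      show "Q \<subseteq> P - {x} \<union> P0 \<union> f ` (ports VH EH - g ` N)"
        using step.prems(3) step.hyps(10) by blast
      have "{e \<in> E \<union> G \<union> {{y, x}}. u \<notin> e} = {e \<in> E. u \<notin> e} \<union> G \<union> {{y, x}}"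
        using uG yV' old by auto
      then show "E' \<union> G \<union> {{y, x}} = {e \<in> E \<union> G \<union> {{y, x}}. u \<notin> e} \<union> (\<lambda>e. f ` e) ` EH
          \<union> {{f (g v), v} |v. v \<in> N}"
        unfolding step.hyps(12) by (simp only: Un_ac)
    qed
    then show ?thesis unfolding Req .
  qed
qed

text \<open>The three host trees are exchanged for generated graphs one at a time. Each use of
  \<open>pgen_attach\<close> takes the previous statement as its base, and the first one rests on
  \<open>joined_calT\<close>.\<close>

lemma pgen_join:
  assumes p: "pgen R1 P1 X1 F1" "pgen R2 P2 X2 F2" "pgen R3 P3 X3 F3"
    and d: "X1 \<inter> X2 = {}" "X1 \<inter> X3 = {}" "X2 \<inter> X3 = {}" "y \<notin> X1" "y \<notin> X2" "y \<notin> X3"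
    and x: "x1 \<in> R1 \<union> P1" "x2 \<in> R2 \<union> P2" "x3 \<in> R3 \<union> P3"
  shows "pgen (R1 \<union> R2 \<union> R3) ((P1 - {x1}) \<union> (P2 - {x2}) \<union> (P3 - {x3})) (insert y (X1 \<union> X2 \<union> X3))
    (F1 \<union> F2 \<union> F3 \<union> {{y, x1}, {y, x2}, {y, x3}})"
proof -
  have inv: "R1 \<subseteq> X1" "P1 \<subseteq> X1" "\<And>e. e \<in> F1 \<Longrightarrow> e \<subseteq> X1" "R2 \<subseteq> X2" "P2 \<subseteq> X2" "\<And>e. e \<in> F2 \<Longrightarrow> e \<subseteq> X2"
    using pgen_invariants[OF p(1)] pgen_invariants[OF p(2)] by auto
  have x12: "x1 \<in> X1" "x2 \<in> X2" using inv x by auto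
  have DX: "GE_D X F \<subseteq> X" for X :: "nat set" and F by (auto simp: GE_D_def)
  have eX: "e \<subseteq> X" if "calT X F" "e \<in> F" for X :: "nat set" and F e
    using that unfolding calT_def tree_def graph_def by fastforce
  have one: "pgen (R1 \<union> (GE_D X2 F2 \<union> GE_D X3 F3)) (P1 - {x1}) (insert y (X1 \<union> (X2 \<union> X3)))
      (F1 \<union> (F2 \<union> F3 \<union> {{y, x2}, {y, x3}}) \<union> {{y, x1}})"
    if T: "calT X2 F2" "calT X3 F3" and x: "x2 \<in> GE_D X2 F2" "x3 \<in> GE_D X3 F3"
      and d: "X1 \<inter> X2 = {}" "X1 \<inter> X3 = {}" "X2 \<inter> X3 = {}" "y \<notin> X2" "y \<notin> X3" for X2 X3 F2 F3 x2 x3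
  proof (rule pgen_attach[OF p(1) _ \<open>x1 \<in> R1 \<union> P1\<close>, where ?P0.0 = "{}"])
    show "X1 \<inter> insert y (X2 \<union> X3) = {}" using d \<open>y \<notin> X1\<close> by auto
    show "e \<subseteq> insert y (X2 \<union> X3)" if "e \<in> F2 \<union> F3 \<union> {{y, x2}, {y, x3}}" for e
      using that eX[OF T(1), of e] eX[OF T(2), of e] x DX by blast
    show "GE_D X2 F2 \<union> GE_D X3 F3 \<subseteq> insert y (X2 \<union> X3)" using DX by blast
    fix X1 F1 x1 assume T1: "calT X1 F1" "X1 \<inter> insert y (X2 \<union> X3) = {}" "x1 \<in> GE_D X1 F1"
    interpret three_trees X1 X2 X3 F1 F2 F3 y x1 x2 x3
      by unfold_locales (use T T1 d x in auto)
    have "pgen (GE_D X1 F1 \<union> GE_D X2 F2 \<union> GE_D X3 F3) {} (insert y (X1 \<union> X2 \<union> X3))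
        (F1 \<union> F2 \<union> F3 \<union> {{y, x1}, {y, x2}, {y, x3}})"
      using pgen.base[OF joined_calT] unfolding joined_D .
    moreover have "F1 \<union> F2 \<union> F3 \<union> {{y, x1}, {y, x2}, {y, x3}} = F1 \<union> (F2 \<union> F3 \<union> {{y, x2}, {y, x3}}) \<union> {{y, x1}}"
      by auto
    ultimately show "pgen (GE_D X1 F1 \<union> (GE_D X2 F2 \<union> GE_D X3 F3)) {} (insert y (X1 \<union> (X2 \<union> X3)))
        (F1 \<union> (F2 \<union> F3 \<union> {{y, x2}, {y, x3}}) \<union> {{y, x1}})"
      by (simp only: Un_assoc)
  qed simp
  have two: "pgen (R2 \<union> (R1 \<union> GE_D X3 F3)) ((P2 - {x2}) \<union> (P1 - {x1})) (insert y (X2 \<union> (X1 \<union> X3)))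
      (F2 \<union> (F1 \<union> F3 \<union> {{y, x1}, {y, x3}}) \<union> {{y, x2}})"
    if T: "calT X3 F3" and x3: "x3 \<in> GE_D X3 F3"
      and d3: "X1 \<inter> X3 = {}" "X2 \<inter> X3 = {}" "y \<notin> X3" for X3 F3 x3
  proof (rule pgen_attach[OF p(2) _ \<open>x2 \<in> R2 \<union> P2\<close>, where ?P0.0 = "P1 - {x1}"])
    show "X2 \<inter> insert y (X1 \<union> X3) = {}" using d d3 by auto
    show "e \<subseteq> insert y (X1 \<union> X3)" if "e \<in> F1 \<union> F3 \<union> {{y, x1}, {y, x3}}" for e
      using that eX[OF T, of e] inv(3)[of e] x3 DX x12 by blast
    show "R1 \<union> GE_D X3 F3 \<subseteq> insert y (X1 \<union> X3)" using DX inv by blast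
    fix X2 F2 x2 assume T2: "calT X2 F2" "X2 \<inter> insert y (X1 \<union> X3) = {}" "x2 \<in> GE_D X2 F2"
    have "pgen (R1 \<union> (GE_D X2 F2 \<union> GE_D X3 F3)) (P1 - {x1}) (insert y (X1 \<union> (X2 \<union> X3)))
      (F1 \<union> (F2 \<union> F3 \<union> {{y, x2}, {y, x3}}) \<union> {{y, x1}})"
      by (rule one) (use T T2 x3 d d3 in auto)
    moreover have "F1 \<union> (F2 \<union> F3 \<union> {{y, x2}, {y, x3}}) \<union> {{y, x1}} = F2 \<union> (F1 \<union> F3 \<union> {{y, x1}, {y, x3}}) \<union> {{y, x2}}"
      "R1 \<union> (GE_D X2 F2 \<union> GE_D X3 F3) = GE_D X2 F2 \<union> (R1 \<union> GE_D X3 F3)" "X1 \<union> (X2 \<union> X3) = X2 \<union> (X1 \<union> X3)"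
      by auto
    ultimately show "pgen (GE_D X2 F2 \<union> (R1 \<union> GE_D X3 F3)) (P1 - {x1}) (insert y (X2 \<union> (X1 \<union> X3)))
        (F2 \<union> (F1 \<union> F3 \<union> {{y, x1}, {y, x3}}) \<union> {{y, x2}})"
      by (simp only:)
  qed simp
  have "pgen (R3 \<union> (R1 \<union> R2)) ((P3 - {x3}) \<union> ((P2 - {x2}) \<union> (P1 - {x1}))) (insert y (X3 \<union> (X1 \<union> X2)))
      (F3 \<union> (F1 \<union> F2 \<union> {{y, x1}, {y, x2}}) \<union> {{y, x3}})"
  proof (rule pgen_attach[OF p(3) _ \<open>x3 \<in> R3 \<union> P3\<close>, where ?P0.0 = "(P2 - {x2}) \<union> (P1 - {x1})"])
    show "X3 \<inter> insert y (X1 \<union> X2) = {}" using d by auto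
    show "e \<subseteq> insert y (X1 \<union> X2)" if "e \<in> F1 \<union> F2 \<union> {{y, x1}, {y, x2}}" for e
      using that inv(3)[of e] inv(6)[of e] x12 by blast
    show "R1 \<union> R2 \<subseteq> insert y (X1 \<union> X2)" using inv by blast
    fix X3 F3 x3 assume T3: "calT X3 F3" "X3 \<inter> insert y (X1 \<union> X2) = {}" "x3 \<in> GE_D X3 F3"
    have "pgen (R2 \<union> (R1 \<union> GE_D X3 F3)) ((P2 - {x2}) \<union> (P1 - {x1})) (insert y (X2 \<union> (X1 \<union> X3)))
      (F2 \<union> (F1 \<union> F3 \<union> {{y, x1}, {y, x3}}) \<union> {{y, x2}})"
      by (rule two) (use T3 d in auto)
    moreover have "F2 \<union> (F1 \<union> F3 \<union> {{y, x1}, {y, x3}}) \<union> {{y, x2}} = F3 \<union> (F1 \<union> F2 \<union> {{y, x1}, {y, x2}}) \<union> {{y, x3}}"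
      "R2 \<union> (R1 \<union> GE_D X3 F3) = GE_D X3 F3 \<union> (R1 \<union> R2)" "X2 \<union> (X1 \<union> X3) = X3 \<union> (X1 \<union> X2)"
      by auto
    ultimately show "pgen (GE_D X3 F3 \<union> (R1 \<union> R2)) ((P2 - {x2}) \<union> (P1 - {x1})) (insert y (X3 \<union> (X1 \<union> X2)))
        (F3 \<union> (F1 \<union> F2 \<union> {{y, x1}, {y, x2}}) \<union> {{y, x3}})"
      by (simp only:)
  qed simp
  moreover have "F3 \<union> (F1 \<union> F2 \<union> {{y, x1}, {y, x2}}) \<union> {{y, x3}} = F1 \<union> F2 \<union> F3 \<union> {{y, x1}, {y, x2}, {y, x3}}"
    "R3 \<union> (R1 \<union> R2) = R1 \<union> R2 \<union> R3" "X3 \<union> (X1 \<union> X2) = X1 \<union> X2 \<union> X3"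
    "(P3 - {x3}) \<union> ((P2 - {x2}) \<union> (P1 - {x1})) = (P1 - {x1}) \<union> (P2 - {x2}) \<union> (P3 - {x3})"
    by auto
  ultimately show ?thesis by (simp only:)
qed

lemma calB_blobs: "(es, m, ds) \<in> set blobs \<Longrightarrow> mk_graph es \<in> calB"
proof -
  assume "(es, m, ds) \<in> set blobs"
  then have "es \<in> fst ` set blobs" by force
  then have "es \<in> set [G1_edges, G2_edges, G3_edges, G4_edges, G5_edges, G6_edges, G7_edges, G8_edges, G9_edges]"
    by (simp add: blobs_def)
  then show ?thesis unfolding calB_def by blast
qed

lemma degree_mk_graph: "degree (snd (mk_graph es)) x = card {y. ladj es x y}"
  unfolding degree_def snd_mk_graph by (rule arg_cong[where f = card]) (auto simp: ladj_iff)

section \<open>The theorem\<close>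

context subcubic
begin

text \<open>\<open>calG\<close> consists of graphs on natural numbers, so everything is transported
  along an injection; \<open>h\<close> places the labelled blob there.\<close>

lemma realizes_image:
  assumes r: "realizes es f X" and X: "X \<subseteq> V" and \<phi>: "inj_on \<phi> V"
  defines "h \<equiv> \<lambda>k. \<phi> (inv_into X f k)"
  shows "\<And>x. x \<in> X \<Longrightarrow> h (f x) = \<phi> x" and "inj_on h (verts es)" and "h ` verts es = \<phi> ` X"
    and "(\<lambda>e. h ` e) ` snd (mk_graph es) = (\<lambda>e. \<phi> ` e) ` induced_edges E X"
proof -
  have inj: "inj_on f X" and img: "f ` X = verts es"
    and a: "\<And>u v. u \<in> X \<Longrightarrow> v \<in> X \<Longrightarrow> adj u v \<longleftrightarrow> ladj es (f u) (f v)"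
    using r by (auto simp: realizes_def bij_betw_def)
  show hf: "h (f x) = \<phi> x" if "x \<in> X" for x using inj that by (simp add: h_def)
  have \<phi>X: "inj_on \<phi> X" using \<phi> X inj_on_subset by blast
  show "inj_on h (verts es)"
  proof (rule inj_onI)
    fix k l assume "k \<in> verts es" "l \<in> verts es" "h k = h l"
    then obtain u v where "u \<in> X" "v \<in> X" "k = f u" "l = f v" using img by (metis imageE)
    then show "k = l" using \<open>h k = h l\<close> hf \<phi>X by (metis inj_onD)
  qed
  have "h ` f ` X = \<phi> ` X" unfolding image_image by (rule image_cong[OF refl hf])
  then show "h ` verts es = \<phi> ` X" using img by simp
  show "(\<lambda>e. h ` e) ` snd (mk_graph es) = (\<lambda>e. \<phi> ` e) ` induced_edges E X"
  proof (intro equalityI subsetI)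
    fix e assume "e \<in> (\<lambda>e. h ` e) ` snd (mk_graph es)"
    then obtain e0 where e0: "e0 \<in> snd (mk_graph es)" "e = h ` e0" by blast
    then obtain k l where kl: "(k, l) \<in> set es" "e0 = {k, l}" by (auto simp: mk_graph_def)
    then have l: "ladj es k l" by (simp add: ladj_iff)
    then obtain u v where uv: "u \<in> X" "v \<in> X" "k = f u" "l = f v" using ladj_verts img by (metis imageE)
    then have "{u, v} \<in> induced_edges E X" using a l by (simp add: induced_edges_def)
    moreover have "e = \<phi> ` {u, v}" using e0 kl uv hf by simp
    ultimately show "e \<in> (\<lambda>e. \<phi> ` e) ` induced_edges E X" by blast
  next
    fix e assume "e \<in> (\<lambda>e. \<phi> ` e) ` induced_edges E X"
    then obtain e0 where e0: "e0 \<in> E" "e0 \<subseteq> X" "e = \<phi> ` e0" by (auto simp: induced_edges_def)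
    then obtain u v where uv: "e0 = {u, v}" using edge_card by (metis card_2_iff)
    then have "ladj es (f u) (f v)" using a e0 by auto
    then have "{f u, f v} \<in> snd (mk_graph es)" by (simp add: snd_mk_graph)
    moreover have "e = h ` {f u, f v}" using e0 uv hf by auto
    ultimately show "e \<in> (\<lambda>e. h ` e) ` snd (mk_graph es)" by blast
  qed
qed

lemma induced_join:
  assumes j: "joined y X1 X2 X3"
    and x: "\<And>w. w \<in> X1 \<Longrightarrow> adj y w \<longleftrightarrow> w = x1" "\<And>w. w \<in> X2 \<Longrightarrow> adj y w \<longleftrightarrow> w = x2"
      "\<And>w. w \<in> X3 \<Longrightarrow> adj y w \<longleftrightarrow> w = x3" "x1 \<in> X1" "x2 \<in> X2" "x3 \<in> X3"
  shows "induced_edges E (insert y (X1 \<union> X2 \<union> X3)) =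
    induced_edges E X1 \<union> induced_edges E X2 \<union> induced_edges E X3 \<union> {{y, x1}, {y, x2}, {y, x3}}"
proof (intro equalityI subsetI)
  have no: "\<not> adj u v" if "u \<in> X1 \<and> v \<in> X2 \<or> u \<in> X1 \<and> v \<in> X3 \<or> u \<in> X2 \<and> v \<in> X3" for u v
    using j that unfolding joined_def ecount_eq_0 by blast
  have yw: "w = x1 \<or> w = x2 \<or> w = x3" if "adj y w" "w \<in> X1 \<union> X2 \<union> X3" for w
    using that x(1-3)[of w] by blast
  fix e assume "e \<in> induced_edges E (insert y (X1 \<union> X2 \<union> X3))"
  then have e: "e \<in> E" "e \<subseteq> insert y (X1 \<union> X2 \<union> X3)" by (auto simp: induced_edges_def)
  then obtain u v where uv: "e = {u, v}" using edge_card by (metis card_2_iff)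
  then have a: "adj u v" "adj v u" using e by (auto simp: insert_commute)
  consider "u = y" | "v = y" | "u \<noteq> y" "v \<noteq> y" by blast
  then show "e \<in> induced_edges E X1 \<union> induced_edges E X2 \<union> induced_edges E X3 \<union> {{y, x1}, {y, x2}, {y, x3}}"
  proof cases
    case 1
    then have "v \<in> X1 \<union> X2 \<union> X3" using e uv a by auto
    then show ?thesis using yw[of v] 1 a uv by auto
  next
    case 2
    then have "u \<in> X1 \<union> X2 \<union> X3" using e uv a by auto
    then show ?thesis using yw[of u] 2 a uv by (auto simp: insert_commute)
  next
    case 3
    then have uvX: "u \<in> X1 \<union> X2 \<union> X3" "v \<in> X1 \<union> X2 \<union> X3" using e uv by auto
    then have "u \<in> X1 \<and> v \<in> X1 \<or> u \<in> X2 \<and> v \<in> X2 \<or> u \<in> X3 \<and> v \<in> X3"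
      using no[of u v] no[of v u] a by blast
    then show ?thesis using e(1) uv by (auto simp: induced_edges_def)
  qed
next
  have "adj y x1" "adj y x2" "adj y x3" using x by auto
  then show "e \<in> induced_edges E (insert y (X1 \<union> X2 \<union> X3))"
    if "e \<in> induced_edges E X1 \<union> induced_edges E X2 \<union> induced_edges E X3 \<union> {{y, x1}, {y, x2}, {y, x3}}" for e
    using that x(4-6) by (auto simp: induced_edges_def)
qed

text \<open>The two claims about degrees carry the induction. A vertex that can still get a join
  edge has degree below 3 in its part, so it must be an unreplaced vertex of D or a free port. A
  port already has degree 2, so it has degree 3 once it is used.\<close>

lemma calH_pgen:
  assumes "calH X" "X \<subseteq> V" and \<phi>: "inj_on \<phi> V"
  shows "\<exists>R P. pgen R P (\<phi> ` X) ((\<lambda>e. \<phi> ` e) ` induced_edges E X)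
    \<and> (\<forall>x\<in>X. \<phi> x \<in> R \<union> P \<or> 3 \<le> ecount {x} X) \<and> (\<forall>x\<in>X. \<phi> x \<in> P \<longrightarrow> 2 \<le> ecount {x} X)"
  using assms(1,2)
proof (induction rule: calH.induct)
  case (single x)
  have "induced_edges E {x} = {}"
  proof -
    have "e \<notin> E" if "e \<subseteq> {x}" for e
      using that edge_card[of e] card_mono[of "{x}" e] by fastforce
    then show ?thesis by (auto simp: induced_edges_def)
  qed
  moreover have "pgen {\<phi> x} {} {\<phi> x} {}" using pgen.base[OF calT_single(1)[of "\<phi> x"]] calT_single(2)[of "\<phi> x"] by simp
  ultimately have "pgen {\<phi> x} {} (\<phi> ` {x}) ((\<lambda>e. \<phi> ` e) ` induced_edges E {x})" by simp
  then show ?case by (intro exI[of _ "{\<phi> x}"] exI[of _ "{}"]) simp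
next
  case (blob X)
  obtain es m ds f where b: "(es, m, ds) \<in> set blobs" "realizes es f X" 
    "\<And>v. v \<in> X \<Longrightarrow> ecount {v} X = (if f v \<in> set ds then 2 else 3)"
    using bblobE[OF blob(1)] by metis
  define h where "h = (\<lambda>k. \<phi> (inv_into X f k))"
  note hi = realizes_image[OF b(2) blob(2) \<phi>, folded h_def]
  obtain x0 where x0: "x0 \<in> X" using bblob_nonempty[OF blob(1)] by blast
  let ?VH = "fst (mk_graph es)" and ?EH = "snd (mk_graph es)"
  let ?P = "h ` ports ?VH ?EH"
  have hV: "h ` ?VH = \<phi> ` X" using hi(3) by (simp add: fst_mk_graph)
  have b0: "pgen {\<phi> x0} {} {\<phi> x0} {}"
    using pgen.base[OF calT_single(1)[of "\<phi> x0"]] calT_single(2)[of "\<phi> x0"] by simp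
  \<comment> \<open>The host tree is a single vertex, which is replaced by the blob; all ports stay
    free.\<close>
  have "pgen ({\<phi> x0} - {\<phi> x0}) ?P (\<phi> ` X) ((\<lambda>e. \<phi> ` e) ` induced_edges E X)"
  proof (rule pgen.step[OF b0, where f = h and N = "{}" and g = id and VH = ?VH and EH = ?EH])
    show "(?VH, ?EH) \<in> calB" using calB_blobs[OF b(1)] by simp
    show "inj_on h ?VH" using hi(2) by (simp add: fst_mk_graph)
    show "\<phi> x0 \<in> h ` ?VH" using hV x0 by simp
    show "\<phi> ` X = {\<phi> x0} - {\<phi> x0} \<union> h ` ?VH" using hV by simp
    show "(\<lambda>e. \<phi> ` e) ` induced_edges E X = {e \<in> {}. \<phi> x0 \<notin> e} \<union> (\<lambda>e. h ` e) ` ?EH \<union> {{h (id v), v} |v. v \<in> {}}"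
      using hi(4) by simp
  qed auto
  then have p: "pgen {} ?P (\<phi> ` X) ((\<lambda>e. \<phi> ` e) ` induced_edges E X)" by simp
  have deg: "f x \<in> ports ?VH ?EH \<longleftrightarrow> f x \<in> set ds" if "x \<in> X" for x
  proof -
    have "f x \<in> verts es" using b(2) that by (auto simp: realizes_def bij_betw_def)
    then show ?thesis
      using blobs_facts(2)[OF b(1)] by (simp add: ports_def fst_mk_graph degree_mk_graph)
  qed
  have "\<phi> x \<in> ?P \<or> 3 \<le> ecount {x} X" if "x \<in> X" for x
  proof (cases "f x \<in> set ds")
    case True
    then have "h (f x) \<in> ?P" using deg that by blast
    moreover have "h (f x) = \<phi> x" using hi(1)[OF that] by (simp add: h_def)
    ultimately show ?thesis by simp
  qed (use b(3) that in simp)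
  moreover have "2 \<le> ecount {x} X" if "x \<in> X" for x using b(3)[OF that] by simp
  ultimately show ?case using p by (intro exI[of _ "{}"] exI[of _ ?P]) simp
next
  case (join X1 X2 X3 y)
  have sub: "X1 \<subseteq> V" "X2 \<subseteq> V" "X3 \<subseteq> V" "y \<in> V" using join.prems by auto
  obtain R1 P1 where 1: "pgen R1 P1 (\<phi> ` X1) ((\<lambda>e. \<phi> ` e) ` induced_edges E X1)"
    "\<And>x. x \<in> X1 \<Longrightarrow> \<phi> x \<in> R1 \<union> P1 \<or> 3 \<le> ecount {x} X1" "\<And>x. x \<in> X1 \<Longrightarrow> \<phi> x \<in> P1 \<Longrightarrow> 2 \<le> ecount {x} X1"
    using join.IH(1)[OF sub(1)] by metis
  obtain R2 P2 where 2: "pgen R2 P2 (\<phi> ` X2) ((\<lambda>e. \<phi> ` e) ` induced_edges E X2)"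
    "\<And>x. x \<in> X2 \<Longrightarrow> \<phi> x \<in> R2 \<union> P2 \<or> 3 \<le> ecount {x} X2" "\<And>x. x \<in> X2 \<Longrightarrow> \<phi> x \<in> P2 \<Longrightarrow> 2 \<le> ecount {x} X2"
    using join.IH(2)[OF sub(2)] by metis
  obtain R3 P3 where 3: "pgen R3 P3 (\<phi> ` X3) ((\<lambda>e. \<phi> ` e) ` induced_edges E X3)"
    "\<And>x. x \<in> X3 \<Longrightarrow> \<phi> x \<in> R3 \<union> P3 \<or> 3 \<le> ecount {x} X3" "\<And>x. x \<in> X3 \<Longrightarrow> \<phi> x \<in> P3 \<Longrightarrow> 2 \<le> ecount {x} X3"
    using join.IH(3)[OF sub(3)] by metis
  note j = join.hyps(4)
  have dj: "X1 \<inter> X2 = {}" "X1 \<inter> X3 = {}" "X2 \<inter> X3 = {}" "y \<notin> X1" "y \<notin> X2" "y \<notin> X3"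
    and ey: "ecount {y} X1 = 1" "ecount {y} X2 = 1" "ecount {y} X3 = 1"
    using j by (auto simp: joined_def)
  obtain x1 where x1: "x1 \<in> X1" "\<And>w. w \<in> X1 \<Longrightarrow> adj y w \<longleftrightarrow> w = x1" using ecount_1E[OF ey(1)] by metis
  obtain x2 where x2: "x2 \<in> X2" "\<And>w. w \<in> X2 \<Longrightarrow> adj y w \<longleftrightarrow> w = x2" using ecount_1E[OF ey(2)] by metis
  obtain x3 where x3: "x3 \<in> X3" "\<And>w. w \<in> X3 \<Longrightarrow> adj y w \<longleftrightarrow> w = x3" using ecount_1E[OF ey(3)] by metis
  have yx: "adj x1 y" "adj x2 y" "adj x3 y" using x1 x2 x3 by (auto simp: insert_commute[of _ y])
  have "ecount {x1} X1 \<le> 2" "ecount {x2} X2 \<le> 2" "ecount {x3} X3 \<le> 2"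
    using ecount_single_less[OF dj(4) yx(1)] ecount_single_less[OF dj(5) yx(2)] ecount_single_less[OF dj(6) yx(3)] .
  then have xp: "\<phi> x1 \<in> R1 \<union> P1" "\<phi> x2 \<in> R2 \<union> P2" "\<phi> x3 \<in> R3 \<union> P3"
    using 1(2)[OF x1(1)] 2(2)[OF x2(1)] 3(2)[OF x3(1)] by linarith+
  have \<phi>eq: "\<phi> u = \<phi> v \<longleftrightarrow> u = v" if "u \<in> V" "v \<in> V" for u v using \<phi> that by (auto dest: inj_onD)
  have dis: "\<phi> ` A \<inter> \<phi> ` B = {}" if "A \<subseteq> V" "B \<subseteq> V" "A \<inter> B = {}" for A B
    using inj_on_image_Int[OF \<phi> that(1,2)] that(3) by simp
  have nm: "\<phi> v \<notin> \<phi> ` A" if "A \<subseteq> V" "v \<in> V" "v \<notin> A" for A v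
    using inj_on_image_mem_iff[OF \<phi> that(2,1)] that(3) by simp
  let ?X = "insert y (X1 \<union> X2 \<union> X3)"
  let ?P = "(P1 - {\<phi> x1}) \<union> (P2 - {\<phi> x2}) \<union> (P3 - {\<phi> x3})"
  have ij: "induced_edges E ?X = induced_edges E X1 \<union> induced_edges E X2 \<union> induced_edges E X3
      \<union> {{y, x1}, {y, x2}, {y, x3}}"
    using j x1(2) x2(2) x3(2) x1(1) x2(1) x3(1) by (rule induced_join)
  have "pgen (R1 \<union> R2 \<union> R3) ?P (insert (\<phi> y) (\<phi> ` X1 \<union> \<phi> ` X2 \<union> \<phi> ` X3))
    ((\<lambda>e. \<phi> ` e) ` induced_edges E X1 \<union> (\<lambda>e. \<phi> ` e) ` induced_edges E X2 \<union> (\<lambda>e. \<phi> ` e) ` induced_edges E X3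
      \<union> {{\<phi> y, \<phi> x1}, {\<phi> y, \<phi> x2}, {\<phi> y, \<phi> x3}})"
    by (rule pgen_join[OF 1(1) 2(1) 3(1)]) (use dis nm sub dj xp in auto)
  moreover have "insert (\<phi> y) (\<phi> ` X1 \<union> \<phi> ` X2 \<union> \<phi> ` X3) = \<phi> ` ?X" by (simp add: image_Un)
  moreover have "(\<lambda>e. \<phi> ` e) ` induced_edges E X1 \<union> (\<lambda>e. \<phi> ` e) ` induced_edges E X2 \<union> (\<lambda>e. \<phi> ` e) ` induced_edges E X3
      \<union> {{\<phi> y, \<phi> x1}, {\<phi> y, \<phi> x2}, {\<phi> y, \<phi> x3}} = (\<lambda>e. \<phi> ` e) ` induced_edges E ?X"
    unfolding ij image_Un by simp
  ultimately have p: "pgen (R1 \<union> R2 \<union> R3) ?P (\<phi> ` ?X) ((\<lambda>e. \<phi> ` e) ` induced_edges E ?X)" by simp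
  have inv: "P1 \<subseteq> \<phi> ` X1" "P2 \<subseteq> \<phi> ` X2" "P3 \<subseteq> \<phi> ` X3"
    using pgen_invariants[OF 1(1)] pgen_invariants[OF 2(1)] pgen_invariants[OF 3(1)] by auto
  have mono: "ecount {x} A \<le> ecount {x} ?X" if "A \<subseteq> ?X" for x A using that by (intro ecount_mono) auto
  have plus: "3 \<le> ecount {x} ?X" if "2 \<le> ecount {x} A" "adj x y" "y \<notin> A" "A \<subseteq> ?X" for x A
  proof -
    have "ecount {x} (insert y A) = ecount {x} {y} + ecount {x} A"
      using ecount_insert_right[OF that(3), of "{x}"] by (simp add: ecount_sym)
    then have "3 \<le> ecount {x} (insert y A)" using that by (simp add: ecount_single_single)
    moreover have "insert y A \<subseteq> ?X" using that(4) by blast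
    ultimately show ?thesis using mono order_trans by blast
  qed
  have y3: "3 \<le> ecount {y} ?X"
  proof -
    have "ecount {y} (X1 \<union> X2 \<union> X3) = ecount {y} (X1 \<union> X2) + ecount {y} X3"
      using dj by (intro ecount_Un_right) auto
    also have "ecount {y} (X1 \<union> X2) = ecount {y} X1 + ecount {y} X2"
      using dj by (intro ecount_Un_right) auto
    finally have "ecount {y} (X1 \<union> X2 \<union> X3) = 3" using ey by simp
    moreover have "X1 \<union> X2 \<union> X3 \<subseteq> ?X" by blast
    ultimately show ?thesis using mono by metis
  qed
  have A: "\<phi> x \<in> R1 \<union> R2 \<union> R3 \<union> ?P \<or> 3 \<le> ecount {x} ?X" if "x \<in> ?X" for x
  proof -
    \<comment> \<open>Only a used port is withdrawn. An unreplaced vertex of D that receives the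
      edge stays in \<open>R\<close>.\<close>
    have part: "\<phi> x \<in> R \<union> (P - {\<phi> z}) \<or> 3 \<le> ecount {x} ?X"
      if "x \<in> A" "z \<in> A" "A \<subseteq> ?X" "y \<notin> A" "adj z y" "A \<subseteq> V"
        "\<phi> x \<in> R \<union> P \<or> 3 \<le> ecount {x} A" "\<phi> x \<in> P \<Longrightarrow> 2 \<le> ecount {x} A" for A R P z
    proof (cases "x = z \<and> \<phi> x \<in> P")
      case True
      then show ?thesis using plus[of x A] that by auto
    next
      case False
      then show ?thesis using that mono[of A x] \<phi>eq[of x z] by fastforce
    qed
    consider "x = y" | "x \<in> X1" | "x \<in> X2" | "x \<in> X3" using \<open>x \<in> ?X\<close> by blast
    then show ?thesis
    proof cases
      case 1
      then show ?thesis using y3 by simp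
    next
      case 2
      have "\<phi> x \<in> R1 \<union> (P1 - {\<phi> x1}) \<or> 3 \<le> ecount {x} ?X"
        by (rule part[of X1]) (use 2 x1 dj yx sub 1 in auto)
      then show ?thesis by blast
    next
      case 3
      have "\<phi> x \<in> R2 \<union> (P2 - {\<phi> x2}) \<or> 3 \<le> ecount {x} ?X"
        by (rule part[of X2]) (use 3 x2 dj yx sub \<open>\<And>x. x \<in> X2 \<Longrightarrow> \<phi> x \<in> R2 \<union> P2 \<or> 3 \<le> ecount {x} X2\<close>
            \<open>\<And>x. x \<in> X2 \<Longrightarrow> \<phi> x \<in> P2 \<Longrightarrow> 2 \<le> ecount {x} X2\<close> in auto)
      then show ?thesis by blast
    next
      case 4
      have "\<phi> x \<in> R3 \<union> (P3 - {\<phi> x3}) \<or> 3 \<le> ecount {x} ?X"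
        by (rule part[of X3]) (use 4 x3 dj yx sub \<open>\<And>x. x \<in> X3 \<Longrightarrow> \<phi> x \<in> R3 \<union> P3 \<or> 3 \<le> ecount {x} X3\<close>
            \<open>\<And>x. x \<in> X3 \<Longrightarrow> \<phi> x \<in> P3 \<Longrightarrow> 2 \<le> ecount {x} X3\<close> in auto)
      then show ?thesis by blast
    qed
  qed
  have B: "2 \<le> ecount {x} ?X" if x: "x \<in> ?X" "\<phi> x \<in> ?P" for x
  proof -
    have xV: "x \<in> V" using x(1) join.prems by blast
    have mem: "x \<in> A" if "\<phi> x \<in> P" "P \<subseteq> \<phi> ` A" "A \<subseteq> V" for A P
      using nm[OF that(3) xV] that(1,2) by blast
    consider "\<phi> x \<in> P1" | "\<phi> x \<in> P2" | "\<phi> x \<in> P3" using x(2) by blast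
    then show ?thesis
    proof cases
      case 1
      then have "2 \<le> ecount {x} X1" using mem[OF 1 inv(1) sub(1)] \<open>\<And>x. x \<in> X1 \<Longrightarrow> \<phi> x \<in> P1 \<Longrightarrow> 2 \<le> ecount {x} X1\<close> by blast
      moreover have "X1 \<subseteq> ?X" by blast
      ultimately show ?thesis using mono order_trans by blast
    next
      case 2
      then have "2 \<le> ecount {x} X2" using mem[OF 2 inv(2) sub(2)] \<open>\<And>x. x \<in> X2 \<Longrightarrow> \<phi> x \<in> P2 \<Longrightarrow> 2 \<le> ecount {x} X2\<close> by blast
      moreover have "X2 \<subseteq> ?X" by blast
      ultimately show ?thesis using mono order_trans by blast
    next
      case 3
      then have "2 \<le> ecount {x} X3" using mem[OF 3 inv(3) sub(3)] \<open>\<And>x. x \<in> X3 \<Longrightarrow> \<phi> x \<in> P3 \<Longrightarrow> 2 \<le> ecount {x} X3\<close> by blast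
      moreover have "X3 \<subseteq> ?X" by blast
      ultimately show ?thesis using mono order_trans by blast
    qed
  qed
  show ?case using p A B by blast
qed

lemma calH_iso_to_calG:
  assumes "calH X" "X \<subseteq> V"
  shows "iso_to_calG X (induced_edges E X)"
proof -
  obtain \<phi> :: "'a \<Rightarrow> nat" where \<phi>: "inj_on \<phi> V"
    using finite_imp_inj_to_nat_seg[OF finite_V] by blast
  let ?F = "(\<lambda>e. \<phi> ` e) ` induced_edges E X"
  obtain R P where "pgen R P (\<phi> ` X) ?F" using calH_pgen[OF assms \<phi>] by blast
  then have G: "calG (\<phi> ` X) ?F" using pgen_gen unfolding calG_def by blast
  have \<phi>X: "inj_on \<phi> X" using \<phi> assms(2) inj_on_subset by blast
  have "{u, v} \<in> induced_edges E X \<longleftrightarrow> {\<phi> u, \<phi> v} \<in> ?F" if uv: "u \<in> X" "v \<in> X" for u v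
  proof
    assume "{u, v} \<in> induced_edges E X"
    then show "{\<phi> u, \<phi> v} \<in> ?F" by (metis image_empty image_insert imageI)
  next
    assume "{\<phi> u, \<phi> v} \<in> ?F"
    then obtain e where e: "e \<in> induced_edges E X" "\<phi> ` e = \<phi> ` {u, v}" by auto
    then have "e \<subseteq> X" by (simp add: induced_edges_def)
    then have "e = {u, v}" using inj_on_image_eq_iff[OF \<phi>X, of e "{u, v}"] e(2) uv by simp
    then show "{u, v} \<in> induced_edges E X" using e by simp
  qed
  then have "iso X (induced_edges E X) (\<phi> ` X) ?F"
    unfolding iso_def using \<phi>X by (intro exI[of _ \<phi>]) (auto simp: bij_betw_def)
  then show ?thesis using G unfolding iso_to_calG_def by blast
qed

section \<open>Bounds for connected sets, first those with a vertex of degree at most 2 and then the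
  cubic ones\<close>

lemma bounded_conn:
  assumes "X \<subseteq> V" "conn X" "\<exists>v\<in>X. ecount {v} X \<le> 2"
  shows "bounded X"
  using assms
proof (induction "card X" arbitrary: X rule: less_induct)
  case less
  note X = less.prems(1,2)
  have IH: "bounded Y" if Y: "Y \<subset> X" "conn Y" for Y
  proof (rule less.hyps)
    show "card Y < card X" using psubset_card_mono[OF finite_sub[OF X(1)] Y(1)] .
    show "\<exists>v\<in>Y. ecount {v} Y \<le> 2" using conn_sub_deg[OF X(2) Y(1) econn_nonempty[OF Y(2)]] .
  qed (use Y X in auto)
  show ?case
  proof (cases "\<exists>x. X = {x}")
    case True
    then show ?thesis using calH.single by (auto simp: bounded_def defic_def)
  next
    case False
    have pos: "1 \<le> ecount {v} X" if "v \<in> X" for v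
    proof -
      have "{v} \<subset> X" using that False by blast
      then have "1 \<le> ecount {v} (X - {v})" using econnD[OF X(2)] by simp
      then show ?thesis using ecount_self by simp
    qed
    show ?thesis
    proof (cases "\<exists>u\<in>X. ecount {u} X = 1")
      case True
      then show ?thesis using bounded_leaf[OF X _ _ IH] by blast
    next
      case no1: False
      have deg: "2 \<le> ecount {v} X" if "v \<in> X" for v
        using pos[OF that] no1 that by (metis One_nat_def Suc_1 le_antisym not_less_eq_eq)
      show ?thesis
      proof (cases "econn 2 X")
        case True
        obtain u where "u \<in> X" "ecount {u} X \<le> 2" using less.prems(3) by blast
        then have "u \<in> X" "ecount {u} X = 2" using deg by (auto intro: le_antisym)
        then show ?thesis using bounded_two_conn[OF X(1) True _ _ IH] by blast
      next
        case False
        show ?thesis by (rule bounded_bridge[OF X False deg IH])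
      qed
    qed
  qed
qed

text \<open>Without bridges, exactly three edges leave \<open>X - {x}\<close>. In a join each part
  would have two leaving edges and be a single vertex of degree 2, which a cubic graph lacks. So
  only a blob remains, its ports are the neighbours of \<open>x\<close>, and the vertex tables
  decide.\<close>

lemma cubic_bound:
  assumes X: "X \<subseteq> V" "conn X" and cubic: "\<And>v. v \<in> X \<Longrightarrow> ecount {v} X = 3"
  shows "defic X \<le> 1 \<or> defic X \<le> 2 \<and> iso_to_H12 X (induced_edges E X)"
proof -
  have IH: "bounded Y" if Y: "Y \<subset> X" "conn Y" for Y
    using bounded_conn conn_sub_deg[OF X(2) Y(1) econn_nonempty[OF Y(2)]] X Y by auto
  have IH1: "defic Y \<le> 1" if "Y \<subset> X" "conn Y" for Y
    using IH[OF that] by (simp add: bounded_def)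
  show ?thesis
  proof (cases "econn 2 X")
    case False
    have "bounded X" by (rule bounded_bridge[OF X False _ IH]) (use cubic in auto)
    then show ?thesis by (simp add: bounded_def)
  next
    case c2: True
    obtain x where x: "x \<in> X" using econn_nonempty[OF X(2)] by blast
    define Y where "Y = X - {x}"
    have YX: "Y \<subset> X" "X - Y = {x}" "X = insert x Y" "x \<notin> Y" using x by (auto simp: Y_def)
    have e3: "ecount {x} Y = 3" using cubic[OF x] ecount_self[of x X] by (simp add: Y_def)
    then have Yne: "Y \<noteq> {}" by auto
    have eY: "ecount Y (X - Y) = 3" using e3 YX(2) by (simp add: ecount_sym)
    then have cY: "conn Y" using conn_if_few_edges[OF c2 YX(1) Yne] by simp
    have bY: "bounded Y" by (rule IH[OF YX(1) cY])
    have dX: "defic X \<le> defic Y + 1" using defic_insert[of Y x] YX X by auto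
    show ?thesis
    proof (cases "defic X \<le> 1")
      case False
      then have HY: "calH Y" using dX bY by (auto simp: bounded_def)
      have "iso_to_H12 X (induced_edges E X)"
        using HY psubset_imp_subset[OF YX(1)] c2
      proof (cases rule: calH_cases)
        case (single z)
        then show ?thesis using e3 by (simp add: ecount_single_single split: if_splits)
      next
        case blob
        obtain es m ds f where b: "(es, m, ds) \<in> set blobs" "realizes es f Y" "card Y = 3 * m + 1"
          and lt: "\<And>v. v \<in> Y \<Longrightarrow> f v < 200" and inj: "inj_on f Y"
          and deg: "\<And>v. v \<in> Y \<Longrightarrow> ecount {v} Y = (if f v \<in> set ds then 2 else 3)"
          using bblobE[OF blob] by metis
        have nb: "adj x v \<longleftrightarrow> f v \<in> set ds" if v: "v \<in> Y" for v
        proof -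
          have "ecount {v} X = ecount {x} {v} + ecount {v} Y"
            using ecount_insert_right[OF YX(4), of "{v}"] YX(3) by simp
          then show ?thesis using cubic[of v] deg[OF v] v YX(3)
            by (auto simp: ecount_single_single split: if_splits)
        qed
        have img: "f ` Y = verts es" using b(2) by (simp add: realizes_def bij_betw_def)
        have "f ` {v \<in> Y. adj x v} = set ds"
        proof (intro equalityI subsetI)
          fix k assume k: "k \<in> set ds"
          then obtain v where "v \<in> Y" "k = f v" using blobs_facts(4)[OF b(1)] img by blast
          then show "k \<in> f ` {v \<in> Y. adj x v}" using nb k by blast
        qed (use nb in auto)
        moreover have "inj_on f {v \<in> Y. adj x v}" using inj by (auto simp: inj_on_def)
        ultimately have "card (set ds) = 3" using card_image[of f "{v \<in> Y. adj x v}"] e3 by (simp add: ecount_single)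
        then have len: "length ds = 3" using distinct_card[OF blobs_distinct[OF b(1)]] by simp
        have r: "realizes (es @ map (Pair 200) ds) (f(x := 200)) (insert x Y)"
        proof (rule realizes_insert[OF b(2) YX(4)])
          show "200 \<notin> verts es" using blobs_facts(3)[OF b(1), of 200] by auto
          show "set ds \<subseteq> verts es" using blobs_facts(4)[OF b(1)] .
          show "ds \<noteq> []" using len by auto
        qed (rule nb)
        have cX: "card X = 3 * m + 2"
          using b(3) YX(3,4) finite_subset[OF _ finite_V, of Y] X(1) YX(1) by auto
        from vertex_table[OF b(1) len] show ?thesis
        proof
          assume "\<exists>w. check (m + 1) (es @ map (Pair 200) ds) w"
          then have "m + 1 \<le> nu X \<or> bblob X" using check_sound[OF r] YX(3) by auto
          then show ?thesis
          proof
            assume "m + 1 \<le> nu X"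
            then show ?thesis using False cX by (simp add: defic_def)
          next
            \<comment> \<open>Impossible modulo 3: the order of \<open>X\<close> is
              \<open>3 * m + 2\<close>, while blobs have order congruent to 1.\<close>
            assume "bblob X"
            then show ?thesis using cX by (elim bblobE) presburger
          qed
        next
          assume "\<exists>es'\<in>{H1_edges, H2_edges}. \<exists>ps. iso_check (es @ map (Pair 200) ds) es' ps"
          then obtain es' g where es': "es' \<in> {H1_edges, H2_edges}" "realizes es' g X"
            using realizes_iso_check[OF r] YX(3) by metis
          then have "iso X (induced_edges E X) (fst (mk_graph es')) (snd (mk_graph es'))"
            using iso_mk_graph by blast
          then show ?thesis
            using es'(1) unfolding iso_to_H12_def graph_H1_def graph_H2_def by auto
        qed
      next
        case (join y X1 X2 X3)
        have ne: "X1 \<noteq> {}" "X2 \<noteq> {}" "X3 \<noteq> {}" using join calH_nonempty by auto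
        have e2: "ecount X1 (X - X1) = 2"
          by (rule joined_parts[OF join(1,5) psubset_imp_subset[OF YX(1)] c2 ne]) (use eY in linarith)
        have X1X: "X1 \<subset> X" using join(5) YX by auto
        have "0 < defic X" using False by simp
        then obtain z where z: "X1 = {z}" using calH_two_out[OF join(2) X1X e2 X(1) c2 IH1] by auto
        then have "ecount {z} X = 3" using cubic X1X by blast
        then show ?thesis using e2 z ecount_self[of z X] by simp
      qed
      moreover have "defic X \<le> 2" using dX bY by (simp add: bounded_def)
      ultimately show ?thesis by simp
    qed simp
  qed
qed

end

section \<open>Summation over the components\<close>

lemma (in subcubic) nu_V: "nu V = ur_matching_number E"
proof -
  have "{M. uniquely_restricted E M \<and> \<Union>M \<subseteq> V} = {M. uniquely_restricted E M}"
  proof -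
    have "\<Union>M \<subseteq> V" if "uniquely_restricted E M" for M
    proof -
      have "e \<subseteq> V" if "e \<in> E" for e
        using graph that unfolding graph_def by fastforce
      then show ?thesis using that by (meson Sup_least matching_def subsetD uniquely_restricted_def)
    qed
    then show ?thesis by blast
  qed
  then show ?thesis by (simp add: nu_def ur_matching_number_def)
qed

context subcubic
begin

lemma component_conn:
  assumes "C \<in> components V E"
  shows "C \<subseteq> V" "conn C" "\<And>v w. v \<in> C \<Longrightarrow> adj v w \<Longrightarrow> w \<in> C"
proof -
  obtain c where c: "c \<in> V" "C = {w \<in> V. reach E c w}" using assms by (auto simp: components_def)
  show "C \<subseteq> V" using c by auto
  show closed: "w \<in> C" if "v \<in> C" "adj v w" for v w
  proof -
    have "reach E c v" using that c by auto
    then have "reach E c w" unfolding reach_def using that(2) by (rule rtranclp.rtrancl_into_rtrancl)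
    then show ?thesis using c adj_V[OF that(2)] by simp
  qed
  have rc: "reach E c c" by (simp add: reach_def)
  show "conn C"
    unfolding econn_def
  proof (intro conjI allI impI)
    show "C \<noteq> {}" using c rc by auto
    fix Z assume Z: "Z \<subset> C \<and> Z \<noteq> {}"
    show "Suc 0 \<le> ecount Z (C - Z)"
    proof (rule ccontr)
      assume "\<not> ?thesis"
      then have "ecount Z (C - Z) = 0" by simp
      then have no: "\<not> adj z w" "\<not> adj w z" if "z \<in> Z" "w \<in> C - Z" for z w
        using that adj_sym unfolding ecount_eq_0 by blast+
      have inC: "v \<in> C" if "reach E c v" for v
        using that unfolding reach_def
      proof (induction rule: rtranclp_induct)
        case base
        show ?case using c rc by simp
      next
        case (step v w)
        show ?case by (rule closed[OF step(3,2)])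
      qed
      have same: "v \<in> Z \<longleftrightarrow> c \<in> Z" if "reach E c v" for v
        using that unfolding reach_def
      proof (induction rule: rtranclp_induct)
        case (step v w)
        have v: "v \<in> C" by (rule inC) (use step(1) in \<open>simp add: reach_def\<close>)
        have "w \<in> C" by (rule closed[OF v step(2)])
        then have "v \<in> Z \<longleftrightarrow> w \<in> Z" using v no[of v w] no[of w v] step(2) by blast
        then show ?case using step by simp
      qed simp
      have "v \<in> Z \<longleftrightarrow> c \<in> Z" if "v \<in> C" for v using same that c by blast
      then show False using Z by blast
    qed
  qed
qed

lemma components_partition: "\<Union>(components V E) = V" "finite (components V E)"
  "C \<in> components V E \<Longrightarrow> C' \<in> components V E \<Longrightarrow> C \<noteq> C' \<Longrightarrow> C \<inter> C' = {}"
proof -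
  show "\<Union>(components V E) = V" by (auto simp: components_def reach_def)
  have "components V E = (\<lambda>v. {w \<in> V. reach E v w}) ` V" by (auto simp: components_def)
  then show "finite (components V E)" using finite_V by simp
  show "C \<inter> C' = {}" if C: "C \<in> components V E" "C' \<in> components V E" "C \<noteq> C'"
  proof (rule ccontr)
    assume "C \<inter> C' \<noteq> {}"
    then obtain v where v: "v \<in> C" "v \<in> C'" by blast
    have sub: "D \<subseteq> D'" if D: "D \<in> components V E" "D' \<in> components V E" "v \<in> D" "v \<in> D'" for D D'
    proof (rule ccontr)
      assume "\<not> D \<subseteq> D'"
      then have "D \<inter> D' \<subset> D" "D \<inter> D' \<noteq> {}" using D by auto
      then obtain a b where "a \<in> D \<inter> D'" "b \<in> D - D \<inter> D'" "adj a b"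
        by (rule conn_edge_out[OF component_conn(2)[OF D(1)]])
      then show False using component_conn(3)[OF D(2), of a b] by blast
    qed
    show False using sub[of C C'] sub[of C' C] C v by blast
  qed
qed

lemma defic_components: "S \<subseteq> components V E \<Longrightarrow> defic (\<Union>S) \<le> (\<Sum>C\<in>S. defic C)"
proof -
  assume S: "S \<subseteq> components V E"
  have "finite S" using S components_partition(2) finite_subset by blast
  then show ?thesis using S
  proof (induction S rule: finite_induct)
    case empty
    then show ?case using defic_empty by simp
  next
    case (insert C S)
    have C: "C \<in> components V E" and S: "S \<subseteq> components V E" using insert.prems by auto
    have dj: "C \<inter> \<Union>S = {}" using components_partition(3)[OF C] S insert.hyps(2) by blast
    have "\<Union>S \<subseteq> V" using S component_conn(1) by blast
    then have "defic (C \<union> \<Union>S) \<le> defic C + defic (\<Union>S)"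
    proof (intro defic_parts)
      show "ecount C (\<Union>S) = 0"
        unfolding ecount_eq_0 using component_conn(3)[OF C] dj by blast
    qed (use component_conn(1)[OF C] dj in auto)
    then show ?case using insert.IH[OF S] insert.hyps by simp
  qed
qed

lemma component_bound:
  assumes C: "C \<in> components V E"
  shows "defic C \<le> (if iso_to_calG C (induced_edges E C) then 1 else 0)
    + (if in_calG3 C (induced_edges E C) then 1 else 0)
    + (if iso_to_H12 C (induced_edges E C) then 1 else 0)"
proof (cases "\<exists>v\<in>C. ecount {v} C \<le> 2")
  case True
  have b: "bounded C" using bounded_conn component_conn[OF C] True by blast
  then show ?thesis
    using calH_iso_to_calG[OF _ component_conn(1)[OF C]] by (auto simp: bounded_def)
next
  case False
  have cubic: "ecount {v} C = 3" if "v \<in> C" for v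
    using False that ecount_single_le[of v C] by (metis Suc_leI le_antisym not_le numeral_2_eq_2 numeral_3_eq_3)
  have "in_calG3 C (induced_edges E C)"
    unfolding in_calG3_def
  proof (intro conjI ballI)
    have fin: "finite C" using component_conn(1)[OF C] finite_sub by blast
    have "\<exists>u v. e = {u, v} \<and> u \<noteq> v \<and> u \<in> C \<and> v \<in> C" if "e \<in> induced_edges E C" for e
    proof -
      have "e \<in> E" using that by (simp add: induced_edges_def)
      then obtain u v where "e = {u, v}" "u \<noteq> v" using edge_card[of e] unfolding card_2_iff by blast
      then show ?thesis using that by (auto simp: induced_edges_def)
    qed
    then show "graph C (induced_edges E C)" using fin by (simp add: graph_def)
    show "girth_ge (induced_edges E C) 5"
      using girth unfolding girth_ge_def is_cycle_def induced_edges_def by blast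
    fix v assume v: "v \<in> C"
    have "{u. {u, v} \<in> induced_edges E C} = {w \<in> C. adj v w}"
      using v by (auto simp: induced_edges_def insert_commute)
    then show "degree (induced_edges E C) v = 3"
      using cubic[OF v] by (simp add: degree_def ecount_single)
  qed
  \<comment> \<open>Deficiency 2 is covered because such a component is cubic and isomorphic to H1
    or H2, so it is counted by two of the three terms.\<close>
  then show ?thesis using cubic_bound[OF component_conn(1,2)[OF C] cubic] by auto
qed

end

theorem theorem3:
  fixes V :: "'a set" and E :: "'a set set"
  assumes "graph V E"
    and "max_degree_le V E 3"
    and "girth_ge E 5"
  shows "real (ur_matching_number E) \<ge>
    (real (card V) - real (kappa V E iso_to_calG) - real (kappa V E in_calG3)
       - real (kappa V E iso_to_H12)) / 3"
proof -
  interpret subcubic V E using assms by unfold_locales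
  have fin: "finite (components V E)" by (rule components_partition(2))
  have k: "(\<Sum>C\<in>components V E. if P C (induced_edges E C) then 1 else 0 :: int) = int (kappa V E P)"
    for P :: "'a set \<Rightarrow> 'a set set \<Rightarrow> bool"
    using fin unfolding kappa_def by (simp add: sum.If_cases Int_def)
  have "defic V \<le> (\<Sum>C\<in>components V E. defic C)"
    using defic_components[of "components V E"] components_partition(1) by simp
  also have "\<dots> \<le> (\<Sum>C\<in>components V E. (if iso_to_calG C (induced_edges E C) then 1 else 0)
    + (if in_calG3 C (induced_edges E C) then 1 else 0)
    + (if iso_to_H12 C (induced_edges E C) then 1 else 0))"
    by (rule sum_mono) (rule component_bound)
  also have "\<dots> = int (kappa V E iso_to_calG) + int (kappa V E in_calG3) + int (kappa V E iso_to_H12)"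
    by (simp add: sum.distrib k)
  finally have "int (card V) \<le> 3 * int (ur_matching_number E) + int (kappa V E iso_to_calG)
      + int (kappa V E in_calG3) + int (kappa V E iso_to_H12)"
    by (simp add: defic_def nu_V)
  then have "card V \<le> 3 * ur_matching_number E + kappa V E iso_to_calG + kappa V E in_calG3 + kappa V E iso_to_H12"
    by linarith
  then have "real (card V) \<le> real (3 * ur_matching_number E + kappa V E iso_to_calG + kappa V E in_calG3 + kappa V E iso_to_H12)"
    by (simp only: of_nat_le_iff)
  then show ?thesis by (simp add: field_simps)
qed

end
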